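(* Let $\alpha\in(0,1)$. For each $n$ let $(\mathbf X_i,y_i)_{i=1}^n$ be independent copies of $(\mathbf X,y)$ with $y=\langle\mathbf X,\boldsymbol\Theta^*\rangle_{\mathrm{HS}}+\epsilon$, where $\boldsymbol\Theta^*\in\mathbb R^{d_1\times d_2}$, $d_1\le d_2=:d$, $\mathrm{vec}(\mathbf X)$ is sub-Gaussian with parameter $K_x$, mean zero and covariance matrix $\boldsymbol\Sigma\in\mathbb R^{d_1d_2\times d_1d_2}$, and $\epsilon$ is sub-Gaussian with parameter $K_\epsilon$, mean zero, variance $\sigma_\epsilon^2$, and independent of $\mathbf X$. Let $\tilde r\ge1$ be an integer (possibly different from $r^*=\mathrm{rank}(\boldsymbol\Theta^* )$) and let $$\tilde{\boldsymbol\Theta}=\tilde{\boldsymbol\Theta}(\tilde r)=\mathop{\mathrm{argmin}}_{\boldsymbol\Theta\in\mathbb R^{d_1\times d_2},\ \mathrm{rank}(\boldsymbol\Theta)\le\tilde r}\mathbb E\langle\mathbf X,\boldsymbol\Theta^*-\boldsymbol\Theta\rangle_{\mathrm{HS}}^2,$$ with $\tilde{\boldsymbol\Theta}=\boldsymbol\Theta^*$ if $\tilde r\ge r^*$. Let $\phi(\hat f_{L_0})$ be the permutation p-value based on the rank-constrained least-squares estimator with rank constraint $r=\tilde r$. Then under $H_0:\boldsymbol\Theta^*=\mathbf 0$, $$\limsup_{n\to\infty}\mathbb P_{H_0}(\phi(\hat f_{L_0})\le\alpha)\le\alpha.$$ In addition, if $h>0$ is sufficiently large (not depending on $n$), then $$\liminf_{n\to\infty}\mathbb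 P_{H_1}(\phi(\hat f_{L_0})\le\alpha)>\alpha$$ under the alternative $$H_1:\ \mathrm{vec}(\tilde{\boldsymbol\Theta})^\top\boldsymbol\Sigma\,\mathrm{vec}(\tilde{\boldsymbol\Theta})=h\Big(\frac1{\sqrt n}+\frac{\tilde r d\log(n)}{n}\Big),$$ and also under the alternative $$H_1:\ \mathrm{vec}(\tilde{\boldsymbol\Theta})^\top\boldsymbol\Sigma\,\mathrm{vec}(\tilde{\boldsymbol\Theta})=h\,\frac{\tilde r d\log(n)}{n}$$ provided that in addition there exists $\kappa>0$ such that $\|\langle\mathrm{vec}(\mathbf X),\mathbf v\rangle\|_{\psi_2}^2\le\kappa\,\mathbb E\langle\mathrm{vec}(\mathbf X),\mathbf v\rangle^2$ for all $\mathbf v\in\mathbb R^{d_1d_2}$.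
   Context: $\langle\mathbf A,\mathbf B\rangle_{\mathrm{HS}}=\mathrm{tr}(\mathbf A^\top\mathbf B)$; $\mathrm{vec}$ is vectorization. $\|\xi\|_{\psi_2}=\inf\{t>0:\mathbb E\exp(\xi^2/t^2)\le2\}$; a real random variable $\xi$ is sub-Gaussian with parameter $K$ if $\|\xi\|_{\psi_2}\le K$, and a random vector $\boldsymbol\xi$ is if $\sup_{\|\mathbf v\|_2=1}\|\langle\boldsymbol\xi,\mathbf v\rangle\|_{\psi_2}\le K$. $\Pi_n$ is the set of permutations of $\{1,\dots,n\}$ and $\pi_0$ the identity. For $\pi\in\Pi_n$, $\hat{\boldsymbol\Theta}^{(\pi)}_{L_0}$ is a minimizer of $\sum_{i=1}^n(y_{\pi(i)}-\langle\mathbf X_i,\boldsymbol\Theta\rangle_{\mathrm{HS}})^2$ over $\boldsymbol\Theta\in\mathbb R^{d_1\times d_2}$ with $\mathrm{rank}(\boldsymbol\Theta)\le r$, chosen by a fixed rule depending only on the data $(\mathbf X_j,y_{\pi(j)})_{j=1}^n$. Put $\Lambda^{(\pi)}=\sum_{i=1}^n\langle\mathbf X_i,\hat{\boldsymbol\Theta}^{(\pi)}_{L_0}\rangle_{\mathrm{HS}}^2$ and $\phi(\hat f_{L_0})=\frac1{|\Pi_n|}\sum_{\pi\in\Pi_n}\mathbf 1\{\Lambda^{(\pi_0)}\le\Lambda^{(\pi)}\}$. Dimensions, ranks, $\boldsymbol\Theta^*$ and $\boldsymbol\Sigma$ may vary with $n$; $K_x$, $K_\epsilon$, $\sigma_\epsilon^2$,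 $\kappa$ and bounds on the Frobenius norms of $\boldsymbol\Theta^*$ and $\tilde{\boldsymbol\Theta}$ do not depend on $n$. "$h$ sufficiently large (not depending on $n$)" means: there is a threshold $h_0$ not depending on $n$ such that the conclusion holds for every fixed $h\ge h_0$. *)

theory Defs
  imports "HOL-Probability.Probability" "Jordan_Normal_Form.DL_Rank"
begin

text \<open>
  All dimensions may grow with the sample size, so vectors and matrices are those of
  \<^theory>\<open>Jordan_Normal_Form.Matrix\<close>, whose dimensions are values rather than types.
\<close>

unbundle no inner_syntax
unbundle no vec_syntax

definition mat_trace :: "real mat \<Rightarrow> real" where
  "mat_trace A = (\<Sum>i<dim_row A. A $$ (i, i))"

definition hs_inner :: "real mat \<Rightarrow> real mat \<Rightarrow> real" where
  "hs_inner A B = mat_trace (transpose_mat A * B)"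

definition frobenius_norm :: "real mat \<Rightarrow> real" where
  "frobenius_norm A = sqrt (hs_inner A A)"

text \<open>Column stacking.\<close>

definition vectorize :: "real mat \<Rightarrow> real Matrix.vec" where
  "vectorize A =
     Matrix.vec (dim_row A * dim_col A) (\<lambda>k. A $$ (k mod dim_row A, k div dim_row A))"

abbreviation mat_rank :: "real mat \<Rightarrow> nat" where
  "mat_rank A \<equiv> vec_space.rank (dim_row A) A"

definition low_rank_mats :: "nat \<Rightarrow> nat \<Rightarrow> nat \<Rightarrow> real mat set" where
  "low_rank_mats d1 d2 r = {A \<in> carrier_mat d1 d2. mat_rank A \<le> r}"

text \<open>The Borel \<open>\<sigma>\<close>-algebra on the space of real \<open>d1 \<times> d2\<close> matrices, generated by the entries.\<close>

definition mat_borel :: "nat \<Rightarrow> nat \<Rightarrow> real mat measure" where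
  "mat_borel d1 d2 =
     vimage_algebra (carrier_mat d1 d2) (\<lambda>A. \<lambda>ij\<in>{..<d1} \<times> {..<d2}. A $$ ij)
       (Pi\<^sub>M ({..<d1} \<times> {..<d2}) (\<lambda>_. borel))"

lemma measurable_mat_borel_iff:
  "X \<in> measurable M (mat_borel d1 d2) \<longleftrightarrow>
     (\<forall>\<omega>\<in>space M. X \<omega> \<in> carrier_mat d1 d2) \<and>
     (\<forall>i<d1. \<forall>j<d2. (\<lambda>\<omega>. X \<omega> $$ (i, j)) \<in> borel_measurable M)"
proof -
  let ?I = "{..<d1} \<times> {..<d2}"
  let ?f = "\<lambda>A::real mat. \<lambda>ij\<in>?I. A $$ ij"
  let ?P = "Pi\<^sub>M ?I (\<lambda>_. borel) :: (nat \<times> nat \<Rightarrow> real) measure"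
  have f: "?f \<in> carrier_mat d1 d2 \<rightarrow> space ?P"
    by (auto simp: space_PiM)
  have sp: "space (mat_borel d1 d2) = carrier_mat d1 d2"
    by (simp add: mat_borel_def)
  show ?thesis
  proof (intro iffI conjI ballI allI impI)
    assume X: "X \<in> measurable M (mat_borel d1 d2)"
    show "X \<omega> \<in> carrier_mat d1 d2" if "\<omega> \<in> space M" for \<omega>
      using measurable_space[OF X that] sp by simp
    show "(\<lambda>\<omega>. X \<omega> $$ (i, j)) \<in> borel_measurable M" if "i < d1" "j < d2" for i j
    proof -
      have "(\<lambda>\<omega>. ?f (X \<omega>)) \<in> measurable M ?P"
        using measurable_compose[OF X, of ?f ?P] measurable_vimage_algebra1[OF f]
        by (simp add: mat_borel_def)
      from measurable_compose[OF this measurable_component_singleton[of "(i, j)"]]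
      show ?thesis using that by simp
    qed
  next
    assume A: "(\<forall>\<omega>\<in>space M. X \<omega> \<in> carrier_mat d1 d2) \<and>
      (\<forall>i<d1. \<forall>j<d2. (\<lambda>\<omega>. X \<omega> $$ (i, j)) \<in> borel_measurable M)"
    have "(\<lambda>\<omega>. ?f (X \<omega>)) \<in> measurable M ?P"
      using A by (intro measurable_restrict) auto
    then show "X \<in> measurable M (mat_borel d1 d2)"
      unfolding mat_borel_def using A by (intro measurable_vimage_algebra2) auto
  qed
qed

text \<open>The value is \<open>\<infinity>\<close> if no admissible \<open>t\<close> exists.\<close>

definition psi2_norm :: "'w measure \<Rightarrow> ('w \<Rightarrow> real) \<Rightarrow> ereal" where
  "psi2_norm M \<xi> =
     (INF t\<in>{t. 0 < t \<and> (\<integral>\<^sup>+\<omega>. ennreal (exp ((\<xi> \<omega>)\<^sup>2 / t\<^sup>2)) \<partial>M) \<le> 2}. ereal t)"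

definition subgaussian :: "'w measure \<Rightarrow> real \<Rightarrow> ('w \<Rightarrow> real) \<Rightarrow> bool" where
  "subgaussian M K \<xi> \<longleftrightarrow> psi2_norm M \<xi> \<le> ereal K"

definition subgaussian_vec ::
    "'w measure \<Rightarrow> nat \<Rightarrow> real \<Rightarrow> ('w \<Rightarrow> real Matrix.vec) \<Rightarrow> bool" where
  "subgaussian_vec M N K \<xi> \<longleftrightarrow>
     (SUP v\<in>{v \<in> carrier_vec N. sqrt (v \<bullet> v) = 1}. psi2_norm M (\<lambda>\<omega>. \<xi> \<omega> \<bullet> v)) \<le> ereal K"

definition mean_vec :: "'w measure \<Rightarrow> nat \<Rightarrow> ('w \<Rightarrow> real Matrix.vec) \<Rightarrow> real Matrix.vec" where
  "mean_vec M N \<xi> = Matrix.vec N (\<lambda>k. \<integral>\<omega>. \<xi> \<omega> $ k \<partial>M)"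

definition covariance_mat :: "'w measure \<Rightarrow> nat \<Rightarrow> ('w \<Rightarrow> real Matrix.vec) \<Rightarrow> real mat" where
  "covariance_mat M N \<xi> = mat N N (\<lambda>(k, l).
     \<integral>\<omega>. (\<xi> \<omega> $ k - mean_vec M N \<xi> $ k) * (\<xi> \<omega> $ l - mean_vec M N \<xi> $ l) \<partial>M)"

text \<open>
  One instance of the model, for a single sample size.  \<open>X_pop\<close> and \<open>eps_pop\<close> are the population
  covariate and noise, \<open>X_smp i\<close> and \<open>y_smp i\<close> the \<open>i\<close>-th observation; \<open>rk\<close> is the rank constraint
  and \<open>est\<close> the rule that maps a data set to a parameter matrix.
\<close>

record 'w trace_regression =
  Pr :: "'w measure"
  nrow :: nat
  ncol :: nat
  rk :: nat
  Theta_star :: "real mat"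
  Theta_tilde :: "real mat"
  Sigma :: "real mat"
  X_pop :: "'w \<Rightarrow> real mat"
  eps_pop :: "'w \<Rightarrow> real"
  X_smp :: "nat \<Rightarrow> 'w \<Rightarrow> real mat"
  y_smp :: "nat \<Rightarrow> 'w \<Rightarrow> real"
  est :: "(nat \<Rightarrow> real mat \<times> real) \<Rightarrow> real mat"

definition y_pop :: "'w trace_regression \<Rightarrow> 'w \<Rightarrow> real" where
  "y_pop S \<omega> = hs_inner (X_pop S \<omega>) (Theta_star S) + eps_pop S \<omega>"

text \<open>
  The argument of the estimation rule is made extensional, so that the rule sees exactly the
  \<open>n\<close> pairs of covariate and permuted response.
\<close>

definition perm_data ::
    "nat \<Rightarrow> 'w trace_regression \<Rightarrow> (nat \<Rightarrow> nat) \<Rightarrow> 'w \<Rightarrow> nat \<Rightarrow> real mat \<times> real" where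
  "perm_data n S \<pi> \<omega> = (\<lambda>j\<in>{1..n}. (X_smp S j \<omega>, y_smp S (\<pi> j) \<omega>))"

definition Theta_hat ::
    "nat \<Rightarrow> 'w trace_regression \<Rightarrow> (nat \<Rightarrow> nat) \<Rightarrow> 'w \<Rightarrow> real mat" where
  "Theta_hat n S \<pi> \<omega> = est S (perm_data n S \<pi> \<omega>)"

definition least_squares_min ::
    "nat \<Rightarrow> 'w trace_regression \<Rightarrow> (nat \<Rightarrow> nat) \<Rightarrow> 'w \<Rightarrow> real mat \<Rightarrow> bool" where
  "least_squares_min n S \<pi> \<omega> \<Theta> \<longleftrightarrow>
     is_arg_min (\<lambda>\<Theta>'. \<Sum>i=1..n. (y_smp S (\<pi> i) \<omega> - hs_inner (X_smp S i \<omega>) \<Theta>')\<^sup>2)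
       (\<lambda>\<Theta>'. \<Theta>' \<in> low_rank_mats (nrow S) (ncol S) (rk S)) \<Theta>"

text \<open>
  For some data sets the infimum over the matrices of bounded rank is not attained; that the
  estimator is a minimizer is therefore required almost surely.
\<close>

definition trace_regression_model ::
    "real \<Rightarrow> real \<Rightarrow> real \<Rightarrow> nat \<Rightarrow> 'w trace_regression \<Rightarrow> bool" where
  "trace_regression_model K\<^sub>x K\<^sub>\<epsilon> \<sigma> n S \<longleftrightarrow>
     prob_space (Pr S) \<and>
     1 \<le> nrow S \<and> nrow S \<le> ncol S \<and> 1 \<le> rk S \<and>
     Theta_star S \<in> carrier_mat (nrow S) (ncol S) \<and>
     X_pop S \<in> measurable (Pr S) (mat_borel (nrow S) (ncol S)) \<and>
     subgaussian_vec (Pr S) (nrow S * ncol S) K\<^sub>x (\<lambda>\<omega>. vectorize (X_pop S \<omega>)) \<and>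
     mean_vec (Pr S) (nrow S * ncol S) (\<lambda>\<omega>. vectorize (X_pop S \<omega>)) = 0\<^sub>v (nrow S * ncol S) \<and>
     Sigma S = covariance_mat (Pr S) (nrow S * ncol S) (\<lambda>\<omega>. vectorize (X_pop S \<omega>)) \<and>
     eps_pop S \<in> borel_measurable (Pr S) \<and>
     subgaussian (Pr S) K\<^sub>\<epsilon> (eps_pop S) \<and>
     prob_space.expectation (Pr S) (eps_pop S) = 0 \<and>
     prob_space.variance (Pr S) (eps_pop S) = \<sigma>\<^sup>2 \<and>
     prob_space.indep_set (Pr S)
       (sets (vimage_algebra (space (Pr S)) (X_pop S) (mat_borel (nrow S) (ncol S))))
       (sets (vimage_algebra (space (Pr S)) (eps_pop S) borel)) \<and>
     prob_space.indep_vars (Pr S) (\<lambda>_. mat_borel (nrow S) (ncol S) \<Otimes>\<^sub>M borel)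
       (\<lambda>i \<omega>. (X_smp S i \<omega>, y_smp S i \<omega>)) {1..n} \<and>
     (\<forall>i\<in>{1..n}.
        distr (Pr S) (mat_borel (nrow S) (ncol S) \<Otimes>\<^sub>M borel) (\<lambda>\<omega>. (X_smp S i \<omega>, y_smp S i \<omega>)) =
        distr (Pr S) (mat_borel (nrow S) (ncol S) \<Otimes>\<^sub>M borel) (\<lambda>\<omega>. (X_pop S \<omega>, y_pop S \<omega>))) \<and>
     (AE \<omega> in Pr S. \<forall>\<pi>. \<pi> permutes {1..n} \<longrightarrow>
        least_squares_min n S \<pi> \<omega> (Theta_hat n S \<pi> \<omega>))"

definition best_rank_approx :: "'w trace_regression \<Rightarrow> bool" where
  "best_rank_approx S \<longleftrightarrow>
     is_arg_min (\<lambda>\<Theta>. \<integral>\<omega>. (hs_inner (X_pop S \<omega>) (Theta_star S - \<Theta>))\<^sup>2 \<partial>Pr S)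
       (\<lambda>\<Theta>. \<Theta> \<in> low_rank_mats (nrow S) (ncol S) (rk S)) (Theta_tilde S) \<and>
     (mat_rank (Theta_star S) \<le> rk S \<longrightarrow> Theta_tilde S = Theta_star S)"

definition signal :: "'w trace_regression \<Rightarrow> real" where
  "signal S = vectorize (Theta_tilde S) \<bullet> (Sigma S *\<^sub>v vectorize (Theta_tilde S))"

definition psi2_moment_equiv :: "real \<Rightarrow> 'w trace_regression \<Rightarrow> bool" where
  "psi2_moment_equiv \<kappa> S \<longleftrightarrow>
     (\<forall>v\<in>carrier_vec (nrow S * ncol S).
        (psi2_norm (Pr S) (\<lambda>\<omega>. vectorize (X_pop S \<omega>) \<bullet> v))\<^sup>2
          \<le> ereal (\<kappa> * (\<integral>\<omega>. (vectorize (X_pop S \<omega>) \<bullet> v)\<^sup>2 \<partial>Pr S)))"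

definition Lambda :: "nat \<Rightarrow> 'w trace_regression \<Rightarrow> (nat \<Rightarrow> nat) \<Rightarrow> 'w \<Rightarrow> real" where
  "Lambda n S \<pi> \<omega> = (\<Sum>i=1..n. (hs_inner (X_smp S i \<omega>) (Theta_hat n S \<pi> \<omega>))\<^sup>2)"

definition p_value :: "nat \<Rightarrow> 'w trace_regression \<Rightarrow> 'w \<Rightarrow> real" where
  "p_value n S \<omega> =
     (\<Sum>\<pi> | \<pi> permutes {1..n}. of_bool (Lambda n S id \<omega> \<le> Lambda n S \<pi> \<omega>))
       / real (card {\<pi>. \<pi> permutes {1..n}})"

text \<open>
  The estimation rule is not assumed to be measurable.  Almost surely \<open>Lambda n S \<pi>\<close> is the
  squared norm of the permuted response minus the minimal residual sum of squares, hence it is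
  measurable up to a null set; the completed measure is defined on the event below and agrees
  with \<open>Pr S\<close> whenever the event is \<open>Pr S\<close>-measurable.
\<close>

definition reject_prob :: "real \<Rightarrow> nat \<Rightarrow> 'w trace_regression \<Rightarrow> real" where
  "reject_prob \<alpha> n S = measure (completion (Pr S)) {\<omega> \<in> space (Pr S). p_value n S \<omega> \<le> \<alpha>}"

end

theory Submission
  imports Defs
begin

text \<open>
  Write \<open>L \<pi>\<close> for the supremum of \<open>2 * (y\<^sub>\<pi> \<bullet> w) - w \<bullet> w\<close> over the vectors \<open>w\<close> of fitted values
  \<open>\<langle>X\<^sub>i, \<Theta>\<rangle>\<close>, with \<open>\<Theta>\<close> of rank at most \<open>r\<close>.  Because the matrices of bounded rank form a cone, a
  minimizer of the residual sum of squares satisfies \<open>y\<^sub>\<pi> \<bullet> w = w \<bullet> w\<close>, so that \<open>\<Lambda>\<^sup>(\<^sup>\<pi>\<^sup>) = L \<pi>\<close>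
  (\<open>least_squares_fitted_norm\<close>).  The rule that selects the minimizer thus disappears, and \<open>L \<pi>\<close> is
  measurable, because the supremum may be restricted to a countable dense set of pairs of factors.

  Level.  If \<open>\<Theta>\<^sup>* = 0\<close>, then the responses are independent and identically distributed and independent
  of the covariates, so permuting them does not change the law of the data
  (\<open>permuted_response_same_law\<close>).  Hence the rank of \<open>L id\<close> among all \<open>L \<pi>\<close> is uniform up to ties,
  and the test has level \<open>\<alpha>\<close> for every sample size (\<open>null_level\<close>).

  Power.  By Markov's inequality it suffices that the expected p-value is small, that is, that
  \<open>L id \<le> L \<pi>\<close> is unlikely for a uniformly random \<open>\<pi>\<close>.  Let \<open>s\<close> be the signal.

  \<^item> The choice \<open>\<Theta> = \<Theta>~\<close> gives \<open>L id \<ge> \<Sum>i. 2 * y\<^sub>i * a\<^sub>i - a\<^sub>i\<^sup>2\<close> with \<open>a\<^sub>i = \<langle>X\<^sub>i, \<Theta>~\<rangle>\<close>.  Optimality of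
    \<open>\<Theta>~\<close> along its own ray makes the summands have mean \<open>s\<close>, and Chebyshev's inequality yields
    \<open>L id > n * s / 2\<close> with high probability.  The variance of a summand is bounded by a constant, which
    costs the term \<open>1 / sqrt n\<close> in the signal; under the moment equivalence it is \<open>O(s)\<close>.

  \<^item> The expectation of \<open>L \<pi>\<close> is \<open>O(r * d)\<close> plus a constant times the number of fixed points of \<open>\<pi>\<close>, which
    is one on average (\<open>permuted_gain_expectation\<close>).  The points moved by \<open>\<pi>\<close> split into three classes, none of
    which meets its image.  On one class the permuted responses are independent of the covariates, so
    it remains to bound the gain of a low-rank fit to pure noise for a fixed design.

  The last bound (\<open>fixed_design_gain_bound\<close>) holds for an arbitrary design and comes from counting monomials.
  With \<open>k = r * d\<close>, the function \<open>(\<Sum>i. \<epsilon>\<^sub>i * w\<^sub>i)\<^sup>k\<close> of the noise lies, for all low-rank fits \<open>w\<close> at once,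
  in a space spanned by at most \<open>16\<^sup>k\<close> functions, one for each monomial of degree \<open>2 * k\<close> in the entries
  of the two factors.  In a \<open>D\<close>-dimensional subspace of \<open>L\<^sup>2\<close> the supremum of \<open>f\<^sup>2\<close> over the unit ball has
  expectation at most \<open>D\<close> (\<open>christoffel_bound\<close>).  The sub-Gaussian moment bound
  \<open>E (\<Sum>i. \<epsilon>\<^sub>i * w\<^sub>i)\<^sup>2\<^sup>k \<le> (C * k)\<^sup>k * (w \<bullet> w)\<^sup>k\<close> and a \<open>k\<close>-th root turn this into \<open>O(k)\<close>.
\<close>

section \<open>Christoffel bound for finite-dimensional function spaces\<close>

definition sq_int :: "'a measure \<Rightarrow> ('a \<Rightarrow> real) \<Rightarrow> bool" where
  "sq_int M f \<longleftrightarrow> f \<in> borel_measurable M \<and> integrable M (\<lambda>\<omega>. (f \<omega>)\<^sup>2)"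

lemma sq_int_mult_integrable:
  assumes "sq_int M f" "sq_int M g"
  shows "integrable M (\<lambda>\<omega>. f \<omega> * g \<omega>)"
proof (rule Bochner_Integration.integrable_bound[of M "\<lambda>\<omega>. (f \<omega>)\<^sup>2 + (g \<omega>)\<^sup>2"])
  show "integrable M (\<lambda>\<omega>. (f \<omega>)\<^sup>2 + (g \<omega>)\<^sup>2)"
    using assms by (auto simp: sq_int_def)
  show "(\<lambda>\<omega>. f \<omega> * g \<omega>) \<in> borel_measurable M"
    using assms by (auto simp: sq_int_def)
  have "norm (x * y) \<le> norm (x\<^sup>2 + y\<^sup>2)" for x y :: real
  proof -
    have "\<bar>x\<bar> * \<bar>y\<bar> \<le> x\<^sup>2 + y\<^sup>2"
      using sum_squares_bound[of "\<bar>x\<bar>" "\<bar>y\<bar>"] by (simp add: mult.assoc) (smt (verit) zero_le_power2 abs_ge_zero mult_nonneg_nonneg)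
    then show ?thesis by (simp add: abs_mult)
  qed
  then show "AE \<omega> in M. norm (f \<omega> * g \<omega>) \<le> norm ((f \<omega>)\<^sup>2 + (g \<omega>)\<^sup>2)"
    by simp
qed

lemma sq_int_add:
  assumes "sq_int M f" "sq_int M g"
  shows "sq_int M (\<lambda>\<omega>. f \<omega> + g \<omega>)"
  using assms sq_int_mult_integrable[OF assms]
  by (auto simp: sq_int_def power2_sum mult.assoc)

lemma sq_int_scale: "sq_int M f \<Longrightarrow> sq_int M (\<lambda>\<omega>. a * f \<omega>)"
  by (auto simp: sq_int_def power_mult_distrib)

lemma sq_int_sum:
  "(\<And>i. i \<in> I \<Longrightarrow> sq_int M (f i)) \<Longrightarrow> sq_int M (\<lambda>\<omega>. \<Sum>i\<in>I. f i \<omega>)"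
  by (induction I rule: infinite_finite_induct) (auto simp: sq_int_add, auto simp: sq_int_def)

lemma integral_orthonormal_mult:
  fixes \<phi> :: "nat \<Rightarrow> 'a \<Rightarrow> real"
  assumes sq: "\<And>j. j < m \<Longrightarrow> sq_int M (\<phi> j)"
    and on: "\<And>j l. j < m \<Longrightarrow> l < m \<Longrightarrow> (\<integral>\<omega>. \<phi> j \<omega> * \<phi> l \<omega> \<partial>M) = of_bool (j = l)"
    and "l < m"
  shows "(\<integral>\<omega>. (\<Sum>j<m. z j * \<phi> j \<omega>) * \<phi> l \<omega> \<partial>M) = z l"
proof -
  have "(\<integral>\<omega>. (\<Sum>j<m. z j * \<phi> j \<omega>) * \<phi> l \<omega> \<partial>M) = (\<integral>\<omega>. (\<Sum>j<m. z j * (\<phi> j \<omega> * \<phi> l \<omega>)) \<partial>M)"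
    by (simp add: sum_distrib_right mult.assoc)
  also have "\<dots> = (\<Sum>j<m. z j * (\<integral>\<omega>. \<phi> j \<omega> * \<phi> l \<omega> \<partial>M))"
    using assms by (subst Bochner_Integration.integral_sum) (auto intro!: sq_int_mult_integrable)
  also have "\<dots> = (\<Sum>j<m. z j * of_bool (j = l))"
    using on \<open>l < m\<close> by (intro sum.cong) auto
  also have "\<dots> = z l"
    using \<open>l < m\<close> by (simp add: of_bool_def if_distrib[of "\<lambda>x. _ * x"] sum.delta cong: if_cong)
  finally show ?thesis .
qed

lemma integral_orthonormal_norm:
  fixes \<phi> :: "nat \<Rightarrow> 'a \<Rightarrow> real"
  assumes sq: "\<And>j. j < m \<Longrightarrow> sq_int M (\<phi> j)"
    and on: "\<And>j l. j < m \<Longrightarrow> l < m \<Longrightarrow> (\<integral>\<omega>. \<phi> j \<omega> * \<phi> l \<omega> \<partial>M) = of_bool (j = l)"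
  shows "(\<integral>\<omega>. (\<Sum>j<m. z j * \<phi> j \<omega>)\<^sup>2 \<partial>M) = (\<Sum>j<m. (z j)\<^sup>2)"
proof -
  let ?f = "\<lambda>\<omega>. \<Sum>j<m. z j * \<phi> j \<omega>"
  have f: "sq_int M ?f" by (intro sq_int_sum sq_int_scale sq) auto
  have "(\<integral>\<omega>. (?f \<omega>)\<^sup>2 \<partial>M) = (\<integral>\<omega>. (\<Sum>l<m. z l * (?f \<omega> * \<phi> l \<omega>)) \<partial>M)"
    by (intro Bochner_Integration.integral_cong refl)
      (simp add: power2_eq_square sum_distrib_left mult_ac)
  also have "\<dots> = (\<Sum>l<m. z l * (\<integral>\<omega>. ?f \<omega> * \<phi> l \<omega> \<partial>M))"
    using sq by (subst Bochner_Integration.integral_sum) (auto intro!: sq_int_mult_integrable f)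
  also have "\<dots> = (\<Sum>l<m. z l * z l)"
    using integral_orthonormal_mult[of m M \<phi>, OF sq on] by simp
  finally show ?thesis by (simp add: power2_eq_square)
qed

text \<open>
  Gram--Schmidt in \<open>L\<^sup>2\<close>.  A residual of norm zero vanishes only almost everywhere, hence the
  representation of each function holds up to a null set.
\<close>
lemma orthonormal_system_exists:
  fixes c :: "'i \<Rightarrow> 'a \<Rightarrow> real"
  assumes "finite I" "\<And>i. i \<in> I \<Longrightarrow> sq_int M (c i)"
  shows "\<exists>(m::nat) \<phi> a. m \<le> card I \<and> (\<forall>j<m. sq_int M (\<phi> j)) \<and>
     (\<forall>j<m. \<forall>l<m. (\<integral>\<omega>. \<phi> j \<omega> * \<phi> l \<omega> \<partial>M) = of_bool (j = l)) \<and>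
     (\<forall>i\<in>I. AE \<omega> in M. c i \<omega> = (\<Sum>j<m. a i j * \<phi> j \<omega>))"
  using assms
proof (induction I rule: finite_induct)
  case empty
  show ?case by (intro exI[of _ 0]) auto
next
  case (insert x F)
  have "\<And>i. i \<in> F \<Longrightarrow> sq_int M (c i)" using insert.prems by simp
  from insert.IH[OF this] obtain m :: nat and \<phi> a where
    H: "m \<le> card F \<and> (\<forall>j<m. sq_int M (\<phi> j)) \<and>
     (\<forall>j<m. \<forall>l<m. (\<integral>\<omega>. \<phi> j \<omega> * \<phi> l \<omega> \<partial>M) = of_bool (j = l)) \<and>
     (\<forall>i\<in>F. AE \<omega> in M. c i \<omega> = (\<Sum>j<m. a i j * \<phi> j \<omega>))" by blast
  then have m: "m \<le> card F" and sq: "\<And>j. j < m \<Longrightarrow> sq_int M (\<phi> j)"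
    and on: "\<And>j l. j < m \<Longrightarrow> l < m \<Longrightarrow> (\<integral>\<omega>. \<phi> j \<omega> * \<phi> l \<omega> \<partial>M) = of_bool (j = l)"
    and rep: "\<And>i. i \<in> F \<Longrightarrow> AE \<omega> in M. c i \<omega> = (\<Sum>j<m. a i j * \<phi> j \<omega>)"
    by blast+
  define b where "b j = (\<integral>\<omega>. c x \<omega> * \<phi> j \<omega> \<partial>M)" for j
  define \<rho> where "\<rho> \<omega> = c x \<omega> + (\<Sum>j<m. (- b j) * \<phi> j \<omega>)" for \<omega>
  define v where "v = (\<integral>\<omega>. (\<rho> \<omega>)\<^sup>2 \<partial>M)"
  have cx: "sq_int M (c x)" using insert by auto
  have sum_sq: "sq_int M (\<lambda>\<omega>. \<Sum>j<m. z j * \<phi> j \<omega>)" for z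
    using sq by (intro sq_int_sum sq_int_scale) auto
  have \<rho>: "sq_int M \<rho>" unfolding \<rho>_def by (intro sq_int_add cx sum_sq)
  have orth: "(\<integral>\<omega>. \<rho> \<omega> * \<phi> l \<omega> \<partial>M) = 0" if "l < m" for l
  proof -
    have "(\<integral>\<omega>. \<rho> \<omega> * \<phi> l \<omega> \<partial>M) =
        (\<integral>\<omega>. c x \<omega> * \<phi> l \<omega> \<partial>M) + (\<integral>\<omega>. (\<Sum>j<m. (- b j) * \<phi> j \<omega>) * \<phi> l \<omega> \<partial>M)"
      unfolding \<rho>_def distrib_right
      by (intro Bochner_Integration.integral_add sq_int_mult_integrable cx sum_sq sq that)
    also have "\<dots> = 0"
      using integral_orthonormal_mult[of m M \<phi> l "\<lambda>j. - b j", OF sq on that] by (simp add: b_def)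
    finally show ?thesis .
  qed
  have c\<rho>: "c x \<omega> = (\<Sum>j<m. b j * \<phi> j \<omega>) + \<rho> \<omega>" for \<omega>
    by (simp add: \<rho>_def sum_negf)
  have v0: "v \<ge> 0" by (simp add: v_def)
  show ?case
  proof (cases "v = 0")
    case True
    then have "AE \<omega> in M. (\<rho> \<omega>)\<^sup>2 = 0"
      using \<rho> by (subst (asm) v_def) (subst (asm) integral_nonneg_eq_0_iff_AE, auto simp: sq_int_def)
    then have "AE \<omega> in M. c x \<omega> = (\<Sum>j<m. b j * \<phi> j \<omega>)"
      by eventually_elim (simp add: c\<rho>)
    then show ?thesis
      using m sq on rep insert.hyps
      by (intro exI[of _ m] exI[of _ \<phi>] exI[of _ "a(x := b)"]) auto
  next
    case False
    then have v: "v > 0" using v0 by simp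
    define \<psi> where "\<psi> = \<phi>(m := (\<lambda>\<omega>. (1 / sqrt v) * \<rho> \<omega>))"
    define a' where "a' i = (if i = x then b(m := sqrt v) else (a i)(m := 0))" for i
    have 1: "sq_int M (\<psi> j)" if "j < Suc m" for j
      using that sq sq_int_scale[OF \<rho>, of "1 / sqrt v"] by (auto simp: \<psi>_def)
    have 2: "(\<integral>\<omega>. \<psi> j \<omega> * \<psi> l \<omega> \<partial>M) = of_bool (j = l)" if jl: "j < Suc m" "l < Suc m" for j l
    proof -
      have i: "(\<integral>\<omega>. (1 / sqrt v) * \<rho> \<omega> * ((1 / sqrt v) * \<rho> \<omega>) \<partial>M) = 1"
      proof -
        have "(\<integral>\<omega>. (1 / sqrt v) * \<rho> \<omega> * ((1 / sqrt v) * \<rho> \<omega>) \<partial>M) = (\<integral>\<omega>. (1 / v) * (\<rho> \<omega>)\<^sup>2 \<partial>M)"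
          using v by (intro Bochner_Integration.integral_cong refl) (simp add: power2_eq_square)
        also have "\<dots> = 1" using v by (simp add: v_def)
        finally show ?thesis .
      qed
      have ii: "(\<integral>\<omega>. (1 / sqrt v) * \<rho> \<omega> * \<phi> l \<omega> \<partial>M) = 0" if "l < m" for l
        using orth[OF that] by (simp add: mult.assoc)
      have iii: "(\<integral>\<omega>. \<phi> l \<omega> * ((1 / sqrt v) * \<rho> \<omega>) \<partial>M) = 0" if "l < m" for l
        using ii[OF that] by (simp add: mult.commute)
      have iv: "(\<integral>\<omega>. \<rho> \<omega> * \<rho> \<omega> \<partial>M) = v"
        by (simp add: v_def power2_eq_square)
      consider "j < m" "l < m" | "j = m" "l < m" | "j < m" "l = m" | "j = m" "l = m"
        using jl by linarith
      then show ?thesis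
        by cases (use i ii iii on iv v in \<open>simp_all add: \<psi>_def\<close>)
    qed
    have 3: "AE \<omega> in M. c i \<omega> = (\<Sum>j<Suc m. a' i j * \<psi> j \<omega>)" if "i \<in> insert x F" for i
    proof (cases "i = x")
      case True
      have "(\<Sum>j<m. b j * \<psi> j \<omega>) = (\<Sum>j<m. b j * \<phi> j \<omega>)" for \<omega>
        by (intro sum.cong) (auto simp: \<psi>_def)
      then show ?thesis
        using True c\<rho> v by (simp add: a'_def \<psi>_def)
    next
      case False
      then have "i \<in> F" using that by simp
      have "(\<Sum>j<m. a i j * \<psi> j \<omega>) = (\<Sum>j<m. a i j * \<phi> j \<omega>)" for \<omega>
        by (intro sum.cong) (auto simp: \<psi>_def)
      then show ?thesis
        using False rep[OF \<open>i \<in> F\<close>] by (simp add: a'_def)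
    qed
    show ?thesis
      using 1 2 3 m insert.hyps
      by (intro exI[of _ "Suc m"] exI[of _ \<psi>] exI[of _ a']) auto
  qed
qed

text \<open>
  \<open>G\<close> is the diagonal of the reproducing kernel of the span, the sum of the squares of an orthonormal
  basis: Cauchy--Schwarz bounds every member of the unit ball pointwise by it, and its integral is the
  dimension.  The exceptional null set does not depend on the coefficients, so the bound holds for
  the supremum over an uncountable family.
\<close>
lemma christoffel_bound:
  fixes c :: "'i \<Rightarrow> 'a \<Rightarrow> real"
  assumes "finite I" "\<And>i. i \<in> I \<Longrightarrow> sq_int M (c i)"
  obtains G where "integrable M G" "\<And>\<omega>. 0 \<le> G \<omega>" "(\<integral>\<omega>. G \<omega> \<partial>M) \<le> real (card I)"
    "AE \<omega> in M. \<forall>x. (\<Sum>i\<in>I. x i * c i \<omega>)\<^sup>2 \<le> G \<omega> * (\<integral>\<omega>'. (\<Sum>i\<in>I. x i * c i \<omega>')\<^sup>2 \<partial>M)"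
proof -
  obtain m :: nat and \<phi> a where
    H: "m \<le> card I \<and> (\<forall>j<m. sq_int M (\<phi> j)) \<and>
     (\<forall>j<m. \<forall>l<m. (\<integral>\<omega>. \<phi> j \<omega> * \<phi> l \<omega> \<partial>M) = of_bool (j = l)) \<and>
     (\<forall>i\<in>I. AE \<omega> in M. c i \<omega> = (\<Sum>j<m. a i j * \<phi> j \<omega>))"
    using orthonormal_system_exists[of I M c, OF assms] by blast
  then have m: "m \<le> card I" and sq: "\<And>j. j < m \<Longrightarrow> sq_int M (\<phi> j)"
    and on: "\<And>j l. j < m \<Longrightarrow> l < m \<Longrightarrow> (\<integral>\<omega>. \<phi> j \<omega> * \<phi> l \<omega> \<partial>M) = of_bool (j = l)"
    and rep: "\<And>i. i \<in> I \<Longrightarrow> AE \<omega> in M. c i \<omega> = (\<Sum>j<m. a i j * \<phi> j \<omega>)"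
    by blast+
  define G where "G \<omega> = (\<Sum>j<m. (\<phi> j \<omega>)\<^sup>2)" for \<omega>
  have int: "integrable M (\<lambda>\<omega>. (\<phi> j \<omega>)\<^sup>2)" if "j < m" for j
    using sq[OF that] by (simp add: sq_int_def)
  have "(\<integral>\<omega>. G \<omega> \<partial>M) = (\<Sum>j<m. (\<integral>\<omega>. (\<phi> j \<omega>)\<^sup>2 \<partial>M))"
    unfolding G_def using int by (subst Bochner_Integration.integral_sum) auto
  also have "\<dots> = real m"
    using on by (simp add: power2_eq_square)
  finally have IG: "(\<integral>\<omega>. G \<omega> \<partial>M) \<le> real (card I)" using m by simp
  have all: "AE \<omega> in M. \<forall>i\<in>I. c i \<omega> = (\<Sum>j<m. a i j * \<phi> j \<omega>)"
    using rep assms(1) by (simp add: AE_finite_all)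
  define z where "z x j = (\<Sum>i\<in>I. x i * a i j)" for x j
  have eq: "(\<Sum>i\<in>I. x i * c i \<omega>) = (\<Sum>j<m. z x j * \<phi> j \<omega>)"
    if "\<forall>i\<in>I. c i \<omega> = (\<Sum>j<m. a i j * \<phi> j \<omega>)" for \<omega> x
  proof -
    have "(\<Sum>i\<in>I. x i * c i \<omega>) = (\<Sum>i\<in>I. \<Sum>j<m. x i * a i j * \<phi> j \<omega>)"
      using that by (intro sum.cong) (auto simp: sum_distrib_left mult.assoc)
    also have "\<dots> = (\<Sum>j<m. z x j * \<phi> j \<omega>)"
      unfolding z_def sum_distrib_right by (rule sum.swap)
    finally show ?thesis .
  qed
  have nrm: "(\<integral>\<omega>. (\<Sum>i\<in>I. x i * c i \<omega>)\<^sup>2 \<partial>M) = (\<Sum>j<m. (z x j)\<^sup>2)" for x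
  proof -
    have "(\<integral>\<omega>. (\<Sum>i\<in>I. x i * c i \<omega>)\<^sup>2 \<partial>M) = (\<integral>\<omega>. (\<Sum>j<m. z x j * \<phi> j \<omega>)\<^sup>2 \<partial>M)"
    proof (rule integral_cong_AE)
      show "(\<lambda>\<omega>. (\<Sum>i\<in>I. x i * c i \<omega>)\<^sup>2) \<in> borel_measurable M"
        using assms(2) unfolding sq_int_def
        by (intro borel_measurable_power borel_measurable_sum borel_measurable_times) auto
      show "(\<lambda>\<omega>. (\<Sum>j<m. z x j * \<phi> j \<omega>)\<^sup>2) \<in> borel_measurable M"
        using sq unfolding sq_int_def
        by (intro borel_measurable_power borel_measurable_sum borel_measurable_times) auto
      show "AE \<omega> in M. (\<Sum>i\<in>I. x i * c i \<omega>)\<^sup>2 = (\<Sum>j<m. z x j * \<phi> j \<omega>)\<^sup>2"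
        using all by eventually_elim (simp only: eq)
    qed
    also have "\<dots> = (\<Sum>j<m. (z x j)\<^sup>2)"
      by (rule integral_orthonormal_norm[OF sq on])
    finally show ?thesis .
  qed
  show ?thesis
  proof (rule that)
    show "integrable M G" unfolding G_def using int by auto
    show "0 \<le> G \<omega>" for \<omega> by (simp add: G_def sum_nonneg)
    show "AE \<omega> in M. \<forall>x. (\<Sum>i\<in>I. x i * c i \<omega>)\<^sup>2 \<le> G \<omega> * (\<integral>\<omega>'. (\<Sum>i\<in>I. x i * c i \<omega>')\<^sup>2 \<partial>M)"
      using all
    proof eventually_elim
      case (elim \<omega>)
      show ?case
        unfolding nrm eq[OF elim] G_def
        using Cauchy_Schwarz_ineq_sum[of "\<lambda>j. z _ j" "\<lambda>j. \<phi> j \<omega>" "{..<m}"]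
        by (simp add: mult.commute)
    qed
  qed (rule IG)
qed

text \<open>
  Grouping the expansion of the power by monomials in \<open>\<theta>\<close> shows that, as a function of \<open>\<omega>\<close>, it ranges
  over a space whose dimension is at most the number of exponent vectors, whatever \<open>\<theta>\<close> and however
  many summands there are.
\<close>
lemma sum_power_monomials:
  fixes \<theta> :: "nat \<Rightarrow> real" and c :: "'t \<Rightarrow> 'a \<Rightarrow> real"
  assumes T: "finite T" and e: "\<And>t. t \<in> T \<Longrightarrow> (\<Sum>i<q. e t i) = d"
  defines "A \<equiv> \<lambda>k. {\<alpha>::nat list. length \<alpha> = q \<and> sum_list \<alpha> = d * k}"
    and "C \<equiv> \<lambda>k \<alpha> \<omega>. \<Sum>g\<in>{g \<in> PiE {..<k} (\<lambda>_. T). map (\<lambda>i. \<Sum>j<k. e (g j) i) [0..<q] = \<alpha>}. \<Prod>j<k. c (g j) \<omega>"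
  shows "(\<Sum>t\<in>T. (\<Prod>i<q. \<theta> i ^ e t i) * c t \<omega>) ^ k = (\<Sum>\<alpha>\<in>A k. (\<Prod>i<q. \<theta> i ^ (\<alpha> ! i)) * C k \<alpha> \<omega>)"
proof -
  let ?P = "PiE {..<k} (\<lambda>_. T)"
  let ?h = "\<lambda>g. map (\<lambda>i. \<Sum>j<k. e (g j) i) [0..<q]"
  have finP: "finite ?P" using T by (intro finite_PiE) auto
  have finA: "finite (A k)"
  proof -
    have "A k \<subseteq> {xs. set xs \<subseteq> {..d * k} \<and> length xs = q}"
      using member_le_sum_list by (fastforce simp: A_def)
    then show ?thesis by (rule finite_subset) (rule finite_lists_length_eq, simp)
  qed
  have hA: "?h ` ?P \<subseteq> A k"
  proof (intro image_subsetI)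
    fix g assume g: "g \<in> ?P"
    have "sum_list (?h g) = (\<Sum>i<q. \<Sum>j<k. e (g j) i)"
      by (simp add: interv_sum_list_conv_sum_set_nat atLeast0LessThan)
    also have "\<dots> = (\<Sum>j<k. \<Sum>i<q. e (g j) i)" by (rule sum.swap)
    also have "\<dots> = (\<Sum>j<k. d)" using g by (intro sum.cong refl e) auto
    finally show "?h g \<in> A k" by (simp add: A_def mult.commute)
  qed
  have "(\<Sum>t\<in>T. (\<Prod>i<q. \<theta> i ^ e t i) * c t \<omega>) ^ k = (\<Prod>j<k. \<Sum>t\<in>T. (\<Prod>i<q. \<theta> i ^ e t i) * c t \<omega>)"
    by simp
  also have "\<dots> = (\<Sum>g\<in>?P. \<Prod>j<k. (\<Prod>i<q. \<theta> i ^ e (g j) i) * c (g j) \<omega>)"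
    using T by (subst prod_sum_PiE) auto
  also have "\<dots> = (\<Sum>g\<in>?P. (\<Prod>i<q. \<theta> i ^ (?h g ! i)) * (\<Prod>j<k. c (g j) \<omega>))"
  proof (intro sum.cong refl)
    fix g
    have "(\<Prod>j<k. \<Prod>i<q. \<theta> i ^ e (g j) i) = (\<Prod>i<q. \<Prod>j<k. \<theta> i ^ e (g j) i)"
      by (rule prod.swap)
    also have "\<dots> = (\<Prod>i<q. \<theta> i ^ (?h g ! i))"
      by (intro prod.cong refl) (simp add: power_sum)
    finally show "(\<Prod>j<k. (\<Prod>i<q. \<theta> i ^ e (g j) i) * c (g j) \<omega>) =
        (\<Prod>i<q. \<theta> i ^ (?h g ! i)) * (\<Prod>j<k. c (g j) \<omega>)"
      by (simp add: prod.distrib)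
  qed
  also have "\<dots> = (\<Sum>\<alpha>\<in>A k. \<Sum>g\<in>{g \<in> ?P. ?h g = \<alpha>}. (\<Prod>i<q. \<theta> i ^ (?h g ! i)) * (\<Prod>j<k. c (g j) \<omega>))"
    by (rule sum.group[OF finP finA hA, symmetric])
  also have "\<dots> = (\<Sum>\<alpha>\<in>A k. (\<Prod>i<q. \<theta> i ^ (\<alpha> ! i)) * C k \<alpha> \<omega>)"
    unfolding C_def sum_distrib_left by (intro sum.cong refl) auto
  finally show ?thesis .
qed

section \<open>Sub-Gaussian moment generating functions and moments\<close>

text \<open>
  This form of sub-Gaussianity, unlike the Orlicz norm, adds up exactly over independent summands; it
  forces mean zero.
\<close>
definition subgaussian_mgf :: "'a measure \<Rightarrow> real \<Rightarrow> ('a \<Rightarrow> real) \<Rightarrow> bool" where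
  "subgaussian_mgf M V Z \<longleftrightarrow> Z \<in> borel_measurable M \<and>
     (\<forall>l. (\<integral>\<^sup>+\<omega>. ennreal (exp (l * Z \<omega>)) \<partial>M) \<le> ennreal (exp (l\<^sup>2 * V)))"

lemma subgaussian_mgf_mono: "subgaussian_mgf M V Z \<Longrightarrow> V \<le> W \<Longrightarrow> subgaussian_mgf M W Z"
  unfolding subgaussian_mgf_def
  by (meson ennreal_leI exp_le_cancel_iff mult_left_mono order_trans zero_le_power2)

lemma exp_moment_power_bound:
  fixes x :: real
  shows "x ^ (2 * k) \<le> fact (2 * k) * ((exp x + exp (- x)))"
proof -
  have *: "y ^ m \<le> fact m * exp y" if "y \<ge> 0" for y :: real and m
  proof -
    have "(\<Sum>n\<in>{m}. inverse (fact n) * y ^ n) \<le> (\<Sum>n. inverse (fact n) * y ^ n)"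
      using that by (intro sum_le_suminf summable_exp) auto
    then have "inverse (fact m) * y ^ m \<le> exp y" by (simp add: exp_def scaleR_conv_of_real)
    then show ?thesis by (simp add: field_simps)
  qed
  have "x ^ (2 * k) = \<bar>x\<bar> ^ (2 * k)" by (simp add: power_mult)
  also have "\<dots> \<le> fact (2 * k) * exp \<bar>x\<bar>" by (rule *) simp
  also have "\<dots> \<le> fact (2 * k) * (exp x + exp (- x))"
    by (intro mult_left_mono) (auto simp: abs_if add_increasing add_increasing2)
  finally show ?thesis .
qed

text \<open>
  The exponential dominates its \<open>2 * k\<close>-th Taylor term; the parameter is chosen as
  \<open>l\<^sup>2 = k / V\<close>, which balances \<open>l\<close> to the power \<open>-2 * k\<close> against \<open>exp (l\<^sup>2 * V)\<close>.
\<close>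
lemma subgaussian_mgf_moment:
  assumes Z: "subgaussian_mgf M V Z" and "V > 0" "k \<ge> 1"
  shows "integrable M (\<lambda>\<omega>. (Z \<omega>) ^ (2 * k))"
    and "(\<integral>\<omega>. (Z \<omega>) ^ (2 * k) \<partial>M) \<le> (24 * V * real k) ^ k"
proof -
  have [measurable]: "Z \<in> borel_measurable M" using Z by (simp add: subgaussian_mgf_def)
  define l where "l = sqrt (real k / V)"
  have l: "l > 0" "l\<^sup>2 = real k / V" using assms by (auto simp: l_def)
  have le: "(Z \<omega>) ^ (2 * k) \<le> fact (2 * k) / l ^ (2 * k) * (exp (l * Z \<omega>) + exp ((- l) * Z \<omega>))" for \<omega>
    using exp_moment_power_bound[of "l * Z \<omega>" k] l
    by (simp add: power_mult_distrib field_simps)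
  have nn: "(\<integral>\<^sup>+\<omega>. ennreal ((Z \<omega>) ^ (2 * k)) \<partial>M) \<le> ennreal ((24 * V * real k) ^ k)"
  proof -
    have "(\<integral>\<^sup>+\<omega>. ennreal ((Z \<omega>) ^ (2 * k)) \<partial>M) \<le>
       (\<integral>\<^sup>+\<omega>. ennreal (fact (2 * k) / l ^ (2 * k)) * (ennreal (exp (l * Z \<omega>)) + ennreal (exp ((- l) * Z \<omega>))) \<partial>M)"
      using l by (intro nn_integral_mono)
        (simp add: le ennreal_mult[symmetric] ennreal_plus[symmetric] del: ennreal_plus, insert le, simp)
    also have "\<dots> = ennreal (fact (2 * k) / l ^ (2 * k)) *
        ((\<integral>\<^sup>+\<omega>. ennreal (exp (l * Z \<omega>)) \<partial>M) + (\<integral>\<^sup>+\<omega>. ennreal (exp ((- l) * Z \<omega>)) \<partial>M))"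
      by (subst nn_integral_cmult, measurable, subst nn_integral_add, auto)
    also have "\<dots> \<le> ennreal (fact (2 * k) / l ^ (2 * k)) * (ennreal (exp (l\<^sup>2 * V)) + ennreal (exp ((-l)\<^sup>2 * V)))"
      using Z unfolding subgaussian_mgf_def by (intro mult_left_mono add_mono) (blast, blast, simp)
    also have "\<dots> = ennreal (fact (2 * k) / l ^ (2 * k) * (2 * exp (real k)))"
      using l \<open>V > 0\<close> by (simp add: ennreal_mult[symmetric] ennreal_plus[symmetric] del: ennreal_plus)
    also have "\<dots> \<le> ennreal ((24 * V * real k) ^ k)"
    proof (rule ennreal_leI)
      have "fact (2 * k) \<le> real (2 * k) ^ (2 * k)"
        using fact_le_power[of "2 * k", where 'a = real] by simp
      also have "\<dots> = (4 * (real k)\<^sup>2) ^ k" by (simp add: power_mult power_mult_distrib)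
      finally have f: "fact (2 * k) \<le> (4 * (real k)\<^sup>2) ^ k" .
      have lk: "l ^ (2 * k) = (real k / V) ^ k" using l by (simp add: power_mult)
      have "exp (1::real) \<le> 3" by (rule exp_le)
      then have "exp (real k) \<le> 3 ^ k"
        by (metis exp_of_nat_mult exp_ge_zero mult.right_neutral power_mono)
      moreover have "(2::real) \<le> 2 ^ k" using \<open>k \<ge> 1\<close> self_le_power[of "2::real" k] by simp
      ultimately have e: "2 * exp (real k) \<le> 6 ^ k"
        using mult_mono[of 2 "2 ^ k" "exp (real k)" "3 ^ k"] by (simp add: power_mult_distrib[symmetric])
      have "fact (2 * k) / l ^ (2 * k) * (2 * exp (real k)) \<le> (4 * (real k)\<^sup>2) ^ k / (real k / V) ^ k * 6 ^ k"
        unfolding lk using f e assms by (intro mult_mono divide_right_mono) auto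
      also have "\<dots> = (4 * (real k)\<^sup>2 / (real k / V) * 6) ^ k"
        by (simp only: power_mult_distrib power_divide)
      also have "4 * (real k)\<^sup>2 / (real k / V) * 6 = 24 * V * real k"
        using assms by (simp add: power2_eq_square)
      finally show "fact (2 * k) / l ^ (2 * k) * (2 * exp (real k)) \<le> (24 * V * real k) ^ k" .
    qed
    finally show ?thesis .
  qed
  show int: "integrable M (\<lambda>\<omega>. (Z \<omega>) ^ (2 * k))"
  proof (rule integrableI_nonneg)
    show "(\<integral>\<^sup>+\<omega>. ennreal ((Z \<omega>) ^ (2 * k)) \<partial>M) < \<infinity>"
      using nn by (simp add: order_le_less_trans)
  qed (auto simp: power_mult)
  show "(\<integral>\<omega>. (Z \<omega>) ^ (2 * k) \<partial>M) \<le> (24 * V * real k) ^ k"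
    using nn assms by (subst (asm) nn_integral_eq_integral[OF int]) (auto simp: power_mult)
qed

lemma (in prob_space) subgaussian_mgf_sum:
  assumes fin: "finite A" and ind: "indep_vars (\<lambda>_. borel) \<epsilon> A" and mgf: "\<And>i. i \<in> A \<Longrightarrow> subgaussian_mgf M V (\<epsilon> i)"
  shows "subgaussian_mgf M (V * (\<Sum>i\<in>A. (w i)\<^sup>2)) (\<lambda>\<omega>. \<Sum>i\<in>A. \<epsilon> i \<omega> * w i)"
  unfolding subgaussian_mgf_def
proof (intro conjI allI)
  show "(\<lambda>\<omega>. \<Sum>i\<in>A. \<epsilon> i \<omega> * w i) \<in> borel_measurable M"
    using mgf unfolding subgaussian_mgf_def by (intro borel_measurable_sum borel_measurable_times) auto
  fix l :: real
  have ind': "indep_vars (\<lambda>_. borel) (\<lambda>i \<omega>. ennreal (exp ((l * w i) * \<epsilon> i \<omega>))) A"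
    by (rule indep_vars_compose2[OF ind]) measurable
  have "(\<integral>\<^sup>+\<omega>. ennreal (exp (l * (\<Sum>i\<in>A. \<epsilon> i \<omega> * w i))) \<partial>M) =
      (\<integral>\<^sup>+\<omega>. (\<Prod>i\<in>A. ennreal (exp ((l * w i) * \<epsilon> i \<omega>))) \<partial>M)"
    using fin by (simp add: prod_ennreal exp_sum[symmetric] sum_distrib_left mult_ac)
  also have "\<dots> = (\<Prod>i\<in>A. \<integral>\<^sup>+\<omega>. ennreal (exp ((l * w i) * \<epsilon> i \<omega>)) \<partial>M)"
    by (rule indep_vars_nn_integral[OF fin ind']) simp
  also have "\<dots> \<le> (\<Prod>i\<in>A. ennreal (exp ((l * w i)\<^sup>2 * V)))"
  proof -
    have "(\<integral>\<^sup>+\<omega>. ennreal (exp ((l * w i) * \<epsilon> i \<omega>)) \<partial>M) \<le> ennreal (exp ((l * w i)\<^sup>2 * V))" if "i \<in> A" for i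
      using mgf[OF that] unfolding subgaussian_mgf_def by blast
    then show ?thesis by (intro prod_mono_ennreal)
  qed
  also have "\<dots> = ennreal (exp (l\<^sup>2 * (V * (\<Sum>i\<in>A. (w i)\<^sup>2))))"
    using fin by (simp add: prod_ennreal exp_sum[symmetric] sum_distrib_left power_mult_distrib mult_ac)
  finally show "(\<integral>\<^sup>+\<omega>. ennreal (exp (l * (\<Sum>i\<in>A. \<epsilon> i \<omega> * w i))) \<partial>M) \<le>
      ennreal (exp (l\<^sup>2 * (V * (\<Sum>i\<in>A. (w i)\<^sup>2))))" .
qed

lemma exp_le_self_plus_exp_square: "exp x \<le> x + exp (x\<^sup>2)" for x :: real
proof (cases "x \<ge> 1")
  case True
  then have "x \<le> x\<^sup>2" by (simp add: power2_eq_square)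
  then show ?thesis using True by (smt (verit) exp_le_cancel_iff)
next
  case False
  have sq: "1 + x\<^sup>2 \<le> exp (x\<^sup>2)" by (rule exp_ge_add_one_self)
  show ?thesis
  proof (cases "x \<ge> 0")
    case True
    have "exp x \<le> 1 + x + x\<^sup>2" using True False by (intro exp_bound) auto
    then show ?thesis using sq by linarith
  next
    case neg: False
    define y where "y = - x"
    have y: "y > 0" using neg by (simp add: y_def)
    (* exp (-y) <= 1 / (1 + y + y^2/2) <= 1 - y + y^2 *)
    have "exp (- y) \<le> 1 - y + y\<^sup>2"
    proof -
      have a: "1 + y + y\<^sup>2 / 2 \<le> exp y"
        using y exp_lower_Taylor_quadratic[of y] by simp
      have "(1 - y + y\<^sup>2) * (1 + y + y\<^sup>2 / 2) = 1 + y\<^sup>2 / 2 + y ^ 3 / 2 + y ^ 4 / 2"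
        by (simp add: power2_eq_square power3_eq_cube power4_eq_xxxx field_simps)
      then have "1 \<le> (1 - y + y\<^sup>2) * (1 + y + y\<^sup>2 / 2)" using y by simp
      also have "\<dots> \<le> (1 - y + y\<^sup>2) * exp y"
      proof (rule mult_left_mono[OF a])
        have "1 - y + y\<^sup>2 = (1 - y / 2)\<^sup>2 + 3 / 4 * y\<^sup>2" by (simp add: power2_eq_square field_simps)
        then show "0 \<le> 1 - y + y\<^sup>2" by simp
      qed
      finally show ?thesis by (simp add: exp_minus field_simps)
    qed
    then have "exp x \<le> 1 + x + x\<^sup>2" by (simp add: y_def)
    then show ?thesis using sq by linarith
  qed
qed

lemma (in prob_space) exp_square_integrable:
  assumes [measurable]: "Z \<in> borel_measurable M"
    and psi: "(\<integral>\<^sup>+\<omega>. ennreal (exp ((Z \<omega>)\<^sup>2 / m)) \<partial>M) \<le> 2"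
  shows "integrable M (\<lambda>\<omega>. exp ((Z \<omega>)\<^sup>2 / m))" "expectation (\<lambda>\<omega>. exp ((Z \<omega>)\<^sup>2 / m)) \<le> 2"
proof -
  show int: "integrable M (\<lambda>\<omega>. exp ((Z \<omega>)\<^sup>2 / m))"
    by (rule integrableI_nonneg) (use psi in \<open>auto simp: order_le_less_trans\<close>)
  have "ennreal (expectation (\<lambda>\<omega>. exp ((Z \<omega>)\<^sup>2 / m))) = (\<integral>\<^sup>+\<omega>. ennreal (exp ((Z \<omega>)\<^sup>2 / m)) \<partial>M)"
    by (intro nn_integral_eq_integral[symmetric] int) simp
  also have "\<dots> \<le> ennreal 2" using psi by simp
  finally show "expectation (\<lambda>\<omega>. exp ((Z \<omega>)\<^sup>2 / m)) \<le> 2" by (subst (asm) ennreal_le_iff) auto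
qed

text \<open>
  For \<open>l\<^sup>2 * m \<le> 1\<close> the inequality \<open>exp x \<le> x + exp (x\<^sup>2)\<close> removes the linear term, which has mean zero,
  and Jensen's inequality bounds the rest; for larger \<open>l\<close> completing the square in \<open>l * Z\<close> suffices.
\<close>
lemma (in prob_space) subgaussian_mgf_of_exp_square:
  assumes [measurable]: "Z \<in> borel_measurable M" and "m > 0"
    and psi: "(\<integral>\<^sup>+\<omega>. ennreal (exp ((Z \<omega>)\<^sup>2 / m)) \<partial>M) \<le> 2"
    and mean: "integrable M Z" "expectation Z = 0"
  shows "subgaussian_mgf M m Z"
  unfolding subgaussian_mgf_def
proof (intro conjI allI)
  fix l :: real
  define f where "f \<omega> = exp ((Z \<omega>)\<^sup>2 / m)" for \<omega>
  have f[measurable]: "f \<in> borel_measurable M" unfolding f_def by measurable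
  have intf: "integrable M f" and If: "expectation f \<le> 2"
    using exp_square_integrable[OF assms(1) psi] by (simp_all add: f_def[abs_def])
  have pw: "integrable M (\<lambda>\<omega>. f \<omega> powr a) \<and> expectation (\<lambda>\<omega>. f \<omega> powr a) \<le> 2 powr a" if a: "0 \<le> a" "a \<le> 1" for a
  proof -
    have f1: "f \<omega> \<ge> 1" for \<omega> using \<open>m > 0\<close> by (simp add: f_def)
    \<comment> \<open>tangent line of the concave function \<open>x powr a\<close> at \<open>2\<close>\<close>
    have tan: "x powr a \<le> 2 powr a * (1 + a * (x / 2 - 1))" if "x \<ge> 1" for x :: real
    proof -
      have "(x / 2) powr a \<le> 1 + a * (x / 2 - 1)"
      proof -
        have "ln (1 + a * (x / 2 - 1)) \<ge> a * ln (x / 2)"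
        proof -
          have c: "concave_on {0<..} (ln :: real \<Rightarrow> real)" by (rule ln_concave)
          have "(1 - a) * ln 1 + a * ln (x / 2) \<le> ln ((1 - a) *\<^sub>R 1 + a *\<^sub>R (x / 2))"
            using concave_onD[OF c, of a 1 "x / 2"] a that by simp
          then show ?thesis by (simp add: algebra_simps)
        qed
        moreover have "1 + a * (x / 2 - 1) > 0"
        proof -
          have "a * (x / 2 - 1) \<ge> a * (- 1 / 2)" using a that by (intro mult_left_mono) auto
          then show ?thesis using a by simp
        qed
        ultimately show ?thesis
          using that by (simp add: powr_def) (metis exp_le_cancel_iff exp_ln)
      qed
      then show ?thesis using that by (simp add: powr_divide field_simps)
    qed
    have int: "integrable M (\<lambda>\<omega>. f \<omega> powr a)"
    proof (rule Bochner_Integration.integrable_bound[of M "\<lambda>\<omega>. 2 powr a * (1 + a * (f \<omega> / 2 - 1))"])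
      show "AE \<omega> in M. norm (f \<omega> powr a) \<le> norm (2 powr a * (1 + a * (f \<omega> / 2 - 1)))"
        using tan[OF f1] by (intro AE_I2) (smt (verit) powr_ge_zero real_norm_def)
    qed (use intf in auto)
    have "expectation (\<lambda>\<omega>. f \<omega> powr a) \<le> expectation (\<lambda>\<omega>. 2 powr a * (1 + a * (f \<omega> / 2 - 1)))"
      using int intf tan[OF f1] by (intro integral_mono) auto
    also have "\<dots> = 2 powr a * (1 + a * (expectation f / 2 - 1))"
      using intf by (simp add: prob_space)
    also have "\<dots> \<le> 2 powr a"
      using If a mult_left_mono[of "expectation f / 2 - 1" 0 a] by (simp add: mult_le_cancel_left1)
    finally show ?thesis using int by simp
  qed
  have ln2: "ln 2 \<le> (1::real)" using ln_2_less_1 by simp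
  show "(\<integral>\<^sup>+\<omega>. ennreal (exp (l * Z \<omega>)) \<partial>M) \<le> ennreal (exp (l\<^sup>2 * m))"
  proof (cases "l\<^sup>2 * m \<le> 1")
    case True
    define a where "a = l\<^sup>2 * m"
    have a: "0 \<le> a" "a \<le> 1" using True \<open>m > 0\<close> by (auto simp: a_def)
    have eq: "f \<omega> powr a = exp ((l * Z \<omega>)\<^sup>2)" for \<omega>
      using \<open>m > 0\<close> by (simp add: f_def a_def powr_def power_mult_distrib)
    have le: "exp (l * Z \<omega>) \<le> l * Z \<omega> + f \<omega> powr a" for \<omega>
      unfolding eq by (rule exp_le_self_plus_exp_square)
    have int: "integrable M (\<lambda>\<omega>. l * Z \<omega> + f \<omega> powr a)" using pw[OF a] mean by auto
    have "(\<integral>\<^sup>+\<omega>. ennreal (exp (l * Z \<omega>)) \<partial>M) \<le> (\<integral>\<^sup>+\<omega>. ennreal (l * Z \<omega> + f \<omega> powr a) \<partial>M)"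
      by (intro nn_integral_mono ennreal_leI le)
    also have "\<dots> = ennreal (expectation (\<lambda>\<omega>. l * Z \<omega> + f \<omega> powr a))"
      using le by (intro nn_integral_eq_integral int AE_I2) (meson exp_ge_zero order_trans)
    also have "expectation (\<lambda>\<omega>. l * Z \<omega> + f \<omega> powr a) = expectation (\<lambda>\<omega>. f \<omega> powr a)"
      using pw[OF a] mean by simp
    also have "ennreal \<dots> \<le> ennreal (2 powr a)" using pw[OF a] by (intro ennreal_leI) simp
    also have "2 powr a \<le> exp a" using a ln2 mult_left_mono[OF ln2, of a] by (simp add: powr_def)
    finally show ?thesis by (simp add: a_def ennreal_leI)
  next
    case False
    have le: "exp (l * Z \<omega>) \<le> exp (l\<^sup>2 * m / 2) * f \<omega> powr (1 / 2)" for \<omega>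
    proof -
      have "0 \<le> (l * sqrt m - Z \<omega> / sqrt m)\<^sup>2" by simp
      also have "\<dots> = l\<^sup>2 * m + (Z \<omega>)\<^sup>2 / m - 2 * (l * Z \<omega>)"
        using \<open>m > 0\<close> by (simp add: power2_diff power_mult_distrib power_divide)
      finally have "l * Z \<omega> \<le> l\<^sup>2 * m / 2 + (Z \<omega>)\<^sup>2 / m / 2" by simp
      then have "exp (l * Z \<omega>) \<le> exp (l\<^sup>2 * m / 2 + (Z \<omega>)\<^sup>2 / m / 2)" by simp
      then show ?thesis unfolding exp_add by (simp add: f_def powr_def mult.commute)
    qed
    have "(\<integral>\<^sup>+\<omega>. ennreal (exp (l * Z \<omega>)) \<partial>M) \<le> (\<integral>\<^sup>+\<omega>. ennreal (exp (l\<^sup>2 * m / 2) * f \<omega> powr (1 / 2)) \<partial>M)"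
      by (intro nn_integral_mono ennreal_leI le)
    also have "\<dots> = ennreal (expectation (\<lambda>\<omega>. exp (l\<^sup>2 * m / 2) * f \<omega> powr (1 / 2)))"
      using pw[of "1/2"] by (intro nn_integral_eq_integral) auto
    also have "\<dots> \<le> ennreal (exp (l\<^sup>2 * m / 2) * exp (1 / 2))"
    proof (rule ennreal_leI)
      have "expectation (\<lambda>\<omega>. f \<omega> powr (1 / 2)) \<le> 2 powr (1/2)" using pw[of "1/2"] by simp
      also have "2 powr (1/2) \<le> exp (1/2 :: real)" using ln2 by (simp add: powr_def)
      finally show "expectation (\<lambda>\<omega>. exp (l\<^sup>2 * m / 2) * f \<omega> powr (1 / 2)) \<le> exp (l\<^sup>2 * m / 2) * exp (1 / 2)"
        by simp
    qed
    also have "exp (l\<^sup>2 * m / 2) * exp (1 / 2) \<le> exp (l\<^sup>2 * m)"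
      unfolding exp_add[symmetric] using False by simp
    finally show ?thesis by (simp add: ennreal_leI)
  qed
qed simp

section \<open>Matrices of bounded rank as products of two factors\<close>

text \<open>
  The entries of \<open>U * V\<close> for a \<open>d1 \<times> r\<close> matrix \<open>U\<close> and an \<open>r \<times> d2\<close> matrix \<open>V\<close>.  Both factors are read
  row by row, \<open>V\<close> transposed, from one parameter sequence \<open>\<theta>\<close>, of which the first \<open>(d1 + d2) * r\<close>
  entries matter; a single sequence makes the entries quadratic forms in \<open>\<theta>\<close> and gives the parameter
  space the topology of \<open>nat \<Rightarrow> real\<close>.
\<close>
definition factor_entry :: "nat \<Rightarrow> nat \<Rightarrow> (nat \<Rightarrow> real) \<Rightarrow> nat \<Rightarrow> nat \<Rightarrow> real" where
  "factor_entry d1 r \<theta> a b = (\<Sum>s<r. \<theta> (a * r + s) * \<theta> ((d1 + b) * r + s))"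

definition factor_mat :: "nat \<Rightarrow> nat \<Rightarrow> nat \<Rightarrow> (nat \<Rightarrow> real) \<Rightarrow> real mat" where
  "factor_mat d1 d2 r \<theta> = mat d1 d2 (\<lambda>(a, b). factor_entry d1 r \<theta> a b)"

lemma rank_factor_mat_le: "vec_space.rank d1 (mat d1 d2 (\<lambda>(a, b). \<Sum>s<r. f s a * g s b :: real)) \<le> r"
proof (induction r)
  case 0
  have eq: "mat d1 d2 (\<lambda>(a, b). \<Sum>s<0. f s a * g s b :: real) = 0\<^sub>m d1 d2"
    by (intro eq_matI) auto
  show ?case unfolding eq using vec_space.rank_0I[where 'a = real, of d1 d2] by simp
next
  case (Suc r)
  let ?A = "mat d1 d2 (\<lambda>(a, b). \<Sum>s<r. f s a * g s b)" and ?B = "mat d1 d2 (\<lambda>(a, b). f r a * g r b)"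
  have "mat d1 d2 (\<lambda>(a, b). \<Sum>s<Suc r. f s a * g s b) = ?A + ?B"
    by (intro eq_matI) auto
  moreover have "vec_space.rank d1 (?A + ?B) \<le> vec_space.rank d1 ?A + vec_space.rank d1 ?B"
    by (rule vec_space.rank_subadditive) auto
  moreover have "vec_space.rank d1 ?B \<le> 1"
    by (rule vec_space.rank_le_1_product_entries[where f = "f r" and g = "g r"]) auto
  ultimately show ?case using Suc by simp
qed

text \<open>
  A maximal independent set of columns has at most \<open>r\<close> elements and spans the others; unused factor
  slots are filled with zeros.
\<close>
lemma low_rank_columns_combination:
  assumes A: "A \<in> carrier_mat d1 d2" and "vec_space.rank d1 A \<le> r"
  obtains f g where "\<And>a b. a < d1 \<Longrightarrow> b < d2 \<Longrightarrow> A $$ (a, b) = (\<Sum>s<r. f s a * g s b :: real)"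
proof -
  interpret vec_space "TYPE(real)" d1 .
  have cols: "set (cols A) \<subseteq> carrier_vec d1" using A cols_dim by blast
  have empty: "lin_indpt {}" by (rule finite_lin_indpt2) auto
  have "\<exists>S. finite S \<and> maximal S (\<lambda>T. T \<subseteq> set (cols A) \<and> lin_indpt T) \<and> {} \<subseteq> S"
    by (rule maximal_exists_superset[of "set (cols A)"]) (simp_all add: empty)
  then obtain S where S: "finite S" "maximal S (\<lambda>T. T \<subseteq> set (cols A) \<and> lin_indpt T)"
    by blast
  from S(2) have SS: "S \<subseteq> set (cols A)" "lin_indpt S" unfolding maximal_def by blast+
  then have Sc: "S \<subseteq> carrier_vec d1" using cols by auto
  have card: "card S \<le> r" using rank_card_indpt[OF A S(2)] assms by simp
  have "\<exists>c. \<forall>a<d1. A $$ (a, b) = (\<Sum>v\<in>S. c v * v $ a)" if "b < d2" for b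
  proof -
    have cA: "col A b \<in> set (cols A)" using A that by (auto simp: cols_def)
    have "col A b \<in> span S"
    proof (cases "col A b \<in> S")
      case True then show ?thesis using span_mem[OF Sc] by simp
    next
      case False
      have "lin_dep (S \<union> {col A b})"
      proof (rule ccontr)
        assume "\<not> ?thesis"
        then have "S \<union> {col A b} \<subseteq> set (cols A) \<and> lin_indpt (S \<union> {col A b})"
          using SS(1) cA by simp
        with S(2) have "S \<union> {col A b} = S" unfolding maximal_def by blast
        then show False using False by blast
      qed
      then show ?thesis
        using lin_dep_iff_in_span[OF Sc SS(2) _ False] cA cols by blast
    qed
    then obtain c where c: "lincomb c S = col A b"
      using finite_in_span[OF S(1) Sc] by blast
    have "A $$ (a, b) = (\<Sum>v\<in>S. c v * v $ a)" if "a < d1" for a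
    proof -
      have "A $$ (a, b) = col A b $ a" using A that \<open>b < d2\<close> by simp
      also have "\<dots> = (\<Sum>v\<in>S. c v * v $ a)" unfolding c[symmetric] by (rule lincomb_index[OF that Sc])
      finally show ?thesis .
    qed
    then show ?thesis by blast
  qed
  then obtain c where c: "\<And>b a. b < d2 \<Longrightarrow> a < d1 \<Longrightarrow> A $$ (a, b) = (\<Sum>v\<in>S. c b v * v $ a)"
    by metis
  obtain h where h: "bij_betw h {..<card S} S"
    using ex_bij_betw_nat_finite[OF S(1)] atLeast0LessThan by metis
  show ?thesis
  proof (rule that[of "\<lambda>s a. if s < card S then h s $ a else 0" "\<lambda>s b. c b (h s)"])
    fix a b assume ab: "a < d1" "b < d2"
    have "A $$ (a, b) = (\<Sum>s<card S. c b (h s) * h s $ a)"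
      using c[OF ab(2,1)] sum.reindex_bij_betw[OF h, of "\<lambda>v. c b v * v $ a"] by simp
    also have "\<dots> = (\<Sum>s<r. (if s < card S then h s $ a else 0) * c b (h s))"
      using card by (intro sum.mono_neutral_cong_left) auto
    finally show "A $$ (a, b) = (\<Sum>s<r. (if s < card S then h s $ a else 0) * c b (h s))" .
  qed
qed

lemma low_rank_mats_eq_range: "low_rank_mats d1 d2 r = range (factor_mat d1 d2 r)"
proof (intro equalityI subsetI)
  fix A assume "A \<in> low_rank_mats d1 d2 r"
  then have A: "A \<in> carrier_mat d1 d2" "vec_space.rank d1 A \<le> r" by (auto simp: low_rank_mats_def)
  obtain f g where fg: "\<And>a b. a < d1 \<Longrightarrow> b < d2 \<Longrightarrow> A $$ (a, b) = (\<Sum>s<r. f s a * g s b)"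
    using low_rank_columns_combination[OF A] by blast
  define \<theta> where "\<theta> i = (if i div r < d1 then f (i mod r) (i div r) else g (i mod r) (i div r - d1))" for i
  have "A = factor_mat d1 d2 r \<theta>"
  proof (rule eq_matI)
    fix a b assume "a < dim_row (factor_mat d1 d2 r \<theta>)" "b < dim_col (factor_mat d1 d2 r \<theta>)"
    then have ab: "a < d1" "b < d2" by (auto simp: factor_mat_def)
    have "(\<Sum>s<r. f s a * g s b) = factor_entry d1 r \<theta> a b"
      unfolding factor_entry_def using ab by (intro sum.cong refl) (auto simp: \<theta>_def)
    then show "A $$ (a, b) = factor_mat d1 d2 r \<theta> $$ (a, b)"
      using fg ab by (simp add: factor_mat_def)
  qed (use A in \<open>auto simp: factor_mat_def\<close>)
  then show "A \<in> range (factor_mat d1 d2 r)" by blast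
next
  fix A assume "A \<in> range (factor_mat d1 d2 r)"
  then obtain \<theta> where A: "A = factor_mat d1 d2 r \<theta>" by blast
  show "A \<in> low_rank_mats d1 d2 r"
    unfolding A low_rank_mats_def factor_mat_def factor_entry_def
    using rank_factor_mat_le[where f = "\<lambda>s a. \<theta> (a * r + s)" and g = "\<lambda>s b. \<theta> ((d1 + b) * r + s)"]
    by simp
qed

text \<open>Scaling the left factor alone scales the product.\<close>
lemma low_rank_mats_scale:
  assumes "A \<in> low_rank_mats d1 d2 r"
  shows "t \<cdot>\<^sub>m A \<in> low_rank_mats d1 d2 r"
proof -
  obtain \<theta> where A: "A = factor_mat d1 d2 r \<theta>" using assms by (auto simp: low_rank_mats_eq_range)
  define \<theta>' where "\<theta>' i = (if i < d1 * r then t * \<theta> i else \<theta> i)" for i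
  have "factor_entry d1 r \<theta>' a b = t * factor_entry d1 r \<theta> a b" if "a < d1" for a b
  proof -
    have "a * r + s < d1 * r" if "s < r" for s
    proof -
      have "a * r + s < Suc a * r" using that by simp
      also have "\<dots> \<le> d1 * r" using \<open>a < d1\<close> by (intro mult_le_mono1) simp
      finally show ?thesis .
    qed
    moreover have "\<not> (d1 + b) * r + s < d1 * r" for s by (simp add: add_mult_distrib)
    ultimately show ?thesis
      unfolding factor_entry_def sum_distrib_left
      by (intro sum.cong refl) (simp add: \<theta>'_def)
  qed
  then have "t \<cdot>\<^sub>m A = factor_mat d1 d2 r \<theta>'"
    unfolding A by (intro eq_matI) (auto simp: factor_mat_def)
  then show ?thesis by (auto simp: low_rank_mats_eq_range)
qed

lemma hs_inner_eq_sum: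
  assumes "A \<in> carrier_mat d1 d2" "B \<in> carrier_mat d1 d2"
  shows "hs_inner A B = (\<Sum>a<d1. \<Sum>b<d2. A $$ (a, b) * B $$ (a, b))"
proof -
  have "hs_inner A B = (\<Sum>b<d2. \<Sum>a<d1. A $$ (a, b) * B $$ (a, b))"
    using assms unfolding hs_inner_def mat_trace_def
    by (auto simp: scalar_prod_def atLeast0LessThan intro!: sum.cong)
  also have "\<dots> = (\<Sum>a<d1. \<Sum>b<d2. A $$ (a, b) * B $$ (a, b))" by (rule sum.swap)
  finally show ?thesis .
qed

section \<open>Maximal gain of a low-rank fit against independent noise\<close>

lemma prod_square_le_sum_powers:
  fixes x :: "nat \<Rightarrow> real"
  assumes "k \<ge> 1"
  shows "(\<Prod>j<k. x j)\<^sup>2 \<le> (\<Sum>j<k. x j ^ (2 * k))"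
proof -
  define m where "m = Max ((\<lambda>j. \<bar>x j\<bar>) ` {..<k})"
  have ne: "(\<lambda>j. \<bar>x j\<bar>) ` {..<k} \<noteq> {}" using assms by (auto simp: lessThan_empty_iff)
  have "m \<in> (\<lambda>j. \<bar>x j\<bar>) ` {..<k}" unfolding m_def using ne by (intro Max_in) auto
  then obtain j where j: "j < k" "m = \<bar>x j\<bar>" by auto
  have le: "\<bar>x i\<bar> \<le> m" if "i < k" for i unfolding m_def using that by (intro Max_ge) auto
  have "(\<Prod>i<k. x i)\<^sup>2 = (\<Prod>i<k. \<bar>x i\<bar>)\<^sup>2" by (simp add: abs_prod[symmetric])
  also have "\<dots> \<le> (m ^ k)\<^sup>2"
    using prod_mono[of "{..<k}" "\<lambda>i. \<bar>x i\<bar>" "\<lambda>_. m"] le by (intro power_mono prod_nonneg) auto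
  also have "\<dots> = x j ^ (2 * k)" using j by (simp add: power_mult[symmetric] mult.commute power_even_abs)
  also have "\<dots> \<le> (\<Sum>j<k. x j ^ (2 * k))"
    using j by (intro member_le_sum) (auto simp: power_mult)
  finally show ?thesis .
qed

text \<open>
  With \<open>k = r * d2\<close> there are \<open>q = (d1 + d2) * r \<le> 2 * k\<close> parameters, hence at most
  \<open>2\<^sup>4\<^sup>k = 16\<^sup>k\<close> monomials of degree \<open>2 * k\<close>: the exponential growth of the dimension in \<open>k\<close> disappears
  when the \<open>k\<close>-th root is taken, and only the factor \<open>k\<close> of the moment bound is left.
\<close>
lemma (in prob_space) fixed_design_gain_bound:
  fixes \<epsilon> :: "'i \<Rightarrow> 'a \<Rightarrow> real" and x :: "'i \<Rightarrow> nat \<Rightarrow> nat \<Rightarrow> real"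
  assumes fin: "finite A" and ind: "indep_vars (\<lambda>_. borel) \<epsilon> A"
    and mgf: "\<And>i. i \<in> A \<Longrightarrow> subgaussian_mgf M V (\<epsilon> i)" and V: "V > 0"
    and d: "1 \<le> d1" "d1 \<le> d2" and r: "1 \<le> r"
  defines "w \<equiv> \<lambda>\<theta> i. \<Sum>a<d1. \<Sum>b<d2. x i a b * factor_entry d1 r \<theta> a b"
  obtains H where "H \<in> borel_measurable M" "(\<integral>\<^sup>+\<omega>. ennreal (H \<omega>) \<partial>M) \<le> ennreal (768 * V * real (r * d2))"
    "AE \<omega> in M. \<forall>\<theta>. (\<Sum>i\<in>A. 2 * \<epsilon> i \<omega> * w \<theta> i - (w \<theta> i)\<^sup>2) \<le> H \<omega>"
proof -
  define k where "k = r * d2"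
  define q where "q = (d1 + d2) * r"
  have k: "k \<ge> 1" using d r by (auto simp: k_def)
  have q2: "q \<le> 2 * k" using d by (simp add: q_def k_def add_mult_distrib mult.commute)
  define T where "T = {..<d1} \<times> {..<d2} \<times> {..<r}"
  define e :: "nat \<times> nat \<times> nat \<Rightarrow> nat \<Rightarrow> nat" where
    "e t i = (case t of (a, b, s) \<Rightarrow> of_bool (i = a * r + s) + of_bool (i = (d1 + b) * r + s))" for t i
  define c :: "nat \<times> nat \<times> nat \<Rightarrow> 'a \<Rightarrow> real" where
    "c t \<omega> = (case t of (a, b, s) \<Rightarrow> \<Sum>i\<in>A. \<epsilon> i \<omega> * x i a b)" for t \<omega>
  have finT: "finite T" by (simp add: T_def)
  have idx: "a * r + s < q" "(d1 + b) * r + s < q" if "a < d1" "b < d2" "s < r" for a b s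
  proof -
    have *: "m * r + s < (d1 + d2) * r" if "m < d1 + d2" for m
    proof -
      have "m * r + s < Suc m * r" using \<open>s < r\<close> by simp
      also have "\<dots> \<le> (d1 + d2) * r" using that by (intro mult_le_mono1) simp
      finally show ?thesis .
    qed
    show "a * r + s < q" "(d1 + b) * r + s < q" using that unfolding q_def by (intro *; simp)+
  qed
  have e2: "(\<Sum>i<q. e t i) = 2" if "t \<in> T" for t
  proof -
    obtain a b s where t: "t = (a, b, s)" "a < d1" "b < d2" "s < r" using \<open>t \<in> T\<close> by (auto simp: T_def)
    show ?thesis
      using idx[OF t(2-4)] by (simp add: t(1) e_def sum.distrib of_bool_def sum.delta)
  qed
  have eprod: "(\<Prod>i<q. \<theta> i ^ e (a, b, s) i) = \<theta> (a * r + s) * \<theta> ((d1 + b) * r + s)"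
    if "a < d1" "b < d2" "s < r" for a b s and \<theta> :: "nat \<Rightarrow> real"
  proof -
    have *: "(\<Prod>i<q. \<theta> i ^ of_bool (i = m)) = \<theta> m" if "m < q" for m
    proof -
      have "(\<Prod>i<q. \<theta> i ^ of_bool (i = m)) = (\<Prod>i<q. if i = m then \<theta> i else 1)"
        by (intro prod.cong) auto
      also have "\<dots> = \<theta> m" using that by (simp add: prod.delta)
      finally show ?thesis .
    qed
    show ?thesis using *[OF idx(1)[OF that]] *[OF idx(2)[OF that]]
      by (simp add: e_def power_add prod.distrib)
  qed
  have lin: "(\<Sum>i\<in>A. \<epsilon> i \<omega> * w \<theta> i) = (\<Sum>t\<in>T. (\<Prod>i<q. \<theta> i ^ e t i) * c t \<omega>)" for \<theta> \<omega>
  proof -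
    have "(\<Sum>t\<in>T. (\<Prod>i<q. \<theta> i ^ e t i) * c t \<omega>) =
       (\<Sum>a<d1. \<Sum>b<d2. \<Sum>s<r. (\<Prod>i<q. \<theta> i ^ e (a, b, s) i) * c (a, b, s) \<omega>)"
      by (simp add: T_def sum.cartesian_product)
    also have "\<dots> = (\<Sum>a<d1. \<Sum>b<d2. \<Sum>s<r. \<theta> (a * r + s) * \<theta> ((d1 + b) * r + s) * (\<Sum>i\<in>A. \<epsilon> i \<omega> * x i a b))"
      by (intro sum.cong refl) (simp add: eprod c_def)
    also have "\<dots> = (\<Sum>a<d1. \<Sum>b<d2. \<Sum>i\<in>A. \<epsilon> i \<omega> * (x i a b * factor_entry d1 r \<theta> a b))"
      unfolding factor_entry_def
      by (simp add: sum_distrib_left sum_distrib_right mult_ac sum.swap[of _ A "{..<r}"])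
    also have "\<dots> = (\<Sum>i\<in>A. \<Sum>a<d1. \<Sum>b<d2. \<epsilon> i \<omega> * (x i a b * factor_entry d1 r \<theta> a b))"
      by (simp add: sum.swap[of _ A])
    also have "\<dots> = (\<Sum>i\<in>A. \<epsilon> i \<omega> * w \<theta> i)"
      by (simp add: w_def sum_distrib_left)
    finally show ?thesis by simp
  qed
  define I where "I = {\<alpha>::nat list. length \<alpha> = q \<and> sum_list \<alpha> = 2 * k}"
  have cardI: "card I \<le> 16 ^ k"
  proof -
    have "card I = (2 * k + q - 1) choose (2 * k)" unfolding I_def by (rule card_length_sum_list)
    also have "\<dots> \<le> 2 ^ (2 * k + q - 1)" by (rule binomial_le_pow2)
    also have "\<dots> \<le> 2 ^ (4 * k)" using q2 by (intro power_increasing) auto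
    also have "(2::nat) ^ (4 * k) = 16 ^ k" by (simp add: power_mult)
    finally show ?thesis .
  qed
  have finI: "finite I"
  proof -
    have "I \<subseteq> {xs. set xs \<subseteq> {..2 * k} \<and> length xs = q}"
      using member_le_sum_list by (fastforce simp: I_def)
    then show ?thesis by (rule finite_subset) (rule finite_lists_length_eq, simp)
  qed
  define C where "C \<alpha> \<omega> = (\<Sum>g\<in>{g \<in> PiE {..<k} (\<lambda>_. T). map (\<lambda>i. \<Sum>j<k. e (g j) i) [0..<q] = \<alpha>}.
      \<Prod>j<k. c (g j) \<omega>)" for \<alpha> \<omega>
  have pow: "(\<Sum>i\<in>A. \<epsilon> i \<omega> * w \<theta> i) ^ k = (\<Sum>\<alpha>\<in>I. (\<Prod>i<q. \<theta> i ^ (\<alpha> ! i)) * C \<alpha> \<omega>)" for \<theta> \<omega>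
    unfolding lin I_def C_def by (rule sum_power_monomials[OF finT e2])
  have mgf_w: "subgaussian_mgf M (V * (\<Sum>i\<in>A. (z i)\<^sup>2)) (\<lambda>\<omega>. \<Sum>i\<in>A. \<epsilon> i \<omega> * z i)" for z
    by (rule subgaussian_mgf_sum[OF fin ind mgf])
  have c_mom: "c t \<in> borel_measurable M \<and> integrable M (\<lambda>\<omega>. c t \<omega> ^ (2 * k))" for t
  proof -
    obtain a b s where t: "t = (a, b, s)" by (cases t)
    have m: "subgaussian_mgf M (V * (\<Sum>i\<in>A. (x i a b)\<^sup>2) + 1) (c t)"
      using subgaussian_mgf_mono[OF mgf_w[of "\<lambda>i. x i a b"], of "V * (\<Sum>i\<in>A. (x i a b)\<^sup>2) + 1"]
      by (simp add: c_def[abs_def] t)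
    have "V * (\<Sum>i\<in>A. (x i a b)\<^sup>2) + 1 > 0"
      using V by (intro add_nonneg_pos mult_nonneg_nonneg sum_nonneg) auto
    then show ?thesis
      using subgaussian_mgf_moment(1)[OF m _ k] m by (simp add: subgaussian_mgf_def)
  qed
  have C_sq: "sq_int M (C \<alpha>)" for \<alpha>
    unfolding C_def
  proof (rule sq_int_sum)
    fix g
    have meas: "(\<lambda>\<omega>. \<Prod>j<k. c (g j) \<omega>) \<in> borel_measurable M"
      using c_mom by (intro borel_measurable_prod) blast
    have "integrable M (\<lambda>\<omega>. (\<Prod>j<k. c (g j) \<omega>)\<^sup>2)"
    proof (rule Bochner_Integration.integrable_bound)
      show "integrable M (\<lambda>\<omega>. \<Sum>j<k. c (g j) \<omega> ^ (2 * k))" using c_mom by auto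
      show "AE \<omega> in M. norm ((\<Prod>j<k. c (g j) \<omega>)\<^sup>2) \<le> norm (\<Sum>j<k. c (g j) \<omega> ^ (2 * k))"
        using prod_square_le_sum_powers[OF k]
        by (intro AE_I2) (auto intro: order_trans[OF _ abs_ge_self])
    qed (use meas in measurable)
    then show "sq_int M (\<lambda>\<omega>. \<Prod>j<k. c (g j) \<omega>)" using meas by (simp add: sq_int_def)
  qed
  obtain G where G: "integrable M G" "\<And>\<omega>. 0 \<le> G \<omega>" "(\<integral>\<omega>. G \<omega> \<partial>M) \<le> real (card I)"
    and GAE: "AE \<omega> in M. \<forall>z. (\<Sum>\<alpha>\<in>I. z \<alpha> * C \<alpha> \<omega>)\<^sup>2 \<le> G \<omega> * (\<integral>\<omega>'. (\<Sum>\<alpha>\<in>I. z \<alpha> * C \<alpha> \<omega>')\<^sup>2 \<partial>M)"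
    by (rule christoffel_bound[of I M C, OF finI C_sq]) (rule that)
  \<comment> \<open>The \<open>k\<close>-th root of \<open>G\<close> is at most \<open>16 * (1 + G / 16\<^sup>k)\<close>, which is integrable with integral at
     most 32; the factor 384 is 16 times the constant 24 of the moment bound.\<close>
  define H where "H \<omega> = 384 * V * real k * (1 + G \<omega> / 16 ^ k)" for \<omega>
  have Hpos: "H \<omega> \<ge> 0" for \<omega> using G V by (simp add: H_def)
  show ?thesis
  proof (rule that)
    show "H \<in> borel_measurable M" unfolding H_def using G by auto
    have intH: "integrable M H" unfolding H_def using G by auto
    have "(\<integral>\<omega>. H \<omega> \<partial>M) = 384 * V * real k * (1 + (\<integral>\<omega>. G \<omega> \<partial>M) / 16 ^ k)"
      unfolding H_def using G by (simp add: prob_space)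
    also have "\<dots> \<le> 384 * V * real k * 2"
    proof (intro mult_left_mono)
      have "real (card I) \<le> 16 ^ k" using cardI by (metis of_nat_le_iff of_nat_numeral of_nat_power)
      then have "(\<integral>\<omega>. G \<omega> \<partial>M) \<le> 16 ^ k" using G(3) by linarith
      then show "1 + (\<integral>\<omega>. G \<omega> \<partial>M) / 16 ^ k \<le> 2" by simp
    qed (use V in simp)
    finally have "(\<integral>\<omega>. H \<omega> \<partial>M) \<le> 768 * V * real (r * d2)" by (simp add: k_def)
    then show "(\<integral>\<^sup>+\<omega>. ennreal (H \<omega>) \<partial>M) \<le> ennreal (768 * V * real (r * d2))"
      using Hpos by (subst nn_integral_eq_integral[OF intH]) (auto intro: ennreal_leI)
    show "AE \<omega> in M. \<forall>\<theta>. (\<Sum>i\<in>A. 2 * \<epsilon> i \<omega> * w \<theta> i - (w \<theta> i)\<^sup>2) \<le> H \<omega>"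
      using GAE
    proof (eventually_elim, intro allI)
      fix \<omega> \<theta>
      assume el: "\<forall>z. (\<Sum>\<alpha>\<in>I. z \<alpha> * C \<alpha> \<omega>)\<^sup>2 \<le> G \<omega> * (\<integral>\<omega>'. (\<Sum>\<alpha>\<in>I. z \<alpha> * C \<alpha> \<omega>')\<^sup>2 \<partial>M)"
      define S where "S \<omega> = (\<Sum>i\<in>A. \<epsilon> i \<omega> * w \<theta> i)" for \<omega>
      define W where "W = (\<Sum>i\<in>A. (w \<theta> i)\<^sup>2)"
      have W0: "W \<ge> 0" by (simp add: W_def sum_nonneg)
      have target: "(\<Sum>i\<in>A. 2 * \<epsilon> i \<omega> * w \<theta> i - (w \<theta> i)\<^sup>2) = 2 * S \<omega> - W"
        by (simp add: S_def W_def sum_subtractf sum_distrib_left mult.assoc)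
      show "(\<Sum>i\<in>A. 2 * \<epsilon> i \<omega> * w \<theta> i - (w \<theta> i)\<^sup>2) \<le> H \<omega>"
      proof (cases "W = 0")
        case True
        then have "w \<theta> i = 0" if "i \<in> A" for i
          using that fin by (simp add: W_def sum_nonneg_eq_0_iff)
        then have "(\<Sum>i\<in>A. 2 * \<epsilon> i \<omega> * w \<theta> i - (w \<theta> i)\<^sup>2) = 0" by (intro sum.neutral) auto
        then show ?thesis using Hpos by simp
      next
        case False
        then have W: "W > 0" using W0 by simp
        have mom: "(\<integral>\<omega>. S \<omega> ^ (2 * k) \<partial>M) \<le> (24 * (V * W) * real k) ^ k"
          using subgaussian_mgf_moment(2)[OF mgf_w[of "w \<theta>"] _ k] V W by (simp add: S_def W_def)
        have Sk: "(S \<omega> ^ k)\<^sup>2 \<le> G \<omega> * (\<integral>\<omega>'. (S \<omega>' ^ k)\<^sup>2 \<partial>M)"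
          using el[rule_format, of "\<lambda>\<alpha>. \<Prod>i<q. \<theta> i ^ (\<alpha> ! i)"] unfolding S_def pow .
        define g where "g = G \<omega> / 16 ^ k"
        have g: "g \<ge> 0" using G by (simp add: g_def)
        have "((S \<omega>)\<^sup>2) ^ k \<le> G \<omega> * (24 * (V * W) * real k) ^ k"
          using Sk mult_left_mono[OF mom G(2)[of \<omega>]] by (simp add: power_mult[symmetric] mult.commute)
        also have "\<dots> = g * (384 * V * real k * W) ^ k"
        proof -
          have "(384 * V * real k * W) ^ k = (16 * (24 * (V * W) * real k)) ^ k" by (simp add: mult_ac)
          then show ?thesis by (simp only: power_mult_distrib[of 16]) (simp add: g_def)
        qed
        also have "\<dots> \<le> (1 + g) ^ k * (384 * V * real k * W) ^ k"
        proof (rule mult_right_mono)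
          have "g \<le> 1 + g" by simp
          also have "\<dots> \<le> (1 + g) ^ k" using g k self_le_power[of "1 + g" k] by simp
          finally show "g \<le> (1 + g) ^ k" .
        qed (use V W in auto)
        also have "\<dots> = (H \<omega> * W) ^ k" by (simp add: H_def g_def power_mult_distrib[symmetric] mult_ac)
        finally have "((S \<omega>)\<^sup>2) ^ k \<le> (H \<omega> * W) ^ k" .
        then have S2: "(S \<omega>)\<^sup>2 \<le> H \<omega> * W"
          using k Hpos W by (subst (asm) power_mono_iff) auto
        have "2 * S \<omega> \<le> H \<omega> + W"
        proof (rule power2_le_imp_le)
          have "(2 * S \<omega>)\<^sup>2 \<le> 4 * (H \<omega> * W)" using S2 by (simp add: power_mult_distrib)
          also have "\<dots> \<le> (H \<omega> + W)\<^sup>2"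
            using sum_squares_bound[of "H \<omega>" W] by (simp add: power2_sum mult_ac)
          finally show "(2 * S \<omega>)\<^sup>2 \<le> (H \<omega> + W)\<^sup>2" .
        qed (use Hpos W in auto)
        then show ?thesis unfolding target by simp
      qed
    qed
  qed
qed

section \<open>Gain functional of rank-constrained least squares\<close>

text \<open>
  The reduction of the residual sum of squares achieved by the best low-rank fit, restricted to the
  observations in \<open>A\<close>.  In this form it is subadditive in \<open>A\<close> and no division by the norm of the
  fitted values occurs.
\<close>
definition fitted_gain ::
    "nat \<Rightarrow> nat \<Rightarrow> nat \<Rightarrow> 'i set \<Rightarrow> ('i \<Rightarrow> real mat) \<Rightarrow> ('i \<Rightarrow> real) \<Rightarrow> real" where
  "fitted_gain d1 d2 r A X y =
     (SUP \<Theta>\<in>low_rank_mats d1 d2 r. \<Sum>i\<in>A. 2 * y i * hs_inner (X i) \<Theta> - (hs_inner (X i) \<Theta>)\<^sup>2)"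

lemma low_rank_mats_nonempty: "low_rank_mats d1 d2 r \<noteq> {}"
  by (simp add: low_rank_mats_eq_range)

lemma gain_term_le: "2 * y * w - w\<^sup>2 \<le> (y :: real)\<^sup>2"
  using zero_le_power2[of "y - w"] by (simp add: power2_diff algebra_simps)

lemma gain_sum_le: "(\<Sum>i\<in>A. 2 * y i * w i - (w i)\<^sup>2) \<le> (\<Sum>i\<in>A. (y i :: real)\<^sup>2)"
  by (intro sum_mono gain_term_le)

lemma fitted_gain_upper:
  assumes "\<Theta> \<in> low_rank_mats d1 d2 r"
  shows "(\<Sum>i\<in>A. 2 * y i * hs_inner (X i) \<Theta> - (hs_inner (X i) \<Theta>)\<^sup>2) \<le> fitted_gain d1 d2 r A X y"
  unfolding fitted_gain_def
  by (rule cSUP_upper[OF assms]) (use gain_sum_le in \<open>auto intro!: bdd_aboveI2\<close>)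

lemma fitted_gain_least:
  assumes "\<And>\<Theta>. \<Theta> \<in> low_rank_mats d1 d2 r \<Longrightarrow>
     (\<Sum>i\<in>A. 2 * y i * hs_inner (X i) \<Theta> - (hs_inner (X i) \<Theta>)\<^sup>2) \<le> c"
  shows "fitted_gain d1 d2 r A X y \<le> c"
  unfolding fitted_gain_def by (rule cSUP_least[OF low_rank_mats_nonempty assms])

lemma fitted_gain_le_sum_squares: "fitted_gain d1 d2 r A X y \<le> (\<Sum>i\<in>A. (y i)\<^sup>2)"
  by (intro fitted_gain_least gain_sum_le)

lemma less_fitted_gain_iff:
  "c < fitted_gain d1 d2 r A X y \<longleftrightarrow> (\<exists>\<Theta>\<in>low_rank_mats d1 d2 r.
     c < (\<Sum>i\<in>A. 2 * y i * hs_inner (X i) \<Theta> - (hs_inner (X i) \<Theta>)\<^sup>2))"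
  unfolding fitted_gain_def
  by (rule less_cSUP_iff[OF low_rank_mats_nonempty]) (use gain_sum_le in \<open>auto intro!: bdd_aboveI2\<close>)

lemma fitted_gain_union_le:
  assumes "finite A" "finite B" "A \<inter> B = {}"
  shows "fitted_gain d1 d2 r (A \<union> B) X y \<le> fitted_gain d1 d2 r A X y + fitted_gain d1 d2 r B X y"
  using assms by (intro fitted_gain_least) (simp add: sum.union_disjoint add_mono fitted_gain_upper)

lemma fitted_gain_cong:
  assumes "\<And>i. i \<in> A \<Longrightarrow> X i = X' i" "\<And>i. i \<in> A \<Longrightarrow> y i = y' i"
  shows "fitted_gain d1 d2 r A X y = fitted_gain d1 d2 r A X' y'"
  unfolding fitted_gain_def using assms by (intro SUP_cong sum.cong refl) auto

lemma hs_inner_factor_mat: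
  "A \<in> carrier_mat d1 d2 \<Longrightarrow>
   hs_inner A (factor_mat d1 d2 r \<theta>) = (\<Sum>a<d1. \<Sum>b<d2. A $$ (a, b) * factor_entry d1 r \<theta> a b)"
  by (subst hs_inner_eq_sum[of _ d1 d2]) (auto simp: factor_mat_def intro!: sum.cong)

lemma hs_inner_smult:
  assumes "A \<in> carrier_mat d1 d2" "B \<in> carrier_mat d1 d2"
  shows "hs_inner A (t \<cdot>\<^sub>m B) = t * hs_inner A B"
  using assms by (subst (1 2) hs_inner_eq_sum[of _ d1 d2]) (auto simp: sum_distrib_left mult_ac intro!: sum.cong)

text \<open>The vertex of the parabola lies at \<open>t = 1\<close>; both optimality arguments along a ray use this.\<close>
lemma quadratic_max_at_one:
  fixes b q :: real
  assumes "q \<ge> 0" and t: "\<And>t. 2 * t * b - t\<^sup>2 * q \<le> 2 * b - q"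
  shows "b = q"
proof (cases "q = 0")
  case True
  then show ?thesis using t[of 0] t[of 2] by simp
next
  case False
  then have q: "q > 0" using assms by simp
  have "2 * (b / q) * b - (b / q)\<^sup>2 * q = b\<^sup>2 / q" using q by (simp add: power2_eq_square)
  then have "b\<^sup>2 / q \<le> 2 * b - q" using t[of "b / q"] by simp
  then have "b\<^sup>2 \<le> (2 * b - q) * q" using q by (simp add: divide_le_eq)
  then have "(b - q)\<^sup>2 \<le> 0" by (simp add: power2_eq_square algebra_simps)
  then show ?thesis by simp
qed

text \<open>
  A minimizer is in particular optimal among its own multiples, hence its fitted values are
  orthogonal to the residual.
\<close>
lemma least_squares_fitted_norm:
  assumes arg: "is_arg_min (\<lambda>\<Theta>'. \<Sum>i\<in>A. (y i - hs_inner (X i) \<Theta>')\<^sup>2) (\<lambda>\<Theta>'. \<Theta>' \<in> low_rank_mats d1 d2 r) \<Theta>"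
    and fin: "finite A" and X: "\<And>i. i \<in> A \<Longrightarrow> X i \<in> carrier_mat d1 d2"
  shows "(\<Sum>i\<in>A. (hs_inner (X i) \<Theta>)\<^sup>2) = fitted_gain d1 d2 r A X y"
proof -
  define w where "w i = hs_inner (X i) \<Theta>" for i
  define b where "b = (\<Sum>i\<in>A. y i * w i)"
  define q where "q = (\<Sum>i\<in>A. (w i)\<^sup>2)"
  have \<Theta>: "\<Theta> \<in> low_rank_mats d1 d2 r"
    and min: "\<And>\<Theta>'. \<Theta>' \<in> low_rank_mats d1 d2 r \<Longrightarrow>
      (\<Sum>i\<in>A. (y i - w i)\<^sup>2) \<le> (\<Sum>i\<in>A. (y i - hs_inner (X i) \<Theta>')\<^sup>2)"
    using arg by (auto simp: is_arg_min_linorder w_def)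
  have gain_eq: "(\<Sum>i\<in>A. 2 * y i * z i - (z i)\<^sup>2) = (\<Sum>i\<in>A. (y i)\<^sup>2) - (\<Sum>i\<in>A. (y i - z i)\<^sup>2)" for z
    by (simp add: sum_subtractf[symmetric] power2_diff algebra_simps)
  have t: "2 * t * b - t\<^sup>2 * q \<le> 2 * b - q" for t
  proof -
    have "hs_inner (X i) (t \<cdot>\<^sub>m \<Theta>) = t * w i" if "i \<in> A" for i
      using hs_inner_smult[OF X[OF that]] \<Theta> by (simp add: w_def low_rank_mats_def)
    then have "(\<Sum>i\<in>A. (y i - hs_inner (X i) (t \<cdot>\<^sub>m \<Theta>))\<^sup>2) = (\<Sum>i\<in>A. (y i - t * w i)\<^sup>2)" by simp
    then have "(\<Sum>i\<in>A. 2 * y i * (t * w i) - (t * w i)\<^sup>2) \<le> (\<Sum>i\<in>A. 2 * y i * w i - (w i)\<^sup>2)"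
      unfolding gain_eq using min[OF low_rank_mats_scale[OF \<Theta>, of t]] by simp
    then show ?thesis
      by (simp add: b_def q_def sum_subtractf sum_distrib_left power_mult_distrib mult_ac)
  qed
  have bq: "b = q"
    by (rule quadratic_max_at_one[OF _ t]) (simp add: q_def sum_nonneg)
  have own: "(\<Sum>i\<in>A. 2 * y i * w i - (w i)\<^sup>2) = q"
    using bq by (simp add: b_def q_def sum_subtractf sum_distrib_left[symmetric] mult.assoc)
  show ?thesis
  proof (rule antisym)
    show "(\<Sum>i\<in>A. (hs_inner (X i) \<Theta>)\<^sup>2) \<le> fitted_gain d1 d2 r A X y"
      using fitted_gain_upper[OF \<Theta>, where A = A and y = y and X = X] own by (simp add: w_def q_def)
    show "fitted_gain d1 d2 r A X y \<le> (\<Sum>i\<in>A. (hs_inner (X i) \<Theta>)\<^sup>2)"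
    proof (rule fitted_gain_least)
      fix \<Theta>' assume "\<Theta>' \<in> low_rank_mats d1 d2 r"
      from min[OF this] have "(\<Sum>i\<in>A. 2 * y i * hs_inner (X i) \<Theta>' - (hs_inner (X i) \<Theta>')\<^sup>2) \<le> q"
        unfolding own[symmetric] gain_eq by simp
      then show "(\<Sum>i\<in>A. 2 * y i * hs_inner (X i) \<Theta>' - (hs_inner (X i) \<Theta>')\<^sup>2) \<le> (\<Sum>i\<in>A. (hs_inner (X i) \<Theta>)\<^sup>2)"
        by (simp add: q_def w_def)
    qed
  qed
qed

lemma mat_borel_carrier: "X \<in> measurable M (mat_borel d1 d2) \<Longrightarrow> \<omega> \<in> space M \<Longrightarrow> X \<omega> \<in> carrier_mat d1 d2"
  by (simp add: measurable_mat_borel_iff)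

lemma mat_borel_entry_measurable:
  "X \<in> measurable M (mat_borel d1 d2) \<Longrightarrow> a < d1 \<Longrightarrow> b < d2 \<Longrightarrow> (\<lambda>\<omega>. X \<omega> $$ (a, b)) \<in> borel_measurable M"
  by (simp add: measurable_mat_borel_iff)

lemma space_mat_borel: "space (mat_borel d1 d2) = carrier_mat d1 d2"
  by (simp add: mat_borel_def)

text \<open>
  The superlevel set at \<open>c\<close> is the union, over a countable dense set of parameters, of the events that
  the parameter achieves more than \<open>c\<close>, because the gain is continuous in the parameter.
\<close>
lemma fitted_gain_measurable:
  assumes X: "\<And>i. i \<in> A \<Longrightarrow> X i \<in> measurable M (mat_borel d1 d2)"
    and y: "\<And>i. i \<in> A \<Longrightarrow> y i \<in> borel_measurable M"
  shows "(\<lambda>\<omega>. fitted_gain d1 d2 r A (\<lambda>i. X i \<omega>) (\<lambda>i. y i \<omega>)) \<in> borel_measurable M"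
proof -
  obtain D :: "(nat \<Rightarrow> real) set" where D: "countable D" "\<And>S. open S \<Longrightarrow> S \<noteq> {} \<Longrightarrow> \<exists>d\<in>D. d \<in> S"
    using countable_dense_exists[where 'a = "nat \<Rightarrow> real"] by blast
  define v where "v x \<theta> = (\<Sum>a<d1. \<Sum>b<d2. x $$ (a, b) * factor_entry d1 r \<theta> a b)" for x :: "real mat" and \<theta>
  define g where "g \<omega> \<theta> = (\<Sum>i\<in>A. 2 * y i \<omega> * v (X i \<omega>) \<theta> - (v (X i \<omega>) \<theta>)\<^sup>2)" for \<omega> \<theta>
  have cont: "continuous_on UNIV (g \<omega>)" for \<omega>
    unfolding g_def v_def factor_entry_def
    by (intro continuous_intros continuous_on_product_coordinates)
  have iff: "c < fitted_gain d1 d2 r A (\<lambda>i. X i \<omega>) (\<lambda>i. y i \<omega>) \<longleftrightarrow> (\<exists>\<theta>\<in>D. c < g \<omega> \<theta>)"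
    if "\<omega> \<in> space M" for c \<omega>
  proof -
    have "hs_inner (X i \<omega>) (factor_mat d1 d2 r \<theta>) = v (X i \<omega>) \<theta>" if "i \<in> A" for i \<theta>
      using hs_inner_factor_mat[OF mat_borel_carrier[OF X[OF that] \<open>\<omega> \<in> space M\<close>]] by (simp add: v_def)
    then have "c < fitted_gain d1 d2 r A (\<lambda>i. X i \<omega>) (\<lambda>i. y i \<omega>) \<longleftrightarrow> (\<exists>\<theta>. c < g \<omega> \<theta>)"
      unfolding less_fitted_gain_iff low_rank_mats_eq_range g_def by (simp cong: sum.cong)
    also have "\<dots> \<longleftrightarrow> (\<exists>\<theta>\<in>D. c < g \<omega> \<theta>)"
    proof
      assume "\<exists>\<theta>. c < g \<omega> \<theta>"
      then have "{\<theta>. c < g \<omega> \<theta>} \<noteq> {}" by auto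
      moreover have "open {\<theta>. c < g \<omega> \<theta>}"
        using open_Collect_less[OF continuous_on_const cont] by simp
      ultimately show "\<exists>\<theta>\<in>D. c < g \<omega> \<theta>" using D(2) by blast
    qed blast
    finally show ?thesis .
  qed
  have gm: "(\<lambda>\<omega>. g \<omega> \<theta>) \<in> borel_measurable M" for \<theta>
    unfolding g_def v_def
    by (intro borel_measurable_sum borel_measurable_diff borel_measurable_times borel_measurable_power
        borel_measurable_const y mat_borel_entry_measurable[OF X]) auto
  show ?thesis
  proof (rule borel_measurableI_greater)
    fix c
    have "{\<omega> \<in> space M. c < fitted_gain d1 d2 r A (\<lambda>i. X i \<omega>) (\<lambda>i. y i \<omega>)} = (\<Union>\<theta>\<in>D. {\<omega> \<in> space M. c < g \<omega> \<theta>})"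
      using iff by auto
    moreover have "{\<omega> \<in> space M. c < g \<omega> \<theta>} \<in> sets M" for \<theta>
      using gm[of \<theta>] by measurable
    ultimately show "{\<omega> \<in> space M. c < fitted_gain d1 d2 r A (\<lambda>i. X i \<omega>) (\<lambda>i. y i \<omega>)} \<in> sets M"
      using D(1) by (auto intro: sets.countable_UN'')
  qed
qed

lemma (in prob_space) fitted_gain_fixed_design:
  fixes \<epsilon> :: "'i \<Rightarrow> 'a \<Rightarrow> real"
  assumes fin: "finite A" and ind: "indep_vars (\<lambda>_. borel) \<epsilon> A"
    and mgf: "\<And>i. i \<in> A \<Longrightarrow> subgaussian_mgf M V (\<epsilon> i)" and V: "V > 0"
    and d: "1 \<le> d1" "d1 \<le> d2" and r: "1 \<le> r" and x: "\<And>i. i \<in> A \<Longrightarrow> x i \<in> carrier_mat d1 d2"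
  shows "(\<integral>\<^sup>+\<omega>. ennreal (fitted_gain d1 d2 r A x (\<lambda>i. \<epsilon> i \<omega>)) \<partial>M) \<le> ennreal (768 * V * real (r * d2))"
proof (rule fixed_design_gain_bound[OF fin ind mgf V d r, where x = "\<lambda>i a b. x i $$ (a, b)"])
  fix H
  assume H: "(\<integral>\<^sup>+\<omega>. ennreal (H \<omega>) \<partial>M) \<le> ennreal (768 * V * real (r * d2))"
    and AE: "AE \<omega> in M. \<forall>\<theta>. (\<Sum>i\<in>A. 2 * \<epsilon> i \<omega> * (\<Sum>a<d1. \<Sum>b<d2. x i $$ (a, b) * factor_entry d1 r \<theta> a b) -
      (\<Sum>a<d1. \<Sum>b<d2. x i $$ (a, b) * factor_entry d1 r \<theta> a b)\<^sup>2) \<le> H \<omega>"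
  have "(\<integral>\<^sup>+\<omega>. ennreal (fitted_gain d1 d2 r A x (\<lambda>i. \<epsilon> i \<omega>)) \<partial>M) \<le> (\<integral>\<^sup>+\<omega>. ennreal (H \<omega>) \<partial>M)"
  proof (rule nn_integral_mono_AE)
    show "AE \<omega> in M. ennreal (fitted_gain d1 d2 r A x (\<lambda>i. \<epsilon> i \<omega>)) \<le> ennreal (H \<omega>)"
      using AE
    proof eventually_elim
      case (elim \<omega>)
      show ?case
      proof (intro ennreal_leI fitted_gain_least)
        fix \<Theta> assume "\<Theta> \<in> low_rank_mats d1 d2 r"
        then obtain \<theta> where \<Theta>: "\<Theta> = factor_mat d1 d2 r \<theta>" by (auto simp: low_rank_mats_eq_range)
        show "(\<Sum>i\<in>A. 2 * \<epsilon> i \<omega> * hs_inner (x i) \<Theta> - (hs_inner (x i) \<Theta>)\<^sup>2) \<le> H \<omega>"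
          using elim[rule_format, of \<theta>] by (simp add: \<Theta> hs_inner_factor_mat x cong: sum.cong)
      qed
    qed
  qed
  then show ?thesis using H by (rule order_trans)
qed

text \<open>Fubini: the bound for a fixed design does not depend on the design.\<close>
lemma (in prob_space) fitted_gain_independent_noise:
  fixes \<epsilon> :: "'i \<Rightarrow> 'a \<Rightarrow> real"
  assumes fin: "finite A" and ind: "indep_vars (\<lambda>_. borel) \<epsilon> A"
    and mgf: "\<And>i. i \<in> A \<Longrightarrow> subgaussian_mgf M V (\<epsilon> i)" and V: "V > 0"
    and d: "1 \<le> d1" "d1 \<le> d2" and r: "1 \<le> r"
    and mX: "(\<lambda>\<omega>. \<lambda>i\<in>A. X i \<omega>) \<in> measurable M (PiM A (\<lambda>_. mat_borel d1 d2))"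
    and mE: "(\<lambda>\<omega>. \<lambda>i\<in>A. \<epsilon> i \<omega>) \<in> measurable M (PiM A (\<lambda>_. borel))"
    and dist: "distr M (PiM A (\<lambda>_. mat_borel d1 d2)) (\<lambda>\<omega>. \<lambda>i\<in>A. X i \<omega>) \<Otimes>\<^sub>M
       distr M (PiM A (\<lambda>_. borel)) (\<lambda>\<omega>. \<lambda>i\<in>A. \<epsilon> i \<omega>) =
       distr M (PiM A (\<lambda>_. mat_borel d1 d2) \<Otimes>\<^sub>M PiM A (\<lambda>_. borel)) (\<lambda>\<omega>. (\<lambda>i\<in>A. X i \<omega>, \<lambda>i\<in>A. \<epsilon> i \<omega>))"
  shows "(\<integral>\<^sup>+\<omega>. ennreal (fitted_gain d1 d2 r A (\<lambda>i. X i \<omega>) (\<lambda>i. \<epsilon> i \<omega>)) \<partial>M)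
     \<le> ennreal (768 * V * real (r * d2))"
proof -
  let ?S = "PiM A (\<lambda>_. mat_borel d1 d2)" and ?T = "PiM A (\<lambda>_. borel) :: ('i \<Rightarrow> real) measure"
  let ?X = "\<lambda>\<omega>. \<lambda>i\<in>A. X i \<omega>" and ?E = "\<lambda>\<omega>. \<lambda>i\<in>A. \<epsilon> i \<omega>"
  define F where "F p = ennreal (fitted_gain d1 d2 r A (fst p) (snd p))" for p :: "('i \<Rightarrow> real mat) \<times> ('i \<Rightarrow> real)"
  have F: "F \<in> borel_measurable (?S \<Otimes>\<^sub>M ?T)"
    unfolding F_def
    by (intro measurable_compose[OF _ measurable_ennreal] fitted_gain_measurable
        measurable_compose[OF measurable_fst measurable_component_singleton]
        measurable_compose[OF measurable_snd measurable_component_singleton])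
  interpret E: prob_space "distr M ?T ?E" by (rule prob_space_distr[OF mE])
  have "(\<integral>\<^sup>+\<omega>. ennreal (fitted_gain d1 d2 r A (\<lambda>i. X i \<omega>) (\<lambda>i. \<epsilon> i \<omega>)) \<partial>M) = (\<integral>\<^sup>+\<omega>. F (?X \<omega>, ?E \<omega>) \<partial>M)"
    unfolding F_def by (intro nn_integral_cong arg_cong[where f = ennreal] fitted_gain_cong) auto
  also have "\<dots> = (\<integral>\<^sup>+p. F p \<partial>distr M (?S \<Otimes>\<^sub>M ?T) (\<lambda>\<omega>. (?X \<omega>, ?E \<omega>)))"
    using mX mE F by (intro nn_integral_distr[symmetric]) auto
  also have "\<dots> = (\<integral>\<^sup>+x. (\<integral>\<^sup>+e. F (x, e) \<partial>distr M ?T ?E) \<partial>distr M ?S ?X)"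
    unfolding dist[symmetric] using F by (intro E.nn_integral_fst[symmetric]) simp
  also have "\<dots> \<le> (\<integral>\<^sup>+x. ennreal (768 * V * real (r * d2)) \<partial>distr M ?S ?X)"
  proof (rule nn_integral_mono)
    fix x assume "x \<in> space (distr M ?S ?X)"
    then have x: "x \<in> space ?S" by simp
    have "(\<integral>\<^sup>+e. F (x, e) \<partial>distr M ?T ?E) = (\<integral>\<^sup>+\<omega>. F (x, ?E \<omega>) \<partial>M)"
      using mE measurable_Pair2[OF F x] by (intro nn_integral_distr) auto
    also have "\<dots> = (\<integral>\<^sup>+\<omega>. ennreal (fitted_gain d1 d2 r A x (\<lambda>i. \<epsilon> i \<omega>)) \<partial>M)"
      unfolding F_def by (intro nn_integral_cong arg_cong[where f = ennreal] fitted_gain_cong) auto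
    also have "\<dots> \<le> ennreal (768 * V * real (r * d2))"
      using x by (intro fitted_gain_fixed_design fin ind mgf V d r) (auto simp: space_PiM space_mat_borel)
    finally show "(\<integral>\<^sup>+e. F (x, e) \<partial>distr M ?T ?E) \<le> ennreal (768 * V * real (r * d2))" .
  qed
  also have "\<dots> = ennreal (768 * V * real (r * d2))"
    using prob_space.emeasure_space_1[OF prob_space_distr[OF mX]] by simp
  finally show ?thesis .
qed

lemma (in prob_space) indep_var_distr_pair:
  assumes ind: "indep_var S' P T' Q" and f: "f \<in> measurable S' S" and g: "g \<in> measurable T' T"
  shows "distr M S (\<lambda>\<omega>. f (P \<omega>)) \<Otimes>\<^sub>M distr M T (\<lambda>\<omega>. g (Q \<omega>)) =
    distr M (S \<Otimes>\<^sub>M T) (\<lambda>\<omega>. (f (P \<omega>), g (Q \<omega>)))"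
proof -
  have P: "P \<in> measurable M S'" and Q: "Q \<in> measurable M T'"
    and dist: "distr M S' P \<Otimes>\<^sub>M distr M T' Q = distr M (S' \<Otimes>\<^sub>M T') (\<lambda>\<omega>. (P \<omega>, Q \<omega>))"
    using ind unfolding indep_var_distribution_eq by auto
  have sf: "sigma_finite_measure (distr (distr M T' Q) T g)"
    using g by (intro prob_space_imp_sigma_finite prob_space.prob_space_distr prob_space_distr Q) simp
  have "distr M S (\<lambda>\<omega>. f (P \<omega>)) \<Otimes>\<^sub>M distr M T (\<lambda>\<omega>. g (Q \<omega>)) =
      distr (distr M S' P) S f \<Otimes>\<^sub>M distr (distr M T' Q) T g"
    using f g P Q by (simp add: distr_distr comp_def)
  also have "\<dots> = distr (distr M S' P \<Otimes>\<^sub>M distr M T' Q) (S \<Otimes>\<^sub>M T) (\<lambda>(x, y). (f x, g y))"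
    using f g by (intro pair_measure_distr sf) auto
  also have "\<dots> = distr M (S \<Otimes>\<^sub>M T) (\<lambda>\<omega>. (f (P \<omega>), g (Q \<omega>)))"
    unfolding dist using f g P Q by (subst distr_distr) (auto simp: comp_def)
  finally show ?thesis .
qed

text \<open>
  In the graph that joins \<open>i\<close> to \<open>f i\<close> every vertex has degree at most two, so a colouring extends
  greedily.  In \<open>permuted_gain_expectation\<close> the colour classes separate each covariate from the response
  that the permutation attaches to it.
\<close>
lemma three_colouring_of_injection:
  assumes "finite S" "inj_on f S"
  shows "\<exists>c :: 'a \<Rightarrow> nat. (\<forall>i\<in>S. c i < 3) \<and> (\<forall>i\<in>S. f i \<in> S \<longrightarrow> f i \<noteq> i \<longrightarrow> c (f i) \<noteq> c i)"
  using assms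
proof (induction S rule: finite_induct)
  case empty
  show ?case by simp
next
  case (insert x S)
  then obtain c :: "'a \<Rightarrow> nat" where c: "\<And>i. i \<in> S \<Longrightarrow> c i < 3"
    "\<And>i. i \<in> S \<Longrightarrow> f i \<in> S \<Longrightarrow> f i \<noteq> i \<Longrightarrow> c (f i) \<noteq> c i"
    by (auto simp: inj_on_insert)
  define z where "z = (SOME j. j \<in> S \<and> f j = x)"
  have z: "j = z" if "j \<in> S" "f j = x" for j
  proof -
    have "z \<in> S \<and> f z = x" unfolding z_def by (rule someI[of _ j]) (use that in blast)
    then show ?thesis using that insert.prems by (auto simp: inj_on_def)
  qed
  have "\<exists>m<3. m \<noteq> p \<and> m \<noteq> q" for p q :: nat by presburger
  then obtain m where m: "m < 3" "m \<noteq> c (f x)" "m \<noteq> c z" by blast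
  show ?case
  proof (intro exI[of _ "c(x := m)"] conjI ballI impI)
    fix i assume "i \<in> insert x S"
    then show "(c(x := m)) i < 3" using c m by auto
  next
    fix i assume i: "i \<in> insert x S" "f i \<in> insert x S" "f i \<noteq> i"
    show "(c(x := m)) (f i) \<noteq> (c(x := m)) i"
      using i c(2)[of i] z[of i] m by (cases "i = x"; cases "f i = x") auto
  qed
qed

section \<open>Random permutations and exchangeability\<close>

lemma ennreal_add_le: "ennreal (a + b) \<le> ennreal a + ennreal b"
proof -
  have "ennreal (a + b) \<le> ennreal (max 0 a + max 0 b)" by (intro ennreal_leI) auto
  also have "\<dots> = ennreal a + ennreal b" by (simp add: ennreal_plus max_def ennreal_neg)
  finally show ?thesis .
qed

lemma measurable_component_fst:
  "i \<in> I \<Longrightarrow> (\<lambda>p. fst (p i)) \<in> measurable (PiM I (\<lambda>_. MX \<Otimes>\<^sub>M MY)) MX"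
  by (rule measurable_compose[OF measurable_component_singleton[of i I "\<lambda>_. MX \<Otimes>\<^sub>M MY"] measurable_fst])

lemma measurable_component_snd:
  "i \<in> I \<Longrightarrow> (\<lambda>p. snd (p i)) \<in> measurable (PiM I (\<lambda>_. MX \<Otimes>\<^sub>M MY)) MY"
  by (rule measurable_compose[OF measurable_component_singleton[of i I "\<lambda>_. MX \<Otimes>\<^sub>M MY"] measurable_snd])

lemma (in prob_space) indep_vars_reindex:
  assumes ind: "indep_vars M' X (f ` I)" and inj: "inj_on f I"
  shows "indep_vars (\<lambda>i. M' (f i)) (\<lambda>i. X (f i)) I"
  unfolding indep_vars_def2 indep_sets_def
proof (intro conjI ballI allI impI)
  fix i assume "i \<in> I"
  then show "random_variable (M' (f i)) (X (f i))" using ind by (auto simp: indep_vars_def2)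
next
  fix i assume "i \<in> I"
  then show "{X (f i) -` A \<inter> space M |A. A \<in> sets (M' (f i))} \<subseteq> events"
    using ind by (fastforce simp: indep_vars_def2 indep_sets_def)
next
  fix J A
  assume J: "J \<subseteq> I" "J \<noteq> {}" "finite J"
    and A: "A \<in> (\<Pi> i\<in>J. {X (f i) -` A \<inter> space M |A. A \<in> sets (M' (f i))})"
  define A' where "A' k = A (inv_into I f k)" for k
  have A': "A' (f j) = A j" if "j \<in> J" for j
    using that J inj by (simp add: A'_def subset_iff)
  have "A' \<in> (\<Pi> k\<in>f ` J. {X k -` A \<inter> space M |A. A \<in> sets (M' k)})"
    using A A' by (fastforce simp: Pi_iff)
  moreover have "indep_sets (\<lambda>k. {X k -` A \<inter> space M |A. A \<in> sets (M' k)}) (f ` I)"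
    using ind by (simp add: indep_vars_def2)
  ultimately have "prob (\<Inter>k\<in>f ` J. A' k) = (\<Prod>k\<in>f ` J. prob (A' k))"
    using J by (intro indep_setsD[where I = "f ` I"]) (auto simp: Pi_iff)
  moreover have "(\<Inter>k\<in>f ` J. A' k) = (\<Inter>j\<in>J. A j)" using A' by auto
  moreover have "(\<Prod>k\<in>f ` J. prob (A' k)) = (\<Prod>j\<in>J. prob (A j))"
    using inj_on_subset[OF inj J(1)] A' by (simp add: prod.reindex)
  ultimately show "prob (\<Inter>j\<in>J. A j) = (\<Prod>j\<in>J. prob (A j))" by simp
qed

text \<open>
  Each of the three colour classes contributes a pure-noise gain of at most \<open>768 * V * r * d2\<close>.  At a
  fixed point of the permutation response and covariate stay paired; there the gain is bounded by the
  squared response, of expectation at most \<open>24 * V\<close>.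
\<close>
lemma (in prob_space) permuted_gain_expectation:
  fixes X :: "nat \<Rightarrow> 'a \<Rightarrow> real mat" and y :: "nat \<Rightarrow> 'a \<Rightarrow> real"
  assumes Z: "indep_vars (\<lambda>_. mat_borel d1 d2 \<Otimes>\<^sub>M borel) (\<lambda>i \<omega>. (X i \<omega>, y i \<omega>)) S" and fin: "finite S"
    and mgf: "\<And>i. i \<in> S \<Longrightarrow> subgaussian_mgf M V (y i)" and V: "V > 0"
    and d: "1 \<le> d1" "d1 \<le> d2" and r: "1 \<le> r" and \<pi>: "\<pi> permutes S"
  shows "(\<integral>\<^sup>+\<omega>. ennreal (fitted_gain d1 d2 r S (\<lambda>i. X i \<omega>) (\<lambda>i. y (\<pi> i) \<omega>)) \<partial>M)
     \<le> ennreal (2304 * V * real (r * d2) + 24 * V * real (card {i \<in> S. \<pi> i = i}))"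
proof -
  have inj: "inj_on \<pi> S" using \<pi> by (rule permutes_inj_on)
  have \<pi>S: "\<pi> i \<in> S" if "i \<in> S" for i using permutes_in_image[OF \<pi>] that by simp
  obtain c :: "nat \<Rightarrow> nat" where c: "\<And>i. i \<in> S \<Longrightarrow> c i < 3"
    "\<And>i. i \<in> S \<Longrightarrow> \<pi> i \<noteq> i \<Longrightarrow> c (\<pi> i) \<noteq> c i"
    using three_colouring_of_injection[OF fin inj] \<pi>S by blast
  define A where "A k = {i \<in> S. \<pi> i \<noteq> i \<and> c i = k}" for k
  define F where "F = {i \<in> S. \<pi> i = i}"
  have Zm: "(\<lambda>\<omega>. (X i \<omega>, y i \<omega>)) \<in> measurable M (mat_borel d1 d2 \<Otimes>\<^sub>M borel)" if "i \<in> S" for i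
    using Z that by (auto simp: indep_vars_def2)
  have Xm: "X i \<in> measurable M (mat_borel d1 d2)" if "i \<in> S" for i
    using measurable_compose[OF Zm[OF that] measurable_fst] by simp
  have ym: "y i \<in> borel_measurable M" if "i \<in> S" for i
    using mgf[OF that] by (simp add: subgaussian_mgf_def)
  have gm: "(\<lambda>\<omega>. fitted_gain d1 d2 r B (\<lambda>i. X i \<omega>) (\<lambda>i. y (\<pi> i) \<omega>)) \<in> borel_measurable M" if "B \<subseteq> S" for B
    using that by (intro fitted_gain_measurable Xm ym \<pi>S) auto
  have y_ind: "indep_vars (\<lambda>_. borel) y S"
    using indep_vars_compose2[OF Z, where Y = "\<lambda>_. snd" and N = "\<lambda>_. borel"] by simp
  have part: "(\<integral>\<^sup>+\<omega>. ennreal (fitted_gain d1 d2 r (A k) (\<lambda>i. X i \<omega>) (\<lambda>i. y (\<pi> i) \<omega>)) \<partial>M)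
     \<le> ennreal (768 * V * real (r * d2))" for k
  proof -
    have AS: "A k \<subseteq> S" by (auto simp: A_def)
    have "\<pi> i \<notin> A k" if "i \<in> A k" for i using c(2)[of i] that by (simp add: A_def)
    then have disj: "A k \<inter> \<pi> ` A k = {}" by blast
    have ind: "indep_vars (\<lambda>_. borel) (\<lambda>i. y (\<pi> i)) (A k)"
      using indep_vars_reindex[OF indep_vars_subset[OF y_ind, of "\<pi> ` A k"] inj_on_subset[OF inj AS]] AS \<pi>S
      by auto
    let ?Z = "\<lambda>B \<omega>. \<lambda>i\<in>B. (X i \<omega>, y i \<omega>)"
    let ?f = "\<lambda>p. \<lambda>i\<in>A k. fst (p i) :: real mat" and ?g = "\<lambda>p. \<lambda>i\<in>A k. snd (p (\<pi> i)) :: real"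
    have f: "?f \<in> measurable (PiM (A k) (\<lambda>_. mat_borel d1 d2 \<Otimes>\<^sub>M borel)) (PiM (A k) (\<lambda>_. mat_borel d1 d2))"
      by (intro measurable_restrict measurable_component_fst)
    have g: "?g \<in> measurable (PiM (\<pi> ` A k) (\<lambda>_. mat_borel d1 d2 \<Otimes>\<^sub>M borel)) (PiM (A k) (\<lambda>_. borel))"
      by (intro measurable_restrict measurable_component_snd) auto
    have f_eq: "?f (?Z (A k) \<omega>) = (\<lambda>i\<in>A k. X i \<omega>)" for \<omega> by auto
    have g_eq: "?g (?Z (\<pi> ` A k) \<omega>) = (\<lambda>i\<in>A k. y (\<pi> i) \<omega>)" for \<omega> by auto
    have ind2: "indep_var (PiM (A k) (\<lambda>_. mat_borel d1 d2 \<Otimes>\<^sub>M borel)) (?Z (A k))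
        (PiM (\<pi> ` A k) (\<lambda>_. mat_borel d1 d2 \<Otimes>\<^sub>M borel)) (?Z (\<pi> ` A k))"
      by (rule indep_var_restrict[OF Z disj]) (use AS \<pi>S in auto)
    show ?thesis
    proof (rule fitted_gain_independent_noise)
      show "finite (A k)" using fin by (simp add: A_def)
      show "indep_vars (\<lambda>_. borel) (\<lambda>i. y (\<pi> i)) (A k)" by (rule ind)
      show "subgaussian_mgf M V (y (\<pi> i))" if "i \<in> A k" for i using that AS \<pi>S mgf by auto
      show "(\<lambda>\<omega>. \<lambda>i\<in>A k. X i \<omega>) \<in> measurable M (PiM (A k) (\<lambda>_. mat_borel d1 d2))"
        using AS by (intro measurable_restrict Xm) auto
      show "(\<lambda>\<omega>. \<lambda>i\<in>A k. y (\<pi> i) \<omega>) \<in> measurable M (PiM (A k) (\<lambda>_. borel))"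
        using AS by (intro measurable_restrict ym \<pi>S) auto
      show "distr M (PiM (A k) (\<lambda>_. mat_borel d1 d2)) (\<lambda>\<omega>. \<lambda>i\<in>A k. X i \<omega>) \<Otimes>\<^sub>M
         distr M (PiM (A k) (\<lambda>_. borel)) (\<lambda>\<omega>. \<lambda>i\<in>A k. y (\<pi> i) \<omega>) =
         distr M (PiM (A k) (\<lambda>_. mat_borel d1 d2) \<Otimes>\<^sub>M PiM (A k) (\<lambda>_. borel))
           (\<lambda>\<omega>. (\<lambda>i\<in>A k. X i \<omega>, \<lambda>i\<in>A k. y (\<pi> i) \<omega>))"
        using indep_var_distr_pair[OF ind2 f g] unfolding f_eq g_eq .
    qed (use V d r in auto)
  qed
  have fixed: "(\<integral>\<^sup>+\<omega>. ennreal (fitted_gain d1 d2 r F (\<lambda>i. X i \<omega>) (\<lambda>i. y (\<pi> i) \<omega>)) \<partial>M) \<le> ennreal (24 * V * real (card F))"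
  proof -
    have mom: "integrable M (\<lambda>\<omega>. (y i \<omega>)\<^sup>2) \<and> expectation (\<lambda>\<omega>. (y i \<omega>)\<^sup>2) \<le> 24 * V" if "i \<in> F" for i
      using subgaussian_mgf_moment[OF mgf[of i] V, of 1] that by (simp add: F_def)
    have "(\<integral>\<^sup>+\<omega>. ennreal (fitted_gain d1 d2 r F (\<lambda>i. X i \<omega>) (\<lambda>i. y (\<pi> i) \<omega>)) \<partial>M)
        \<le> (\<integral>\<^sup>+\<omega>. ennreal (\<Sum>i\<in>F. (y i \<omega>)\<^sup>2) \<partial>M)"
    proof (intro nn_integral_mono ennreal_leI)
      fix \<omega>
      have "fitted_gain d1 d2 r F (\<lambda>i. X i \<omega>) (\<lambda>i. y (\<pi> i) \<omega>) \<le> (\<Sum>i\<in>F. (y (\<pi> i) \<omega>)\<^sup>2)"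
        by (rule fitted_gain_le_sum_squares)
      also have "\<dots> = (\<Sum>i\<in>F. (y i \<omega>)\<^sup>2)" by (intro sum.cong) (auto simp: F_def)
      finally show "fitted_gain d1 d2 r F (\<lambda>i. X i \<omega>) (\<lambda>i. y (\<pi> i) \<omega>) \<le> (\<Sum>i\<in>F. (y i \<omega>)\<^sup>2)" .
    qed
    also have "\<dots> = ennreal (expectation (\<lambda>\<omega>. \<Sum>i\<in>F. (y i \<omega>)\<^sup>2))"
      using mom by (intro nn_integral_eq_integral) (auto intro!: AE_I2 sum_nonneg)
    also have "expectation (\<lambda>\<omega>. \<Sum>i\<in>F. (y i \<omega>)\<^sup>2) = (\<Sum>i\<in>F. expectation (\<lambda>\<omega>. (y i \<omega>)\<^sup>2))"
      using mom by (intro Bochner_Integration.integral_sum) auto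
    also have "\<dots> \<le> (\<Sum>i\<in>F. 24 * V)" using mom by (intro sum_mono) auto
    also have "\<dots> = 24 * V * real (card F)" by simp
    finally show ?thesis by (simp add: ennreal_leI)
  qed
  let ?L = "\<lambda>B \<omega>. fitted_gain d1 d2 r B (\<lambda>i. X i \<omega>) (\<lambda>i. y (\<pi> i) \<omega>)"
  have split: "S = ((A 0 \<union> A 1) \<union> A 2) \<union> F"
  proof -
    have "c i = 0 \<or> c i = 1 \<or> c i = 2" if "i \<in> S" for i using c(1)[OF that] by linarith
    then show ?thesis by (auto simp: A_def F_def)
  qed
  have finA: "finite (A k)" "finite F" for k using fin by (auto simp: A_def F_def)
  have "?L S \<omega> \<le> ?L (A 0) \<omega> + ?L (A 1) \<omega> + ?L (A 2) \<omega> + ?L F \<omega>" for \<omega>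
  proof -
    have "?L S \<omega> = ?L (((A 0 \<union> A 1) \<union> A 2) \<union> F) \<omega>" using split by simp
    also have "\<dots> \<le> ?L ((A 0 \<union> A 1) \<union> A 2) \<omega> + ?L F \<omega>"
      by (rule fitted_gain_union_le) (use finA in \<open>auto simp: A_def F_def\<close>)
    also have "?L ((A 0 \<union> A 1) \<union> A 2) \<omega> \<le> ?L (A 0 \<union> A 1) \<omega> + ?L (A 2) \<omega>"
      by (rule fitted_gain_union_le) (use finA in \<open>auto simp: A_def F_def\<close>)
    also have "?L (A 0 \<union> A 1) \<omega> \<le> ?L (A 0) \<omega> + ?L (A 1) \<omega>"
      by (rule fitted_gain_union_le) (use finA in \<open>auto simp: A_def F_def\<close>)
    finally show ?thesis by simp
  qed
  then have "ennreal (?L S \<omega>) \<le> ennreal (?L (A 0) \<omega>) + ennreal (?L (A 1) \<omega>) + ennreal (?L (A 2) \<omega>) + ennreal (?L F \<omega>)" for \<omega>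
    by (meson ennreal_leI ennreal_add_le add_mono order_trans order_refl)
  then have "(\<integral>\<^sup>+\<omega>. ennreal (?L S \<omega>) \<partial>M) \<le>
      (\<integral>\<^sup>+\<omega>. ennreal (?L (A 0) \<omega>) + ennreal (?L (A 1) \<omega>) + ennreal (?L (A 2) \<omega>) + ennreal (?L F \<omega>) \<partial>M)"
    by (intro nn_integral_mono)
  also have "\<dots> = (\<integral>\<^sup>+\<omega>. ennreal (?L (A 0) \<omega>) \<partial>M) + (\<integral>\<^sup>+\<omega>. ennreal (?L (A 1) \<omega>) \<partial>M)
      + (\<integral>\<^sup>+\<omega>. ennreal (?L (A 2) \<omega>) \<partial>M) + (\<integral>\<^sup>+\<omega>. ennreal (?L F \<omega>) \<partial>M)"
  proof -
    have m: "(\<lambda>\<omega>. ennreal (?L B \<omega>)) \<in> borel_measurable M" if "B \<subseteq> S" for B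
      using gm[OF that] by measurable
    have "A k \<subseteq> S" "F \<subseteq> S" for k by (auto simp: A_def F_def)
    note ms = m[OF this(1)] m[OF this(2)]
    show ?thesis using ms by (simp add: nn_integral_add)
  qed
  also have "\<dots> \<le> ennreal (768 * V * real (r * d2)) + ennreal (768 * V * real (r * d2))
      + ennreal (768 * V * real (r * d2)) + ennreal (24 * V * real (card F))"
    by (intro add_mono part fixed)
  also have "\<dots> = ennreal (2304 * V * real (r * d2) + 24 * V * real (card F))"
    using V by (simp add: ennreal_plus[symmetric] del: ennreal_plus)
  finally show ?thesis by (simp add: F_def)
qed

lemma sum_card_fixed_points:
  assumes fin: "finite S"
  shows "(\<Sum>\<pi> | \<pi> permutes S. card {i \<in> S. \<pi> i = i}) = (if S = {} then 0 else fact (card S))"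
proof -
  have "(\<Sum>\<pi> | \<pi> permutes S. card {i \<in> S. \<pi> i = i}) = (\<Sum>\<pi> | \<pi> permutes S. \<Sum>i\<in>S. if \<pi> i = i then 1 else 0)"
    using fin by (intro sum.cong refl) (simp add: sum.If_cases Int_def)
  also have "\<dots> = (\<Sum>i\<in>S. \<Sum>\<pi> | \<pi> permutes S. if \<pi> i = i then 1 else 0)" by (rule sum.swap)
  also have "\<dots> = (\<Sum>i\<in>S. card {\<pi>. \<pi> permutes S \<and> \<pi> i = i})"
    using fin by (intro sum.cong refl) (simp add: sum.If_cases finite_permutations Int_def)
  also have "\<dots> = (\<Sum>i\<in>S. fact (card S - 1))"
  proof (intro sum.cong refl)
    fix i assume i: "i \<in> S"
    have "{\<pi>. \<pi> permutes S \<and> \<pi> i = i} = {\<pi>. \<pi> permutes (S - {i})}"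
    proof (intro Collect_cong iffI)
      fix \<pi> assume p: "\<pi> permutes S \<and> \<pi> i = i"
      show "\<pi> permutes (S - {i})"
        by (rule permutes_superset[of \<pi> S]) (use p in auto)
    next
      fix \<pi> assume p: "\<pi> permutes (S - {i})"
      show "\<pi> permutes S \<and> \<pi> i = i"
        using permutes_subset[OF p Diff_subset] permutes_not_in[OF p, of i] by simp
    qed
    then show "card {\<pi>. \<pi> permutes S \<and> \<pi> i = i} = fact (card S - 1)"
      using fin i by (simp add: card_permutations)
  qed
  also have "\<dots> = (if S = {} then 0 else fact (card S))"
    using fin by (auto simp: fact_reduce[of "card S"] card_gt_0_iff)
  finally show ?thesis .
qed

text \<open>
  Among the elements of small rank the one with the least value already dominates all of them, so there
  are no more of them than its rank permits.  This is the deterministic core of the validity of a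
  permutation test, with ties counted conservatively.
\<close>
lemma card_low_ranks_le:
  fixes T :: "'p \<Rightarrow> real"
  assumes "finite P" "c \<ge> 0"
  shows "real (card {\<sigma> \<in> P. real (card {\<tau> \<in> P. T \<sigma> \<le> T \<tau>}) \<le> c}) \<le> c"
proof (cases "{\<sigma> \<in> P. real (card {\<tau> \<in> P. T \<sigma> \<le> T \<tau>}) \<le> c} = {}")
  case True
  show ?thesis unfolding True using assms by simp
next
  case False
  let ?B = "{\<sigma> \<in> P. real (card {\<tau> \<in> P. T \<sigma> \<le> T \<tau>}) \<le> c}"
  have fin: "finite ?B" using assms by simp
  have "Min (T ` ?B) \<in> T ` ?B" using fin False by (intro Min_in) auto
  then obtain \<sigma> where "\<sigma> \<in> ?B" "T \<sigma> = Min (T ` ?B)" by force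
  then have \<sigma>: "\<sigma> \<in> ?B" "\<And>\<tau>. \<tau> \<in> ?B \<Longrightarrow> T \<sigma> \<le> T \<tau>" using fin by (auto intro!: Min_le)
  have "card ?B \<le> card {\<tau> \<in> P. T \<sigma> \<le> T \<tau>}"
    using assms \<sigma> by (intro card_mono) auto
  then show ?thesis using \<sigma>(1) by simp
qed

text \<open>
  The independent pairs, whose components are independent too, form one independent family of twice the size.
  The components differ in type; padding them to pairs by the constants \<open>x0\<close> and \<open>y0\<close> makes them
  members of a single family, which can then be split into covariates and responses.
\<close>
lemma (in prob_space) indep_families:
  fixes X :: "'i \<Rightarrow> 'a \<Rightarrow> 'x" and y :: "'i \<Rightarrow> 'a \<Rightarrow> 'y"
  assumes fin: "finite S" and ne: "S \<noteq> {}"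
    and Z: "indep_vars (\<lambda>_. MX \<Otimes>\<^sub>M MY) (\<lambda>i \<omega>. (X i \<omega>, y i \<omega>)) S"
    and XY: "\<And>i A B. i \<in> S \<Longrightarrow> A \<in> sets MX \<Longrightarrow> B \<in> sets MY \<Longrightarrow>
      prob ((X i -` A \<inter> space M) \<inter> (y i -` B \<inter> space M)) = prob (X i -` A \<inter> space M) * prob (y i -` B \<inter> space M)"
    and x0: "x0 \<in> space MX" and y0: "y0 \<in> space MY"
  shows "indep_vars (\<lambda>_. MX \<Otimes>\<^sub>M MY) (\<lambda>(i, b) \<omega>. if b then (X i \<omega>, y0) else (x0, y i \<omega>)) (S \<times> UNIV)"
proof -
  let ?W = "\<lambda>(i, b) \<omega>. if b then (X i \<omega>, y0) else (x0, y i \<omega>)"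
  have Zm: "(\<lambda>\<omega>. (X i \<omega>, y i \<omega>)) \<in> measurable M (MX \<Otimes>\<^sub>M MY)" if "i \<in> S" for i
    using Z that by (auto simp: indep_vars_def2)
  have Xm: "X i \<in> measurable M MX" if "i \<in> S" for i
    using measurable_compose[OF Zm[OF that] measurable_fst] by simp
  have ym: "y i \<in> measurable M MY" if "i \<in> S" for i
    using measurable_compose[OF Zm[OF that] measurable_snd] by simp
  have Wm: "?W j \<in> measurable M (MX \<Otimes>\<^sub>M MY)" if "j \<in> S \<times> UNIV" for j
    using that x0 y0 Xm ym by (cases j; cases "snd j") auto
  let ?F = "\<lambda>j. {?W j -` A \<inter> space M |A. A \<in> sets (MX \<Otimes>\<^sub>M MY)}"
  have formX: "\<exists>A\<in>sets MX. E = X i -` A \<inter> space M" if "i \<in> S" and E: "E \<in> ?F (i, True)" for i E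
  proof -
    obtain C where C: "C \<in> sets (MX \<Otimes>\<^sub>M MY)" "E = ?W (i, True) -` C \<inter> space M" using E by blast
    have "(\<lambda>x. (x, y0)) -` C \<inter> space MX \<in> sets MX"
      using C(1) y0 by (intro measurable_sets) auto
    moreover have "E = X i -` ((\<lambda>x. (x, y0)) -` C \<inter> space MX) \<inter> space M"
      unfolding C(2) using measurable_space[OF Xm[OF \<open>i \<in> S\<close>]] by auto
    ultimately show ?thesis by blast
  qed
  have formY: "\<exists>B\<in>sets MY. E = y i -` B \<inter> space M" if "i \<in> S" and E: "E \<in> ?F (i, False)" for i E
  proof -
    obtain C where C: "C \<in> sets (MX \<Otimes>\<^sub>M MY)" "E = ?W (i, False) -` C \<inter> space M" using E by blast
    have "(\<lambda>z. (x0, z)) -` C \<inter> space MY \<in> sets MY"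
      using C(1) x0 by (intro measurable_sets) auto
    moreover have "E = y i -` ((\<lambda>z. (x0, z)) -` C \<inter> space MY) \<inter> space M"
      unfolding C(2) using measurable_space[OF ym[OF \<open>i \<in> S\<close>]] by auto
    ultimately show ?thesis by blast
  qed
  have "indep_sets ?F (S \<times> UNIV)"
  proof (subst indep_sets_finite)
    show "S \<times> (UNIV :: bool set) \<noteq> {}" "finite (S \<times> (UNIV :: bool set))" using fin ne by auto
    show "?F j \<subseteq> events" if "j \<in> S \<times> UNIV" for j
      using measurable_sets[OF Wm[OF that]] by blast
    show "space M \<in> ?F j" if "j \<in> S \<times> UNIV" for j
    proof -
      have "?W j -` space (MX \<Otimes>\<^sub>M MY) \<inter> space M = space M"
        using measurable_space[OF Wm[OF that]] by blast
      then show ?thesis by (intro CollectI exI[of _ "space (MX \<Otimes>\<^sub>M MY)"]) simp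
    qed
    show "\<forall>A\<in>Pi (S \<times> UNIV) ?F. prob (\<Inter>j\<in>S \<times> UNIV. A j) = (\<Prod>j\<in>S \<times> UNIV. prob (A j))"
    proof
      fix A assume A: "A \<in> Pi (S \<times> UNIV) ?F"
      have "\<exists>B. B \<in> sets MX \<and> A (i, True) = X i -` B \<inter> space M" if "i \<in> S" for i
        using formX[OF that Pi_mem[OF A]] that by blast
      then obtain B where B: "\<And>i. i \<in> S \<Longrightarrow> B i \<in> sets MX \<and> A (i, True) = X i -` B i \<inter> space M" by metis
      have "\<exists>C. C \<in> sets MY \<and> A (i, False) = y i -` C \<inter> space M" if "i \<in> S" for i
        using formY[OF that Pi_mem[OF A]] that by blast
      then obtain C where C: "\<And>i. i \<in> S \<Longrightarrow> C i \<in> sets MY \<and> A (i, False) = y i -` C i \<inter> space M" by metis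
      define D where "D i = (\<lambda>\<omega>. (X i \<omega>, y i \<omega>)) -` (B i \<times> C i) \<inter> space M" for i
      have D: "D i = A (i, True) \<inter> A (i, False)" if "i \<in> S" for i
        using B C that by (auto simp: D_def)
      have inter: "(\<Inter>j\<in>S \<times> UNIV. A j) = (\<Inter>i\<in>S. D i)"
        using D by (auto simp: UNIV_bool)
      have indZ: "indep_sets (\<lambda>i. {(\<lambda>\<omega>. (X i \<omega>, y i \<omega>)) -` A \<inter> space M |A. A \<in> sets (MX \<Otimes>\<^sub>M MY)}) S"
        using Z by (simp add: indep_vars_def2)
      have memZ: "D i \<in> {(\<lambda>\<omega>. (X i \<omega>, y i \<omega>)) -` A \<inter> space M |A. A \<in> sets (MX \<Otimes>\<^sub>M MY)}" if "i \<in> S" for i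
        unfolding D_def
        by (intro CollectI exI[of _ "B i \<times> C i"] conjI refl pair_measureI
            conjunct1[OF B[OF that]] conjunct1[OF C[OF that]])
      have "prob (\<Inter>j\<in>S \<times> UNIV. A j) = (\<Prod>i\<in>S. prob (D i))"
        unfolding inter using fin ne memZ by (intro indep_setsD[OF indZ]) auto
      also have "\<dots> = (\<Prod>i\<in>S. prob (A (i, True)) * prob (A (i, False)))"
      proof (rule prod.cong[OF refl])
        fix i assume i: "i \<in> S"
        have "prob (D i) = prob ((X i -` B i \<inter> space M) \<inter> (y i -` C i \<inter> space M))"
          using D[OF i] conjunct2[OF B[OF i]] conjunct2[OF C[OF i]] by metis
        also have "\<dots> = prob (X i -` B i \<inter> space M) * prob (y i -` C i \<inter> space M)"
          by (rule XY[OF i conjunct1[OF B[OF i]] conjunct1[OF C[OF i]]])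
        finally show "prob (D i) = prob (A (i, True)) * prob (A (i, False))"
          using conjunct2[OF B[OF i]] conjunct2[OF C[OF i]] by metis
      qed
      also have "\<dots> = (\<Prod>i\<in>S. \<Prod>b\<in>UNIV. prob (A (i, b)))"
        by (simp add: UNIV_bool mult.commute)
      also have "\<dots> = (\<Prod>j\<in>S \<times> UNIV. prob (A j))"
        by (simp add: prod.cartesian_product)
      finally show "prob (\<Inter>j\<in>S \<times> UNIV. A j) = (\<Prod>j\<in>S \<times> UNIV. prob (A j))" .
    qed
  qed
  then show ?thesis using Wm unfolding indep_vars_def2 by simp
qed

text \<open>
  Both sides are the product of the law of the covariates with a power of the common law \<open>Q\<close> of the
  responses.
\<close>
lemma (in prob_space) permuted_response_same_law:
  fixes X :: "'i \<Rightarrow> 'a \<Rightarrow> 'x" and y :: "'i \<Rightarrow> 'a \<Rightarrow> 'y"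
  assumes fin: "finite S" and ne: "S \<noteq> {}"
    and Z: "indep_vars (\<lambda>_. MX \<Otimes>\<^sub>M MY) (\<lambda>i \<omega>. (X i \<omega>, y i \<omega>)) S"
    and XY: "\<And>i A B. i \<in> S \<Longrightarrow> A \<in> sets MX \<Longrightarrow> B \<in> sets MY \<Longrightarrow>
      prob ((X i -` A \<inter> space M) \<inter> (y i -` B \<inter> space M)) = prob (X i -` A \<inter> space M) * prob (y i -` B \<inter> space M)"
    and law: "\<And>i. i \<in> S \<Longrightarrow> distr M MY (y i) = Q"
    and \<sigma>: "\<sigma> permutes S"
  shows "distr M (PiM S (\<lambda>_. MX) \<Otimes>\<^sub>M PiM S (\<lambda>_. MY)) (\<lambda>\<omega>. (\<lambda>i\<in>S. X i \<omega>, \<lambda>i\<in>S. y (\<sigma> i) \<omega>)) =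
    distr M (PiM S (\<lambda>_. MX) \<Otimes>\<^sub>M PiM S (\<lambda>_. MY)) (\<lambda>\<omega>. (\<lambda>i\<in>S. X i \<omega>, \<lambda>i\<in>S. y i \<omega>))"
proof -
  have Zm: "(\<lambda>\<omega>. (X i \<omega>, y i \<omega>)) \<in> measurable M (MX \<Otimes>\<^sub>M MY)" if "i \<in> S" for i
    using Z that by (auto simp: indep_vars_def2)
  have ym: "y i \<in> measurable M MY" if "i \<in> S" for i
    using measurable_compose[OF Zm[OF that] measurable_snd] by simp
  obtain \<omega>0 where "\<omega>0 \<in> space M" using not_empty by blast
  moreover obtain i0 where "i0 \<in> S" using ne by blast
  ultimately have "(X i0 \<omega>0, y i0 \<omega>0) \<in> space (MX \<Otimes>\<^sub>M MY)" using measurable_space[OF Zm] by blast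
  then obtain x0 y0 where x0: "x0 \<in> space MX" and y0: "y0 \<in> space MY" by (auto simp: space_pair_measure)
  let ?W = "\<lambda>(i, b) \<omega>. if b then (X i \<omega>, y0) else (x0, y i \<omega>)"
  have W: "indep_vars (\<lambda>_. MX \<Otimes>\<^sub>M MY) ?W (S \<times> UNIV)"
    by (rule indep_families[OF fin ne Z XY x0 y0])
  have ind: "indep_var (PiM (S \<times> {True}) (\<lambda>_. MX \<Otimes>\<^sub>M MY)) (\<lambda>\<omega>. \<lambda>j\<in>S \<times> {True}. ?W j \<omega>)
     (PiM (S \<times> {False}) (\<lambda>_. MX \<Otimes>\<^sub>M MY)) (\<lambda>\<omega>. \<lambda>j\<in>S \<times> {False}. ?W j \<omega>)"
    by (rule indep_var_restrict[OF W]) auto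
  let ?f = "\<lambda>p. \<lambda>i\<in>S. fst (p (i, True)) :: 'x"
  have f: "?f \<in> measurable (PiM (S \<times> {True}) (\<lambda>_. MX \<Otimes>\<^sub>M MY)) (PiM S (\<lambda>_. MX))"
    by (intro measurable_restrict measurable_component_fst) auto
  have f_eq: "?f (\<lambda>j\<in>S \<times> {True}. ?W j \<omega>) = (\<lambda>i\<in>S. X i \<omega>)" for \<omega> by auto
  have prod: "distr M (PiM S (\<lambda>_. MX)) (\<lambda>\<omega>. \<lambda>i\<in>S. X i \<omega>) \<Otimes>\<^sub>M PiM S (\<lambda>_. Q) =
     distr M (PiM S (\<lambda>_. MX) \<Otimes>\<^sub>M PiM S (\<lambda>_. MY)) (\<lambda>\<omega>. (\<lambda>i\<in>S. X i \<omega>, \<lambda>i\<in>S. y (\<tau> i) \<omega>))"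
    if \<tau>: "\<tau> permutes S" for \<tau>
  proof -
    have \<tau>S: "\<tau> i \<in> S" if "i \<in> S" for i using permutes_in_image[OF \<tau>] that by simp
    let ?g = "\<lambda>p. \<lambda>i\<in>S. snd (p (\<tau> i, False)) :: 'y"
    have g: "?g \<in> measurable (PiM (S \<times> {False}) (\<lambda>_. MX \<Otimes>\<^sub>M MY)) (PiM S (\<lambda>_. MY))"
      using \<tau>S by (intro measurable_restrict measurable_component_snd) auto
    have g_eq: "?g (\<lambda>j\<in>S \<times> {False}. ?W j \<omega>) = (\<lambda>i\<in>S. y (\<tau> i) \<omega>)" for \<omega> using \<tau>S by auto
    have y_ind: "indep_vars (\<lambda>_. MY) y S"
      using indep_vars_compose2[OF Z, where Y = "\<lambda>_. snd" and N = "\<lambda>_. MY"] by simp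
    have y\<tau>: "indep_vars (\<lambda>_. MY) (\<lambda>i. y (\<tau> i)) S"
      by (rule indep_vars_reindex) (use y_ind \<tau> in \<open>auto simp: permutes_image permutes_inj_on\<close>)
    have "distr M (PiM S (\<lambda>_. MY)) (\<lambda>\<omega>. \<lambda>i\<in>S. y (\<tau> i) \<omega>) = PiM S (\<lambda>i. distr M MY (y (\<tau> i)))"
      using y\<tau> by (subst (asm) indep_vars_iff_distr_eq_PiM') (use ne ym \<tau>S in auto)
    also have "\<dots> = PiM S (\<lambda>_. Q)" using law \<tau>S by (intro PiM_cong) auto
    finally have "distr M (PiM S (\<lambda>_. MY)) (\<lambda>\<omega>. \<lambda>i\<in>S. y (\<tau> i) \<omega>) = PiM S (\<lambda>_. Q)" .
    then show ?thesis using indep_var_distr_pair[OF ind f g] unfolding f_eq g_eq by simp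
  qed
  show ?thesis using prod[OF \<sigma>] prod[OF permutes_id] by simp
qed

section \<open>Second moments of sub-Gaussian vectors and Chebyshev bounds\<close>

lemma psi2_norm_less_exp_square:
  assumes "psi2_norm M \<xi> < ereal t" "0 < t"
  shows "(\<integral>\<^sup>+\<omega>. ennreal (exp ((\<xi> \<omega>)\<^sup>2 / t\<^sup>2)) \<partial>M) \<le> 2"
proof -
  obtain u where u: "0 < u" "(\<integral>\<^sup>+\<omega>. ennreal (exp ((\<xi> \<omega>)\<^sup>2 / u\<^sup>2)) \<partial>M) \<le> 2" "u < t"
    using assms(1) unfolding psi2_norm_def INF_less_iff by auto
  have "(\<integral>\<^sup>+\<omega>. ennreal (exp ((\<xi> \<omega>)\<^sup>2 / t\<^sup>2)) \<partial>M) \<le> (\<integral>\<^sup>+\<omega>. ennreal (exp ((\<xi> \<omega>)\<^sup>2 / u\<^sup>2)) \<partial>M)"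
    using u by (intro nn_integral_mono ennreal_leI) (auto intro!: divide_left_mono power_mono)
  then show ?thesis using u(2) by (rule order_trans)
qed

text \<open>Both moment bounds follow from \<open>x \<le> exp x\<close> and \<open>x\<^sup>2 \<le> 2 * exp x\<close> at \<open>x = Z\<^sup>2 / m\<close>.\<close>
lemma (in prob_space) exp_square_moments:
  assumes [measurable]: "Z \<in> borel_measurable M" and "m > 0"
    and psi: "(\<integral>\<^sup>+\<omega>. ennreal (exp ((Z \<omega>)\<^sup>2 / m)) \<partial>M) \<le> 2"
  shows "sq_int M Z" "expectation (\<lambda>\<omega>. (Z \<omega>)\<^sup>2) \<le> 2 * m"
    "integrable M (\<lambda>\<omega>. (Z \<omega>) ^ 4)" "expectation (\<lambda>\<omega>. (Z \<omega>) ^ 4) \<le> 4 * m\<^sup>2"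
proof -
  define f where "f \<omega> = exp ((Z \<omega>)\<^sup>2 / m)" for \<omega>
  have f[measurable]: "f \<in> borel_measurable M" unfolding f_def by measurable
  have intf: "integrable M f" and If: "expectation f \<le> 2"
    using exp_square_integrable[OF assms(1) psi] by (simp_all add: f_def[abs_def])
  have b: "(Z \<omega>)\<^sup>2 \<le> m * f \<omega> \<and> (Z \<omega>) ^ 4 \<le> 2 * m\<^sup>2 * f \<omega>" for \<omega>
  proof -
    define x where "x = (Z \<omega>)\<^sup>2 / m"
    have x: "x \<ge> 0" using \<open>m > 0\<close> by (simp add: x_def)
    have Z2: "(Z \<omega>)\<^sup>2 = m * x" using \<open>m > 0\<close> by (simp add: x_def)
    have "(Z \<omega>) ^ 4 = ((Z \<omega>)\<^sup>2)\<^sup>2" by simp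
    then have Z4: "(Z \<omega>) ^ 4 = m\<^sup>2 * x\<^sup>2" unfolding Z2 by (simp add: power_mult_distrib)
    have e: "1 + x + x\<^sup>2 / 2 \<le> exp x" using x by (rule exp_lower_Taylor_quadratic)
    then have "x \<le> exp x" "x\<^sup>2 \<le> 2 * exp x" using x zero_le_power2[of x] by linarith+
    then show ?thesis
      unfolding Z2 Z4 f_def x_def[symmetric]
      using \<open>m > 0\<close> by (auto simp: mult.assoc intro: mult_left_mono)
  qed
  have i2: "integrable M (\<lambda>\<omega>. (Z \<omega>)\<^sup>2)"
    by (rule Bochner_Integration.integrable_bound[of M "\<lambda>\<omega>. m * f \<omega>"])
      (use intf b in \<open>auto intro!: AE_I2 intro: order_trans[OF _ abs_ge_self]\<close>)
  then show "sq_int M Z" using assms(1) by (simp add: sq_int_def)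
  show i4: "integrable M (\<lambda>\<omega>. (Z \<omega>) ^ 4)"
    by (rule Bochner_Integration.integrable_bound[of M "\<lambda>\<omega>. 2 * m\<^sup>2 * f \<omega>"])
      (use intf b in \<open>auto intro!: AE_I2 intro: order_trans[OF _ abs_ge_self]\<close>)
  have "expectation (\<lambda>\<omega>. (Z \<omega>)\<^sup>2) \<le> expectation (\<lambda>\<omega>. m * f \<omega>)"
    using i2 intf b by (intro integral_mono) auto
  also have "\<dots> \<le> 2 * m" using If \<open>m > 0\<close> by simp
  finally show "expectation (\<lambda>\<omega>. (Z \<omega>)\<^sup>2) \<le> 2 * m" .
  have "expectation (\<lambda>\<omega>. (Z \<omega>) ^ 4) \<le> expectation (\<lambda>\<omega>. 2 * m\<^sup>2 * f \<omega>)"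
    using i4 intf b by (intro integral_mono) auto
  also have "\<dots> \<le> 4 * m\<^sup>2" using mult_left_mono[OF If, of "2 * m\<^sup>2"] by simp
  finally show "expectation (\<lambda>\<omega>. (Z \<omega>) ^ 4) \<le> 4 * m\<^sup>2" .
qed

lemma sq_int_integrable:
  assumes "finite_measure M" "sq_int M f"
  shows "integrable M f"
proof -
  interpret finite_measure M by fact
  have "sq_int M (\<lambda>_. 1)" by (simp add: sq_int_def)
  from sq_int_mult_integrable[OF assms(2) this] show ?thesis by simp
qed

lemma scalar_prod_eq_sum: "v \<in> carrier_vec N \<Longrightarrow> u \<bullet> v = (\<Sum>k<N. u $ k * v $ k)"
  by (auto simp: scalar_prod_def atLeast0LessThan)

text \<open>
  The infimum in the Orlicz norm need not be attained, and \<open>K\<close> may be zero; the admissible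
  parameter \<open>\<bar>K\<bar> + 1\<close> avoids both problems.
\<close>
lemma (in prob_space) subgaussian_vec_exp_square:
  assumes sg: "subgaussian_vec M N K \<xi>" and v: "v \<in> carrier_vec N" "v \<bullet> v \<le> b\<^sup>2" and "b > 0"
  shows "(\<integral>\<^sup>+\<omega>. ennreal (exp ((\<xi> \<omega> \<bullet> v)\<^sup>2 / ((\<bar>K\<bar> + 1)\<^sup>2 * b\<^sup>2))) \<partial>M) \<le> 2"
proof -
  have vv: "v \<bullet> v = (\<Sum>k<N. (v $ k)\<^sup>2)"
    using v by (simp add: scalar_prod_eq_sum[of _ N] power2_eq_square)
  show ?thesis
  proof (cases "v \<bullet> v = 0")
    case True
    then have "v $ k = 0" if "k < N" for k using that unfolding vv by (simp add: sum_nonneg_eq_0_iff)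
    then have "\<xi> \<omega> \<bullet> v = 0" for \<omega> using v by (simp add: scalar_prod_eq_sum[of _ N])
    then show ?thesis using emeasure_space_1 by simp
  next
    case False
    moreover have "v \<bullet> v \<ge> 0" unfolding vv by (simp add: sum_nonneg)
    ultimately have pos: "v \<bullet> v > 0" by simp
    define c where "c = sqrt (v \<bullet> v)"
    have c: "c > 0" "c\<^sup>2 = v \<bullet> v" using pos by (auto simp: c_def)
    define u where "u = (1 / c) \<cdot>\<^sub>v v"
    have u: "u \<in> carrier_vec N" using v by (simp add: u_def)
    have xu: "x \<bullet> u = (x \<bullet> v) / c" for x
      using v u by (simp add: scalar_prod_eq_sum[of _ N] u_def sum_divide_distrib)
    have "u \<bullet> u = (\<Sum>k<N. (v $ k)\<^sup>2 / c\<^sup>2)"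
      using v u by (simp add: scalar_prod_eq_sum[of _ N] u_def power2_eq_square)
    also have "\<dots> = 1" using pos unfolding sum_divide_distrib[symmetric] vv[symmetric] c(2) by simp
    finally have "psi2_norm M (\<lambda>\<omega>. \<xi> \<omega> \<bullet> u) \<le> (SUP v\<in>{v \<in> carrier_vec N. sqrt (v \<bullet> v) = 1}. psi2_norm M (\<lambda>\<omega>. \<xi> \<omega> \<bullet> v))"
      using u by (intro SUP_upper) simp
    also have "\<dots> \<le> ereal K" using sg by (simp add: subgaussian_vec_def)
    also have "\<dots> < ereal (\<bar>K\<bar> + 1)" by simp
    finally have *: "(\<integral>\<^sup>+\<omega>. ennreal (exp ((\<xi> \<omega> \<bullet> u)\<^sup>2 / (\<bar>K\<bar> + 1)\<^sup>2)) \<partial>M) \<le> 2"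
      by (rule psi2_norm_less_exp_square) simp
    have K: "(\<bar>K\<bar> + 1)\<^sup>2 > 0" by (intro zero_less_power) simp
    have "(\<xi> \<omega> \<bullet> v)\<^sup>2 / ((\<bar>K\<bar> + 1)\<^sup>2 * b\<^sup>2) \<le> (\<xi> \<omega> \<bullet> u)\<^sup>2 / (\<bar>K\<bar> + 1)\<^sup>2" for \<omega>
    proof -
      have "(\<xi> \<omega> \<bullet> v)\<^sup>2 / ((\<bar>K\<bar> + 1)\<^sup>2 * b\<^sup>2) \<le> (\<xi> \<omega> \<bullet> v)\<^sup>2 / ((\<bar>K\<bar> + 1)\<^sup>2 * c\<^sup>2)"
        using v(2) c pos \<open>b > 0\<close> K by (intro divide_left_mono mult_left_mono mult_pos_pos) auto
      then show ?thesis by (simp add: xu power_divide mult.commute)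
    qed
    then have "(\<integral>\<^sup>+\<omega>. ennreal (exp ((\<xi> \<omega> \<bullet> v)\<^sup>2 / ((\<bar>K\<bar> + 1)\<^sup>2 * b\<^sup>2))) \<partial>M) \<le>
        (\<integral>\<^sup>+\<omega>. ennreal (exp ((\<xi> \<omega> \<bullet> u)\<^sup>2 / (\<bar>K\<bar> + 1)\<^sup>2)) \<partial>M)"
      by (intro nn_integral_mono ennreal_leI) simp
    then show ?thesis using * by (rule order_trans)
  qed
qed

lemma covariance_quadratic_form:
  fixes \<xi> :: "'w \<Rightarrow> real Matrix.vec"
  assumes sq: "\<And>k. k < N \<Longrightarrow> sq_int M (\<lambda>\<omega>. \<xi> \<omega> $ k)" and mean: "mean_vec M N \<xi> = 0\<^sub>v N" and v: "v \<in> carrier_vec N"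
  shows "v \<bullet> (covariance_mat M N \<xi> *\<^sub>v v) = (\<integral>\<omega>. (\<xi> \<omega> \<bullet> v)\<^sup>2 \<partial>M)"
proof -
  have int: "integrable M (\<lambda>\<omega>. \<xi> \<omega> $ k * \<xi> \<omega> $ l)" if "k < N" "l < N" for k l
    using that by (intro sq_int_mult_integrable sq)
  have "(covariance_mat M N \<xi> *\<^sub>v v) $ k = (\<Sum>l<N. (\<integral>\<omega>. \<xi> \<omega> $ k * \<xi> \<omega> $ l \<partial>M) * v $ l)" if "k < N" for k
    using that v by (simp add: covariance_mat_def scalar_prod_eq_sum[of _ N] mean)
  then have cov: "(covariance_mat M N \<xi> *\<^sub>v v) $ k = (\<Sum>l<N. (\<integral>\<omega>. \<xi> \<omega> $ k * \<xi> \<omega> $ l \<partial>M) * v $ l)" if "k < N" for k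
    using that .
  have "covariance_mat M N \<xi> \<in> carrier_mat N N"
    unfolding covariance_mat_def by (rule mat_carrier)
  then have carr: "covariance_mat M N \<xi> *\<^sub>v v \<in> carrier_vec N"
    using v by (rule mult_mat_vec_carrier)
  have "v \<bullet> (covariance_mat M N \<xi> *\<^sub>v v) = (\<Sum>k<N. v $ k * (\<Sum>l<N. (\<integral>\<omega>. \<xi> \<omega> $ k * \<xi> \<omega> $ l \<partial>M) * v $ l))"
    unfolding scalar_prod_eq_sum[OF carr] by (intro sum.cong refl) (simp only: cov lessThan_iff)
  also have "\<dots> = (\<Sum>k<N. \<Sum>l<N. (\<integral>\<omega>. v $ k * v $ l * (\<xi> \<omega> $ k * \<xi> \<omega> $ l) \<partial>M))"
    unfolding sum_distrib_left by (intro sum.cong refl) simp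
  also have "\<dots> = (\<integral>\<omega>. (\<Sum>k<N. \<Sum>l<N. v $ k * v $ l * (\<xi> \<omega> $ k * \<xi> \<omega> $ l)) \<partial>M)"
    using int by (subst Bochner_Integration.integral_sum, force)+ simp
  also have "\<dots> = (\<integral>\<omega>. (\<xi> \<omega> \<bullet> v)\<^sup>2 \<partial>M)"
    using v by (intro Bochner_Integration.integral_cong refl)
      (simp add: scalar_prod_eq_sum[of _ N] power2_eq_square sum_product mult_ac)
  finally show ?thesis .
qed

lemma vectorize_carrier: "A \<in> carrier_mat d1 d2 \<Longrightarrow> vectorize A \<in> carrier_vec (d1 * d2)"
  unfolding vectorize_def using vec_carrier by (metis carrier_matD)

lemma vectorize_index:
  assumes "A \<in> carrier_mat d1 d2" "k < d1 * d2"
  shows "vectorize A $ k = A $$ (k mod d1, k div d1)" "k mod d1 < d1" "k div d1 < d2"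
proof -
  have "d1 > 0" using assms(2) by (cases d1) auto
  then show "k mod d1 < d1" by simp
  show "k div d1 < d2" using assms(2) by (simp add: less_mult_imp_div_less mult.commute)
  show "vectorize A $ k = A $$ (k mod d1, k div d1)" using assms by (simp add: vectorize_def)
qed

lemma hs_inner_vectorize:
  assumes A: "A \<in> carrier_mat d1 d2" and B: "B \<in> carrier_mat d1 d2"
  shows "hs_inner A B = vectorize A \<bullet> vectorize B"
proof (cases "d1 = 0")
  case True
  then show ?thesis using assms
    by (simp add: hs_inner_eq_sum[of _ d1 d2] scalar_prod_eq_sum[OF vectorize_carrier[OF B]])
next
  case False
  have "vectorize A \<bullet> vectorize B = (\<Sum>k<d2 * d1. A $$ (k mod d1, k div d1) * B $$ (k mod d1, k div d1))"
    using vectorize_index(1)[OF A] vectorize_index(1)[OF B]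
    by (simp add: scalar_prod_eq_sum[OF vectorize_carrier[OF B]] mult.commute[of d2])
  also have "\<dots> = (\<Sum>b<d2. \<Sum>k\<in>{b * d1..<b * d1 + d1}. A $$ (k mod d1, k div d1) * B $$ (k mod d1, k div d1))"
    by (rule sum.nat_group[symmetric])
  also have "\<dots> = (\<Sum>b<d2. \<Sum>a<d1. A $$ (a, b) * B $$ (a, b))"
  proof (rule sum.cong[OF refl])
    fix b
    have "(\<Sum>k\<in>{b * d1..<b * d1 + d1}. A $$ (k mod d1, k div d1) * B $$ (k mod d1, k div d1)) =
        (\<Sum>a\<in>{0..<d1}. A $$ ((a + b * d1) mod d1, (a + b * d1) div d1) * B $$ ((a + b * d1) mod d1, (a + b * d1) div d1))"
      using sum.shift_bounds_nat_ivl[of "\<lambda>k. A $$ (k mod d1, k div d1) * B $$ (k mod d1, k div d1)" 0 "b * d1" d1]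
      by (simp add: add.commute)
    also have "\<dots> = (\<Sum>a<d1. A $$ (a, b) * B $$ (a, b))"
      unfolding atLeast0LessThan using False by (intro sum.cong refl) simp
    finally show "(\<Sum>k\<in>{b * d1..<b * d1 + d1}. A $$ (k mod d1, k div d1) * B $$ (k mod d1, k div d1)) =
        (\<Sum>a<d1. A $$ (a, b) * B $$ (a, b))" .
  qed
  also have "\<dots> = hs_inner A B"
    unfolding hs_inner_eq_sum[OF A B] by (rule sum.swap)
  finally show ?thesis by simp
qed

lemma (in prob_space) chebyshev_lower_tail_sum:
  fixes g :: "nat \<Rightarrow> 'a \<Rightarrow> real"
  assumes ind: "indep_vars (\<lambda>_. borel) g {1..n}" and n: "n \<ge> 1"
    and sq: "\<And>i. i \<in> {1..n} \<Longrightarrow> sq_int M (g i)"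
    and mean: "\<And>i. i \<in> {1..n} \<Longrightarrow> expectation (g i) = s" and "s > 0"
    and v: "\<And>i. i \<in> {1..n} \<Longrightarrow> expectation (\<lambda>\<omega>. (g i \<omega>)\<^sup>2) \<le> v"
  shows "prob {\<omega> \<in> space M. (\<Sum>i=1..n. g i \<omega>) \<le> real n * s / 2} \<le> 4 * v / (real n * s\<^sup>2)"
proof -
  define h where "h i \<omega> = g i \<omega> - s" for i \<omega>
  have fm: "finite_measure M" by (rule finite_measure_axioms)
  have ig: "integrable M (g i)" if "i \<in> {1..n}" for i using sq_int_integrable[OF fm sq[OF that]] .
  have hsq: "sq_int M (h i)" if "i \<in> {1..n}" for i
    using sq_int_add[OF sq[OF that], of "\<lambda>_. - s"] by (simp add: h_def[abs_def] sq_int_def)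
  have gm[measurable]: "g i \<in> borel_measurable M" if "i \<in> {1..n}" for i using sq[OF that] by (simp add: sq_int_def)
  have h0: "expectation (h i) = 0" if "i \<in> {1..n}" for i
    using ig[OF that] mean[OF that] by (simp add: h_def[abs_def] prob_space)
  have h2: "expectation (\<lambda>\<omega>. (h i \<omega>)\<^sup>2) \<le> v" if i: "i \<in> {1..n}" for i
  proof -
    have "expectation (\<lambda>\<omega>. (h i \<omega>)\<^sup>2) = expectation (\<lambda>\<omega>. (g i \<omega>)\<^sup>2 - 2 * s * g i \<omega> + s\<^sup>2)"
      by (intro Bochner_Integration.integral_cong refl) (simp add: h_def power2_diff mult_ac)
    also have "\<dots> = expectation (\<lambda>\<omega>. (g i \<omega>)\<^sup>2) - 2 * s * s + s\<^sup>2"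
      using ig[OF i] sq[OF i] mean[OF i] by (simp add: sq_int_def prob_space)
    also have "\<dots> = expectation (\<lambda>\<omega>. (g i \<omega>)\<^sup>2) - s\<^sup>2" by (simp add: power2_eq_square)
    also have "\<dots> \<le> v" using v[OF i] zero_le_power2[of s] by linarith
    finally show ?thesis .
  qed
  have ind_h: "indep_vars (\<lambda>_. borel) h {1..n}"
    unfolding h_def[abs_def] by (rule indep_vars_compose2[OF ind]) measurable
  have cross: "expectation (\<lambda>\<omega>. h i \<omega> * h j \<omega>) = 0" if ij: "i \<in> {1..n}" "j \<in> {1..n}" "i \<noteq> j" for i j
  proof -
    have "indep_var borel (h i) borel (h j)"
    proof -
      have "indep_vars (\<lambda>_. borel) (\<lambda>k. h (if k then i else j)) (UNIV :: bool set)"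
        by (rule indep_vars_reindex[OF indep_vars_subset[OF ind_h]]) (use ij in \<open>auto simp: inj_on_def\<close>)
      moreover have "case_bool (h i) (h j) = (\<lambda>k. h (if k then i else j))"
        by (rule ext) (simp split: bool.split)
      moreover have "case_bool borel borel = (\<lambda>_. borel :: real measure)"
        by (rule ext) (simp split: bool.split)
      ultimately show ?thesis unfolding indep_var_def by simp
    qed
    from indep_var_lebesgue_integral[OF this sq_int_integrable[OF fm hsq[OF ij(1)]] sq_int_integrable[OF fm hsq[OF ij(2)]]]
    show ?thesis using h0[OF ij(1)] by simp
  qed
  define S where "S \<omega> = (\<Sum>i=1..n. h i \<omega>)" for \<omega>
  have Ssq: "sq_int M S" unfolding S_def using hsq by (intro sq_int_sum) auto
  have S2: "expectation (\<lambda>\<omega>. (S \<omega>)\<^sup>2) \<le> real n * v"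
  proof -
    have "expectation (\<lambda>\<omega>. (S \<omega>)\<^sup>2) = expectation (\<lambda>\<omega>. \<Sum>i=1..n. \<Sum>j=1..n. h i \<omega> * h j \<omega>)"
      unfolding S_def by (simp add: power2_eq_square sum_product)
    also have "\<dots> = (\<Sum>i=1..n. \<Sum>j=1..n. expectation (\<lambda>\<omega>. h i \<omega> * h j \<omega>))"
    proof -
      have int: "integrable M (\<lambda>\<omega>. h i \<omega> * h j \<omega>)" if "i \<in> {1..n}" "j \<in> {1..n}" for i j
        using hsq that by (intro sq_int_mult_integrable) auto
      have "expectation (\<lambda>\<omega>. \<Sum>i=1..n. \<Sum>j=1..n. h i \<omega> * h j \<omega>) =
          (\<Sum>i=1..n. expectation (\<lambda>\<omega>. \<Sum>j=1..n. h i \<omega> * h j \<omega>))"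
        by (rule Bochner_Integration.integral_sum, rule Bochner_Integration.integrable_sum, rule int)
      also have "\<dots> = (\<Sum>i=1..n. \<Sum>j=1..n. expectation (\<lambda>\<omega>. h i \<omega> * h j \<omega>))"
        by (rule sum.cong[OF refl], rule Bochner_Integration.integral_sum, rule int)
      finally show ?thesis .
    qed
    also have "\<dots> = (\<Sum>i=1..n. \<Sum>j=1..n. if i = j then expectation (\<lambda>\<omega>. (h i \<omega>)\<^sup>2) else 0)"
      using cross by (intro sum.cong refl) (auto simp: power2_eq_square)
    also have "\<dots> = (\<Sum>i=1..n. expectation (\<lambda>\<omega>. (h i \<omega>)\<^sup>2))" by (simp add: sum.delta)
    also have "\<dots> \<le> (\<Sum>i=1..n. v)" using h2 by (intro sum_mono) auto
    finally show ?thesis by simp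
  qed
  have t: "real n * s / 2 > 0" using n \<open>s > 0\<close> by simp
  have Sm[measurable]: "S \<in> borel_measurable M" using Ssq by (simp add: sq_int_def)
  have "{\<omega> \<in> space M. (\<Sum>i=1..n. g i \<omega>) \<le> real n * s / 2} \<subseteq> {\<omega> \<in> space M. (S \<omega>)\<^sup>2 \<ge> (real n * s / 2)\<^sup>2}"
  proof (intro subsetI CollectI conjI; clarsimp)
    fix \<omega> assume "(\<Sum>i=Suc 0..n. g i \<omega>) * 2 \<le> real n * s"
    then have "S \<omega> \<le> - (real n * s / 2)" by (simp add: S_def h_def sum_subtractf)
    then have "(real n * s / 2)\<^sup>2 \<le> (- S \<omega>)\<^sup>2" using t by (intro power_mono) auto
    then show "(real n * s / 2)\<^sup>2 \<le> (S \<omega>)\<^sup>2" by simp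
  qed
  then have "prob {\<omega> \<in> space M. (\<Sum>i=1..n. g i \<omega>) \<le> real n * s / 2} \<le> prob {\<omega> \<in> space M. (S \<omega>)\<^sup>2 \<ge> (real n * s / 2)\<^sup>2}"
    by (intro finite_measure_mono) auto
  also have "\<dots> \<le> expectation (\<lambda>\<omega>. (S \<omega>)\<^sup>2) / (real n * s / 2)\<^sup>2"
  proof (rule integral_Markov_inequality_measure[where A = "{}"])
    show "integrable M (\<lambda>\<omega>. (S \<omega>)\<^sup>2)" using Ssq by (simp add: sq_int_def)
    show "0 < (real n * s / 2)\<^sup>2" using t by (rule zero_less_power)
  qed simp_all
  also have "\<dots> \<le> real n * v / (real n * s / 2)\<^sup>2" using S2 by (intro divide_right_mono) auto
  also have "(real n * s / 2)\<^sup>2 = real n * (real n * s\<^sup>2 / 4)" by (simp add: power2_eq_square)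
  also have "real n * v / (real n * (real n * s\<^sup>2 / 4)) = 4 * v / (real n * s\<^sup>2)" using n by simp
  finally show ?thesis .
qed

section \<open>Arithmetic of the error bounds\<close>

text \<open>
  The threshold on \<open>h\<close> leaves the limiting power at least half way between \<open>\<alpha>\<close> and 1, which gives the
  strict inequality in the limit.
\<close>
lemma power_from_error_bound:
  fixes \<alpha> C h Q :: real
  assumes \<alpha>: "0 < \<alpha>" "\<alpha> < 1" and h: "h > 0" "2 * C / (\<alpha> * (1 - \<alpha>)) \<le> h" and Q: "Q \<le> C / h"
  shows "(1 + \<alpha>) / 2 \<le> 1 - Q / \<alpha>"
proof -
  have "2 * C \<le> h * (\<alpha> * (1 - \<alpha>))" using h(2) \<alpha> by (simp add: divide_le_eq)
  then have "C / h \<le> \<alpha> * (1 - \<alpha>) / 2" using h(1) by (simp add: divide_le_eq mult_ac)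
  then have "Q \<le> \<alpha> * (1 - \<alpha>) / 2" using Q by linarith
  then have "Q / \<alpha> \<le> \<alpha> * (1 - \<alpha>) / 2 / \<alpha>" using \<alpha> by (intro divide_right_mono) auto
  also have "\<dots> = (1 - \<alpha>) / 2" using \<alpha> by simp
  finally show ?thesis by (simp add: field_simps)
qed

lemma permutation_noise_term_bound:
  fixes V R h ns :: real
  assumes "V > 0" "R \<ge> 1" "h > 0" "h * R \<le> ns"
  shows "2 * (2304 * V * R + 24 * V) / ns \<le> 4656 * V / h"
proof -
  have hR: "h * R > 0" using assms by simp
  have "2 * (2304 * V * R + 24 * V) \<le> 4656 * V * R"
    using assms mult_left_mono[of 1 R "48 * V"] by simp
  then have "2 * (2304 * V * R + 24 * V) / ns \<le> 4656 * V * R / (h * R)"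
    using assms hR by (intro frac_le) auto
  also have "\<dots> = 4656 * V / h" using assms by simp
  finally show ?thesis .
qed

section \<open>Trace regression samples\<close>

locale trace_regression_instance =
  fixes K\<^sub>x K\<^sub>\<epsilon> \<sigma> :: real and n :: nat and S :: "'w trace_regression"
  assumes model: "trace_regression_model K\<^sub>x K\<^sub>\<epsilon> \<sigma> n S"
begin

abbreviation "M \<equiv> Pr S"
abbreviation "d1 \<equiv> nrow S"
abbreviation "d2 \<equiv> ncol S"
abbreviation "MX \<equiv> mat_borel d1 d2"

lemma prob_space_M: "prob_space M"
  using model by (simp add: trace_regression_model_def)

end

sublocale trace_regression_instance \<subseteq> prob_space "Pr S"
  by (rule prob_space_M)

context trace_regression_instance
begin

lemma dims: "1 \<le> d1" "d1 \<le> d2" "1 \<le> rk S"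
  and Theta_star_carrier: "Theta_star S \<in> carrier_mat d1 d2"
  and X_pop_measurable: "X_pop S \<in> measurable M MX"
  and X_pop_subgaussian: "subgaussian_vec M (d1 * d2) K\<^sub>x (\<lambda>\<omega>. vectorize (X_pop S \<omega>))"
  and X_pop_mean: "mean_vec M (d1 * d2) (\<lambda>\<omega>. vectorize (X_pop S \<omega>)) = 0\<^sub>v (d1 * d2)"
  and Sigma_eq: "Sigma S = covariance_mat M (d1 * d2) (\<lambda>\<omega>. vectorize (X_pop S \<omega>))"
  and eps_measurable: "eps_pop S \<in> borel_measurable M"
  and eps_subgaussian: "subgaussian M K\<^sub>\<epsilon> (eps_pop S)"
  and eps_mean: "expectation (eps_pop S) = 0"
  and X_eps_indep: "indep_set (sets (vimage_algebra (space M) (X_pop S) MX))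
       (sets (vimage_algebra (space M) (eps_pop S) borel))"
  and sample_indep: "indep_vars (\<lambda>_. MX \<Otimes>\<^sub>M borel) (\<lambda>i \<omega>. (X_smp S i \<omega>, y_smp S i \<omega>)) {1..n}"
  and sample_law: "\<And>i. i \<in> {1..n} \<Longrightarrow>
        distr M (MX \<Otimes>\<^sub>M borel) (\<lambda>\<omega>. (X_smp S i \<omega>, y_smp S i \<omega>)) =
        distr M (MX \<Otimes>\<^sub>M borel) (\<lambda>\<omega>. (X_pop S \<omega>, y_pop S \<omega>))"
  and estimator_AE: "AE \<omega> in M. \<forall>\<pi>. \<pi> permutes {1..n} \<longrightarrow>
        least_squares_min n S \<pi> \<omega> (Theta_hat n S \<pi> \<omega>)"
  using model unfolding trace_regression_model_def by blast+

definition linear_response :: "real mat \<Rightarrow> 'w \<Rightarrow> real" where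
  "linear_response \<Theta> \<omega> = hs_inner (X_pop S \<omega>) \<Theta>"

lemma X_pop_carrier: "\<omega> \<in> space M \<Longrightarrow> X_pop S \<omega> \<in> carrier_mat d1 d2"
  by (rule mat_borel_carrier[OF X_pop_measurable])

lemma linear_response_eq_vec: "\<Theta> \<in> carrier_mat d1 d2 \<Longrightarrow> \<omega> \<in> space M \<Longrightarrow> linear_response \<Theta> \<omega> = vectorize (X_pop S \<omega>) \<bullet> vectorize \<Theta>"
  unfolding linear_response_def by (rule hs_inner_vectorize[OF X_pop_carrier])

lemma hs_inner_measurable:
  assumes "\<Theta> \<in> carrier_mat d1 d2"
  shows "(\<lambda>A. hs_inner A \<Theta>) \<in> borel_measurable MX"
proof -
  have "(\<lambda>A. A $$ (a, b)) \<in> borel_measurable MX" if "a < d1" "b < d2" for a b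
    using mat_borel_entry_measurable[OF measurable_ident_sets[OF refl, of MX] that] .
  then have "(\<lambda>A. \<Sum>a<d1. \<Sum>b<d2. A $$ (a, b) * \<Theta> $$ (a, b)) \<in> borel_measurable MX"
    by (intro borel_measurable_sum borel_measurable_times borel_measurable_const) auto
  then show ?thesis
    by (rule measurable_cong[THEN iffD1, rotated]) (simp add: space_mat_borel hs_inner_eq_sum[OF _ assms])
qed

lemma linear_response_measurable: "\<Theta> \<in> carrier_mat d1 d2 \<Longrightarrow> linear_response \<Theta> \<in> borel_measurable M"
  unfolding linear_response_def[abs_def] by (rule measurable_compose[OF X_pop_measurable hs_inner_measurable])

lemma frobenius_norm_vec: "\<Theta> \<in> carrier_mat d1 d2 \<Longrightarrow> (frobenius_norm \<Theta>)\<^sup>2 = vectorize \<Theta> \<bullet> vectorize \<Theta>"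
proof -
  assume T: "\<Theta> \<in> carrier_mat d1 d2"
  have "vectorize \<Theta> \<bullet> vectorize \<Theta> \<ge> 0"
    unfolding scalar_prod_eq_sum[OF vectorize_carrier[OF T]] by (intro sum_nonneg) simp
  then show ?thesis by (simp add: frobenius_norm_def hs_inner_vectorize[OF T T])
qed

lemma linear_response_exp_square:
  assumes T: "\<Theta> \<in> carrier_mat d1 d2" and B: "frobenius_norm \<Theta> \<le> B"
  shows "(\<integral>\<^sup>+\<omega>. ennreal (exp ((linear_response \<Theta> \<omega>)\<^sup>2 / ((\<bar>K\<^sub>x\<bar> + 1)\<^sup>2 * (\<bar>B\<bar> + 1)\<^sup>2))) \<partial>M) \<le> 2"
proof -
  have "frobenius_norm \<Theta> \<ge> 0"
    unfolding frobenius_norm_def hs_inner_vectorize[OF T T] scalar_prod_eq_sum[OF vectorize_carrier[OF T]]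
    by (simp add: sum_nonneg)
  then have "(frobenius_norm \<Theta>)\<^sup>2 \<le> (\<bar>B\<bar> + 1)\<^sup>2" using B by (intro power_mono) auto
  then have "vectorize \<Theta> \<bullet> vectorize \<Theta> \<le> (\<bar>B\<bar> + 1)\<^sup>2" unfolding frobenius_norm_vec[OF T] .
  from subgaussian_vec_exp_square[OF X_pop_subgaussian vectorize_carrier[OF T] this]
  have "(\<integral>\<^sup>+\<omega>. ennreal (exp ((vectorize (X_pop S \<omega>) \<bullet> vectorize \<Theta>)\<^sup>2 / ((\<bar>K\<^sub>x\<bar> + 1)\<^sup>2 * (\<bar>B\<bar> + 1)\<^sup>2))) \<partial>M) \<le> 2"
    by simp
  then show ?thesis by (simp add: linear_response_eq_vec[OF T] cong: nn_integral_cong)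
qed

lemma coordinate_sq_int:
  assumes k: "k < d1 * d2"
  shows "sq_int M (\<lambda>\<omega>. vectorize (X_pop S \<omega>) $ k)"
proof (rule exp_square_moments(1))
  let ?m = "(\<bar>K\<^sub>x\<bar> + 1)\<^sup>2 * 1\<^sup>2 :: real"
  show "(\<lambda>\<omega>. vectorize (X_pop S \<omega>) $ k) \<in> borel_measurable M"
    by (rule measurable_cong[THEN iffD1, OF _ mat_borel_entry_measurable[OF X_pop_measurable vectorize_index(2,3)[OF Theta_star_carrier k]]])
      (simp add: vectorize_index(1)[OF X_pop_carrier k])
  show "?m > 0" by (simp add: add_nonneg_pos)
  have u: "vectorize (X_pop S \<omega>) \<bullet> unit_vec (d1 * d2) k = vectorize (X_pop S \<omega>) $ k" if "\<omega> \<in> space M" for \<omega>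
    using k vectorize_carrier[OF X_pop_carrier[OF that]] by simp
  have "unit_vec (d1 * d2) k \<bullet> unit_vec (d1 * d2) k \<le> (1::real)\<^sup>2"
    using k by simp
  from subgaussian_vec_exp_square[OF X_pop_subgaussian unit_vec_carrier this]
  show "(\<integral>\<^sup>+\<omega>. ennreal (exp ((vectorize (X_pop S \<omega>) $ k)\<^sup>2 / ?m)) \<partial>M) \<le> 2"
    by (simp add: u cong: nn_integral_cong)
qed

lemma linear_response_mean:
  assumes T: "\<Theta> \<in> carrier_mat d1 d2"
  shows "expectation (linear_response \<Theta>) = 0"
proof -
  have int: "integrable M (\<lambda>\<omega>. vectorize (X_pop S \<omega>) $ k)" if "k < d1 * d2" for k
    by (rule sq_int_integrable[OF finite_measure_axioms coordinate_sq_int[OF that]])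
  have zero: "expectation (\<lambda>\<omega>. vectorize (X_pop S \<omega>) $ k) = 0" if "k < d1 * d2" for k
    using arg_cong[OF X_pop_mean, of "\<lambda>v. v $ k"] that by (simp add: mean_vec_def)
  have "expectation (linear_response \<Theta>) = expectation (\<lambda>\<omega>. \<Sum>k<d1 * d2. vectorize (X_pop S \<omega>) $ k * vectorize \<Theta> $ k)"
    by (intro Bochner_Integration.integral_cong refl)
      (simp add: linear_response_eq_vec[OF T] scalar_prod_eq_sum[OF vectorize_carrier[OF T]])
  also have "\<dots> = (\<Sum>k<d1 * d2. expectation (\<lambda>\<omega>. vectorize (X_pop S \<omega>) $ k) * vectorize \<Theta> $ k)"
    using int by (subst Bochner_Integration.integral_sum) auto
  also have "\<dots> = 0" using zero by simp
  finally show ?thesis .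
qed

lemma signal_eq:
  assumes T: "Theta_tilde S \<in> carrier_mat d1 d2"
  shows "signal S = expectation (\<lambda>\<omega>. (linear_response (Theta_tilde S) \<omega>)\<^sup>2)"
proof -
  have "signal S = expectation (\<lambda>\<omega>. (vectorize (X_pop S \<omega>) \<bullet> vectorize (Theta_tilde S))\<^sup>2)"
    unfolding signal_def Sigma_eq
    by (rule covariance_quadratic_form[OF coordinate_sq_int X_pop_mean vectorize_carrier[OF T]])
  also have "\<dots> = expectation (\<lambda>\<omega>. (linear_response (Theta_tilde S) \<omega>)\<^sup>2)"
    by (intro Bochner_Integration.integral_cong refl) (simp add: linear_response_eq_vec[OF T])
  finally show ?thesis .
qed

lemma indep_response_eps:
  assumes T: "\<Theta> \<in> carrier_mat d1 d2"
  shows "indep_var borel (linear_response \<Theta>) borel (eps_pop S)"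
  unfolding indep_var_eq
proof (intro conjI linear_response_measurable[OF T] eps_measurable)
  let ?VX = "vimage_algebra (space M) (X_pop S) MX" and ?VE = "vimage_algebra (space M) (eps_pop S) borel"
  have X: "X_pop S \<in> space M \<rightarrow> space MX" using measurable_space[OF X_pop_measurable] by auto
  have "sigma_sets (space ?VX) {linear_response \<Theta> -` A \<inter> space M |A. A \<in> sets borel} \<subseteq> sets ?VX"
  proof (rule sets.sigma_sets_subset, clarify)
    fix A :: "real set" assume A: "A \<in> sets borel"
    have eq: "linear_response \<Theta> -` A \<inter> space M = X_pop S -` ((\<lambda>A. hs_inner A \<Theta>) -` A \<inter> space MX) \<inter> space M"
      using X by (auto simp: linear_response_def)
    show "linear_response \<Theta> -` A \<inter> space M \<in> sets ?VX"
      unfolding eq by (rule in_vimage_algebra[OF measurable_sets[OF hs_inner_measurable[OF T] A]])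
  qed
  then have 1: "sigma_sets (space M) {linear_response \<Theta> -` A \<inter> space M |A. A \<in> sets borel} \<subseteq> sets ?VX" by simp
  have "sigma_sets (space ?VE) {eps_pop S -` A \<inter> space M |A. A \<in> sets borel} \<subseteq> sets ?VE"
    by (rule sets.sigma_sets_subset) (auto intro: in_vimage_algebra)
  then have 2: "sigma_sets (space M) {eps_pop S -` A \<inter> space M |A. A \<in> sets borel} \<subseteq> sets ?VE" by simp
  show "indep_set (sigma_sets (space M) {linear_response \<Theta> -` A \<inter> space M |A. A \<in> sets borel})
      (sigma_sets (space M) {eps_pop S -` A \<inter> space M |A. A \<in> sets borel})"
    using X_eps_indep unfolding indep_set_def
    by (rule indep_sets_mono_sets) (use 1 2 in \<open>auto split: bool.split\<close>)
qed

lemma eps_exp_square: "(\<integral>\<^sup>+\<omega>. ennreal (exp ((eps_pop S \<omega>)\<^sup>2 / (\<bar>K\<^sub>\<epsilon>\<bar> + 1)\<^sup>2)) \<partial>M) \<le> 2"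
proof (rule psi2_norm_less_exp_square)
  have "psi2_norm M (eps_pop S) \<le> ereal K\<^sub>\<epsilon>" using eps_subgaussian by (simp add: subgaussian_def)
  also have "\<dots> < ereal (\<bar>K\<^sub>\<epsilon>\<bar> + 1)" by simp
  finally show "psi2_norm M (eps_pop S) < ereal (\<bar>K\<^sub>\<epsilon>\<bar> + 1)" .
qed simp

lemma eps_sq_int: "sq_int M (eps_pop S)"
  by (rule exp_square_moments(1)[OF eps_measurable _ eps_exp_square]) (simp add: add_nonneg_pos)

lemma y_pop_eq: "y_pop S \<omega> = linear_response (Theta_star S) \<omega> + eps_pop S \<omega>"
  by (simp add: y_pop_def linear_response_def)

lemma y_pop_measurable: "y_pop S \<in> borel_measurable M"
  unfolding y_pop_eq[abs_def] using linear_response_measurable[OF Theta_star_carrier] eps_measurable by measurable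

text \<open>
  Signal part and noise both satisfy the bound with the sum of their two parameters; the factor 2 comes
  from adding two independent terms with a common parameter.
\<close>
lemma y_pop_mgf:
  assumes B: "frobenius_norm (Theta_star S) \<le> B"
  shows "subgaussian_mgf M (2 * ((\<bar>K\<^sub>x\<bar> + 1)\<^sup>2 * (\<bar>B\<bar> + 1)\<^sup>2 + (\<bar>K\<^sub>\<epsilon>\<bar> + 1)\<^sup>2)) (y_pop S)"
proof -
  let ?a = "linear_response (Theta_star S)"
  let ?m = "(\<bar>K\<^sub>x\<bar> + 1)\<^sup>2 * (\<bar>B\<bar> + 1)\<^sup>2" and ?k = "(\<bar>K\<^sub>\<epsilon>\<bar> + 1)\<^sup>2"
  have m: "?m > 0" "?k > 0" by (simp_all add: add_nonneg_pos)
  note aM = linear_response_measurable[OF Theta_star_carrier] and a2 = linear_response_exp_square[OF Theta_star_carrier B]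
  have a: "subgaussian_mgf M ?m ?a"
    by (rule subgaussian_mgf_of_exp_square[OF aM m(1) a2 sq_int_integrable[OF finite_measure_axioms exp_square_moments(1)[OF aM m(1) a2]]
        linear_response_mean[OF Theta_star_carrier]])
  have e: "subgaussian_mgf M ?k (eps_pop S)"
    by (rule subgaussian_mgf_of_exp_square[OF eps_measurable m(2) eps_exp_square sq_int_integrable[OF finite_measure_axioms eps_sq_int] eps_mean])
  have "case_bool borel borel = (\<lambda>_. borel :: real measure)"
    by (rule ext) (simp split: bool.split)
  then have ind: "indep_vars (\<lambda>_. borel) (case_bool ?a (eps_pop S)) UNIV"
    using indep_response_eps[OF Theta_star_carrier] unfolding indep_var_def by simp
  have "subgaussian_mgf M (?m + ?k) (case_bool ?a (eps_pop S) b)" for b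
    using subgaussian_mgf_mono[OF a, of "?m + ?k"] subgaussian_mgf_mono[OF e, of "?m + ?k"] m by (cases b) auto
  from subgaussian_mgf_sum[OF finite_class.finite_UNIV ind this, of "\<lambda>_. 1"]
  show ?thesis by (simp add: UNIV_bool y_pop_eq[abs_def] mult.commute add.commute)
qed

lemma pop_measurable: "(\<lambda>\<omega>. (X_pop S \<omega>, y_pop S \<omega>)) \<in> measurable M (MX \<Otimes>\<^sub>M borel)"
  using X_pop_measurable y_pop_measurable by measurable

lemma smp_measurable: "i \<in> {1..n} \<Longrightarrow> (\<lambda>\<omega>. (X_smp S i \<omega>, y_smp S i \<omega>)) \<in> measurable M (MX \<Otimes>\<^sub>M borel)"
  using sample_indep by (auto simp: indep_vars_def2)

lemma X_smp_measurable: "i \<in> {1..n} \<Longrightarrow> X_smp S i \<in> measurable M MX"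
  using measurable_compose[OF smp_measurable measurable_fst] by simp

lemma y_smp_measurable: "i \<in> {1..n} \<Longrightarrow> y_smp S i \<in> borel_measurable M"
  using measurable_compose[OF smp_measurable measurable_snd] by simp

lemma smp_nn_integral:
  assumes i: "i \<in> {1..n}" and F: "F \<in> borel_measurable (MX \<Otimes>\<^sub>M borel)"
  shows "(\<integral>\<^sup>+\<omega>. F (X_smp S i \<omega>, y_smp S i \<omega>) \<partial>M) = (\<integral>\<^sup>+\<omega>. F (X_pop S \<omega>, y_pop S \<omega>) \<partial>M)"
proof -
  have "(\<integral>\<^sup>+\<omega>. F (X_smp S i \<omega>, y_smp S i \<omega>) \<partial>M) =
      (\<integral>\<^sup>+p. F p \<partial>distr M (MX \<Otimes>\<^sub>M borel) (\<lambda>\<omega>. (X_smp S i \<omega>, y_smp S i \<omega>)))"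
    by (rule nn_integral_distr[symmetric, OF smp_measurable[OF i]]) (use F in simp)
  also have "\<dots> = (\<integral>\<^sup>+\<omega>. F (X_pop S \<omega>, y_pop S \<omega>) \<partial>M)"
    unfolding sample_law[OF i] by (rule nn_integral_distr[OF pop_measurable]) (use F in simp)
  finally show ?thesis .
qed

lemma smp_integral:
  fixes F :: "real mat \<times> real \<Rightarrow> real"
  assumes i: "i \<in> {1..n}" and F: "F \<in> borel_measurable (MX \<Otimes>\<^sub>M borel)"
  shows "expectation (\<lambda>\<omega>. F (X_smp S i \<omega>, y_smp S i \<omega>)) = expectation (\<lambda>\<omega>. F (X_pop S \<omega>, y_pop S \<omega>))"
    and "integrable M (\<lambda>\<omega>. F (X_smp S i \<omega>, y_smp S i \<omega>)) \<longleftrightarrow> integrable M (\<lambda>\<omega>. F (X_pop S \<omega>, y_pop S \<omega>))"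
  using integral_distr[OF smp_measurable[OF i] F] integral_distr[OF pop_measurable F]
    integrable_distr_eq[OF smp_measurable[OF i] F] integrable_distr_eq[OF pop_measurable F]
  unfolding sample_law[OF i] by auto

lemma y_smp_mgf:
  assumes i: "i \<in> {1..n}" and mgf: "subgaussian_mgf M V (y_pop S)"
  shows "subgaussian_mgf M V (y_smp S i)"
  unfolding subgaussian_mgf_def
proof (intro conjI allI)
  show "y_smp S i \<in> borel_measurable M" by (rule y_smp_measurable[OF i])
  fix l :: real
  have "(\<integral>\<^sup>+\<omega>. ennreal (exp (l * y_smp S i \<omega>)) \<partial>M) = (\<integral>\<^sup>+\<omega>. ennreal (exp (l * y_pop S \<omega>)) \<partial>M)"
    using smp_nn_integral[OF i, of "\<lambda>p. ennreal (exp (l * snd p))"] by simp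
  then show "(\<integral>\<^sup>+\<omega>. ennreal (exp (l * y_smp S i \<omega>)) \<partial>M) \<le> ennreal (exp (l\<^sup>2 * V))"
    using mgf by (simp add: subgaussian_mgf_def)
qed

text \<open>The almost sure value of \<open>\<Lambda>\<close>, without reference to the estimation rule.\<close>
definition gain :: "(nat \<Rightarrow> nat) \<Rightarrow> 'w \<Rightarrow> real" where
  "gain \<pi> \<omega> = fitted_gain d1 d2 (rk S) {1..n} (\<lambda>i. X_smp S i \<omega>) (\<lambda>i. y_smp S (\<pi> i) \<omega>)"

definition gain_p_value :: "'w \<Rightarrow> real" where
  "gain_p_value \<omega> = (\<Sum>\<pi> | \<pi> permutes {1..n}. of_bool (gain id \<omega> \<le> gain \<pi> \<omega>)) / fact n"

lemma card_perms: "card {\<pi>. \<pi> permutes {1..n}} = fact n"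
  by (rule card_permutations) auto

lemma finite_perms: "finite {\<pi>. \<pi> permutes {1..n}}"
  by (rule finite_permutations) simp

lemma Lambda_eq_gain: "AE \<omega> in M. \<forall>\<pi>. \<pi> permutes {1..n} \<longrightarrow> Lambda n S \<pi> \<omega> = gain \<pi> \<omega>"
  using estimator_AE AE_space
proof eventually_elim
  case (elim \<omega>)
  show ?case
  proof (intro allI impI)
    fix \<pi> assume "\<pi> permutes {1..n}"
    then have "least_squares_min n S \<pi> \<omega> (Theta_hat n S \<pi> \<omega>)" using elim by blast
    then show "Lambda n S \<pi> \<omega> = gain \<pi> \<omega>"
      unfolding least_squares_min_def Lambda_def gain_def
      by (rule least_squares_fitted_norm) (auto intro: mat_borel_carrier[OF X_smp_measurable elim(2)])
  qed
qed

lemma gain_measurable: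
  assumes "\<pi> permutes {1..n}"
  shows "gain \<pi> \<in> borel_measurable M"
  unfolding gain_def[abs_def]
  by (intro fitted_gain_measurable X_smp_measurable y_smp_measurable) (use permutes_in_image[OF assms] in auto)

lemma gain_p_value_measurable: "gain_p_value \<in> borel_measurable M"
proof -
  have "(\<lambda>\<omega>. of_bool (gain id \<omega> \<le> gain \<pi> \<omega>) :: real) \<in> borel_measurable M" if "\<pi> permutes {1..n}" for \<pi>
  proof -
    have [measurable]: "gain id \<in> borel_measurable M" "gain \<pi> \<in> borel_measurable M"
      by (auto intro: gain_measurable that permutes_id)
    show ?thesis unfolding of_bool_def by measurable
  qed
  then show ?thesis unfolding gain_p_value_def[abs_def] by (intro borel_measurable_divide borel_measurable_sum) auto
qed

text \<open>
  The p-value agrees almost surely with a measurable function, so its rejection event is measurable for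
  the completion and has the same probability.
\<close>
lemma reject_prob_eq: "reject_prob \<alpha> n S = prob {\<omega> \<in> space M. gain_p_value \<omega> \<le> \<alpha>}"
proof -
  let ?E = "{\<omega> \<in> space M. p_value n S \<omega> \<le> \<alpha>}" and ?E' = "{\<omega> \<in> space M. gain_p_value \<omega> \<le> \<alpha>}"
  have E': "?E' \<in> sets M" using gain_p_value_measurable by measurable
  have eq: "AE \<omega> in M. p_value n S \<omega> = gain_p_value \<omega>"
    using Lambda_eq_gain
  proof eventually_elim
    case (elim \<omega>)
    then have "(\<Sum>\<pi> | \<pi> permutes {1..n}. of_bool (Lambda n S id \<omega> \<le> Lambda n S \<pi> \<omega>)) =
        (\<Sum>\<pi> | \<pi> permutes {1..n}. of_bool (gain id \<omega> \<le> gain \<pi> \<omega>) :: real)"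
      by (intro sum.cong) (auto simp: permutes_id)
    then show ?case unfolding p_value_def gain_p_value_def card_perms by simp
  qed
  then obtain N where N: "{\<omega> \<in> space M. p_value n S \<omega> \<noteq> gain_p_value \<omega>} \<subseteq> N" "N \<in> null_sets M"
    by (auto elim!: AE_E simp: null_sets_def)
  have "?E = (?E' - N) \<union> (?E \<inter> N)" using N(1) by auto
  then have E: "?E \<in> sets (completion M)"
    by (rule sets_completionI[of _ _ _ N]) (use N E' in auto)
  have "measure (completion M) ?E = measure (completion M) ?E'"
  proof (rule measure_eq_AE)
    show "AE \<omega> in completion M. (\<omega> \<in> ?E) = (\<omega> \<in> ?E')"
      using AE_completion[OF eq] by eventually_elim auto
  qed (use E E' in auto)
  then show ?thesis unfolding reject_prob_def using E' by simp
qed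

text \<open>
  The p-value computed from responses permuted by \<open>\<sigma>\<close> has the same law for every \<open>\<sigma>\<close>, and it is the
  normalized rank of \<open>L \<sigma>\<close> among all \<open>L \<tau>\<close>, because \<open>\<tau> \<mapsto> \<sigma> \<circ> \<tau>\<close> is a bijection.  Averaging over
  \<open>\<sigma>\<close> therefore reduces the claim to \<open>card_low_ranks_le\<close>.
\<close>
lemma null_level:
  assumes null: "Theta_star S = 0\<^sub>m d1 d2" and n: "n \<ge> 1" and "\<alpha> \<ge> 0"
  shows "prob {\<omega> \<in> space M. gain_p_value \<omega> \<le> \<alpha>} \<le> \<alpha>"
proof -
  let ?I = "{1..n}"
  let ?P = "{\<pi>. \<pi> permutes ?I}"
  let ?PX = "PiM ?I (\<lambda>_. MX)" and ?PY = "PiM ?I (\<lambda>_. borel) :: (nat \<Rightarrow> real) measure"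
  have yeps: "y_pop S \<omega> = eps_pop S \<omega>" if "\<omega> \<in> space M" for \<omega>
  proof -
    have "hs_inner (X_pop S \<omega>) (0\<^sub>m d1 d2) = 0"
      by (subst hs_inner_eq_sum[OF X_pop_carrier[OF that], of "0\<^sub>m d1 d2"]) auto
    then show ?thesis by (simp add: y_pop_def null)
  qed
  have XY: "prob ((X_smp S i -` A \<inter> space M) \<inter> (y_smp S i -` B \<inter> space M)) =
      prob (X_smp S i -` A \<inter> space M) * prob (y_smp S i -` B \<inter> space M)"
    if i: "i \<in> ?I" and A: "A \<in> sets MX" and B: "B \<in> sets borel" for i A B
  proof -
    have tr: "prob ((X_smp S i -` A \<inter> space M) \<inter> (y_smp S i -` B \<inter> space M)) =
        prob ((X_pop S -` A \<inter> space M) \<inter> (eps_pop S -` B \<inter> space M))"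
      if A: "A \<in> sets MX" and B: "B \<in> sets borel" for A B
    proof -
      have AB: "A \<times> B \<in> sets (MX \<Otimes>\<^sub>M borel)" using A B by (rule pair_measureI)
      have "prob ((\<lambda>\<omega>. (X_smp S i \<omega>, y_smp S i \<omega>)) -` (A \<times> B) \<inter> space M) =
          prob ((\<lambda>\<omega>. (X_pop S \<omega>, y_pop S \<omega>)) -` (A \<times> B) \<inter> space M)"
        using measure_distr[OF smp_measurable[OF i] AB] measure_distr[OF pop_measurable AB]
        unfolding sample_law[OF i] by simp
      moreover have "(\<lambda>\<omega>. (X_smp S i \<omega>, y_smp S i \<omega>)) -` (A \<times> B) \<inter> space M =
          (X_smp S i -` A \<inter> space M) \<inter> (y_smp S i -` B \<inter> space M)" by auto
      moreover have "(\<lambda>\<omega>. (X_pop S \<omega>, y_pop S \<omega>)) -` (A \<times> B) \<inter> space M =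
          (X_pop S -` A \<inter> space M) \<inter> (eps_pop S -` B \<inter> space M)" using yeps by auto
      ultimately show ?thesis by simp
    qed
    have X: "X_pop S \<in> space M \<rightarrow> space MX" using measurable_space[OF X_pop_measurable] by auto
    have prod: "prob ((X_pop S -` A \<inter> space M) \<inter> (eps_pop S -` B \<inter> space M)) =
        prob (X_pop S -` A \<inter> space M) * prob (eps_pop S -` B \<inter> space M)"
      by (rule indep_setD[OF X_eps_indep]) (use A B in \<open>auto intro: in_vimage_algebra\<close>)
    have sX: "X_smp S i -` space MX \<inter> space M = space M" "X_pop S -` space MX \<inter> space M = space M"
      using measurable_space[OF X_smp_measurable[OF i]] X by auto
    have X1: "prob (X_smp S i -` A \<inter> space M) = prob (X_pop S -` A \<inter> space M)"
      using tr[OF A, of UNIV] by (simp add: Int_absorb2)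
    have Y1: "prob (y_smp S i -` B \<inter> space M) = prob (eps_pop S -` B \<inter> space M)"
      using tr[OF sets.top B] unfolding sX by (simp add: Int_absorb1)
    show ?thesis unfolding tr[OF A B] prod X1 Y1 ..
  qed
  have law: "distr M borel (y_smp S i) = distr M borel (y_pop S)" if i: "i \<in> ?I" for i
  proof -
    have "distr M borel (y_smp S i) = distr (distr M (MX \<Otimes>\<^sub>M borel) (\<lambda>\<omega>. (X_smp S i \<omega>, y_smp S i \<omega>))) borel snd"
      by (subst distr_distr[OF measurable_snd smp_measurable[OF i]]) (simp add: comp_def)
    also have "\<dots> = distr M borel (y_pop S)"
      unfolding sample_law[OF i] by (subst distr_distr[OF measurable_snd pop_measurable]) (simp add: comp_def)
    finally show ?thesis .
  qed
  define G where "G p \<pi> = fitted_gain d1 d2 (rk S) ?I (fst p) (\<lambda>i. snd p (\<pi> i))"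
    for p :: "(nat \<Rightarrow> real mat) \<times> (nat \<Rightarrow> real)" and \<pi>
  define \<Psi> :: "(nat \<Rightarrow> real mat) \<times> (nat \<Rightarrow> real) \<Rightarrow> real" where "\<Psi> p = (\<Sum>\<tau>\<in>?P. of_bool (G p id \<le> G p \<tau>)) / fact n" for p
  define D where "D \<sigma> \<omega> = (\<lambda>i\<in>?I. X_smp S i \<omega>, \<lambda>i\<in>?I. y_smp S (\<sigma> i) \<omega>)" for \<sigma> :: "nat \<Rightarrow> nat" and \<omega>
  have Gm: "(\<lambda>p. G p \<pi>) \<in> borel_measurable (?PX \<Otimes>\<^sub>M ?PY)" if "\<pi> permutes ?I" for \<pi>
    unfolding G_def
    by (intro fitted_gain_measurable measurable_compose[OF measurable_fst measurable_component_singleton[of _ ?I "\<lambda>_. MX"]]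
        measurable_compose[OF measurable_snd measurable_component_singleton[of _ ?I "\<lambda>_. borel"]])
      (use permutes_in_image[OF that] in auto)
  have \<Psi>m: "\<Psi> \<in> borel_measurable (?PX \<Otimes>\<^sub>M ?PY)"
  proof -
    have "(\<lambda>p. of_bool (G p id \<le> G p \<tau>) :: real) \<in> borel_measurable (?PX \<Otimes>\<^sub>M ?PY)" if "\<tau> permutes ?I" for \<tau>
    proof -
      note [measurable] = Gm[OF permutes_id] Gm[OF that]
      show ?thesis unfolding of_bool_def by measurable
    qed
    then show ?thesis unfolding \<Psi>_def[abs_def] by (intro borel_measurable_divide borel_measurable_sum) auto
  qed
  have Dm: "D \<sigma> \<in> measurable M (?PX \<Otimes>\<^sub>M ?PY)" if "\<sigma> permutes ?I" for \<sigma>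
    unfolding D_def
    by (intro measurable_Pair measurable_restrict X_smp_measurable y_smp_measurable)
      (use permutes_in_image[OF that] in auto)
  have GD: "G (D \<sigma> \<omega>) \<tau> = gain (\<sigma> \<circ> \<tau>) \<omega>" if "\<tau> permutes ?I" for \<sigma> \<tau> \<omega>
    unfolding G_def D_def gain_def fst_conv snd_conv
    by (rule fitted_gain_cong) (use permutes_in_image[OF that] in auto)
  have \<Psi>D: "\<Psi> (D \<sigma> \<omega>) = real (card {\<tau> \<in> ?P. gain \<sigma> \<omega> \<le> gain \<tau> \<omega>}) / fact n" if \<sigma>: "\<sigma> permutes ?I" for \<sigma> \<omega>
  proof -
    have "(\<Sum>\<tau>\<in>?P. of_bool (G (D \<sigma> \<omega>) id \<le> G (D \<sigma> \<omega>) \<tau>) :: real) =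
        (\<Sum>\<tau>\<in>?P. of_bool (gain \<sigma> \<omega> \<le> gain (\<sigma> \<circ> \<tau>) \<omega>))"
      by (intro sum.cong refl) (simp add: GD permutes_id)
    also have "\<dots> = (\<Sum>\<tau>\<in>?P. of_bool (gain \<sigma> \<omega> \<le> gain \<tau> \<omega>))"
      by (rule setum_permutations_compose_left[OF \<sigma>, symmetric])
    also have "\<dots> = real (card {\<tau> \<in> ?P. gain \<sigma> \<omega> \<le> gain \<tau> \<omega>})"
      using finite_perms by (simp add: of_bool_def sum.If_cases Int_def)
    finally show ?thesis by (simp add: \<Psi>_def)
  qed
  define E where "E \<sigma> = {\<omega> \<in> space M. \<Psi> (D \<sigma> \<omega>) \<le> \<alpha>}" for \<sigma>
  have A: "{p \<in> space (?PX \<Otimes>\<^sub>M ?PY). \<Psi> p \<le> \<alpha>} \<in> sets (?PX \<Otimes>\<^sub>M ?PY)"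
    using \<Psi>m by measurable
  have E_eq: "E \<sigma> = D \<sigma> -` {p \<in> space (?PX \<Otimes>\<^sub>M ?PY). \<Psi> p \<le> \<alpha>} \<inter> space M" if "\<sigma> permutes ?I" for \<sigma>
    using measurable_space[OF Dm[OF that]] by (auto simp: E_def)
  have Em: "E \<sigma> \<in> sets M" if "\<sigma> permutes ?I" for \<sigma>
    unfolding E_eq[OF that] by (rule measurable_sets[OF Dm[OF that] A])
  have same: "prob (E \<sigma>) = prob (E id)" if \<sigma>: "\<sigma> permutes ?I" for \<sigma>
  proof -
    have "distr M (?PX \<Otimes>\<^sub>M ?PY) (D \<sigma>) = distr M (?PX \<Otimes>\<^sub>M ?PY) (D id)"
      unfolding D_def id_apply
    proof (rule permuted_response_same_law[OF _ _ sample_indep _ _ \<sigma>])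
      show "{1..n} \<noteq> {}" using n by simp
    qed (rule finite_atLeastAtMost, erule (2) XY, erule law)
    then show ?thesis
      using measure_distr[OF Dm[OF \<sigma>] A] measure_distr[OF Dm[OF permutes_id] A]
      unfolding E_eq[OF \<sigma>] E_eq[OF permutes_id] by simp
  qed
  have count: "(\<Sum>\<sigma>\<in>?P. indicator (E \<sigma>) \<omega>) \<le> \<alpha> * fact n" for \<omega>
  proof (cases "\<omega> \<in> space M")
    case True
    have "(\<Sum>\<sigma>\<in>?P. indicator (E \<sigma>) \<omega> :: real) =
        (\<Sum>\<sigma>\<in>?P. of_bool (real (card {\<tau> \<in> ?P. gain \<sigma> \<omega> \<le> gain \<tau> \<omega>}) \<le> \<alpha> * fact n))"
      using True by (intro sum.cong refl) (auto simp: E_def \<Psi>D indicator_def divide_le_eq of_bool_def)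
    also have "\<dots> = real (card {\<sigma> \<in> ?P. real (card {\<tau> \<in> ?P. gain \<sigma> \<omega> \<le> gain \<tau> \<omega>}) \<le> \<alpha> * fact n})"
      using finite_perms by (simp add: of_bool_def sum.If_cases Int_def)
    also have "\<dots> \<le> \<alpha> * fact n"
      using card_low_ranks_le[OF finite_perms, of "\<alpha> * fact n" "\<lambda>\<sigma>. gain \<sigma> \<omega>"] \<open>\<alpha> \<ge> 0\<close> by simp
    finally show ?thesis .
  next
    case False
    then have "(\<Sum>\<sigma>\<in>?P. indicator (E \<sigma>) \<omega> :: real) = 0" by (intro sum.neutral) (auto simp: E_def)
    then show ?thesis using \<open>\<alpha> \<ge> 0\<close> by simp
  qed
  have int_E: "integrable M (indicat_real (E \<sigma>))" if "\<sigma> \<in> ?P" for \<sigma>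
    by (rule integrable_real_indicator) (use Em that in \<open>simp_all add: less_top[symmetric]\<close>)
  have "fact n * prob (E id) = (\<Sum>\<sigma>\<in>?P. prob (E id))"
    by (simp only: sum_constant card_perms of_nat_fact)
  also have "\<dots> = (\<Sum>\<sigma>\<in>?P. expectation (indicat_real (E \<sigma>)))"
  proof (rule sum.cong[OF refl])
    fix \<sigma> assume "\<sigma> \<in> ?P"
    then have \<sigma>: "\<sigma> permutes ?I" by blast
    have "E \<sigma> \<inter> space M = E \<sigma>" by (auto simp: E_def)
    then show "prob (E id) = expectation (indicat_real (E \<sigma>))" using same[OF \<sigma>] by simp
  qed
  also have "\<dots> = expectation (\<lambda>\<omega>. \<Sum>\<sigma>\<in>?P. indicator (E \<sigma>) \<omega>)"
    by (rule Bochner_Integration.integral_sum[OF int_E, symmetric])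
  also have "\<dots> \<le> expectation (\<lambda>_. \<alpha> * fact n)"
    by (rule integral_mono[OF Bochner_Integration.integrable_sum[OF int_E] integrable_const count])
  also have "\<dots> = fact n * \<alpha>" by (simp add: prob_space)
  finally have "prob (E id) \<le> \<alpha>" by simp
  moreover have "E id = {\<omega> \<in> space M. gain_p_value \<omega> \<le> \<alpha>}"
  proof -
    have "\<Psi> (D id \<omega>) = gain_p_value \<omega>" for \<omega>
      unfolding \<Psi>_def gain_p_value_def
      by (intro arg_cong[where f = "\<lambda>x. x / fact n"] sum.cong refl) (simp add: GD permutes_id)
    then show ?thesis by (simp add: E_def)
  qed
  ultimately show ?thesis by simp
qed

text \<open>
  Multiples of \<open>\<Theta>~\<close> are admissible competitors, so the approximation error is uncorrelated with
  \<open>\<langle>X, \<Theta>~\<rangle>\<close>.  Hence the covariance of the response with \<open>\<langle>X, \<Theta>~\<rangle>\<close> equals the signal, also when the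
  rank is misspecified.
\<close>
lemma best_rank_orthogonality:
  assumes best: "best_rank_approx S" and T: "sq_int M (linear_response (Theta_tilde S))" and Ts: "sq_int M (linear_response (Theta_star S))"
  shows "Theta_tilde S \<in> low_rank_mats d1 d2 (rk S)" "Theta_tilde S \<in> carrier_mat d1 d2"
    "expectation (\<lambda>\<omega>. y_pop S \<omega> * linear_response (Theta_tilde S) \<omega>) = signal S"
    "integrable M (\<lambda>\<omega>. y_pop S \<omega> * linear_response (Theta_tilde S) \<omega>)"
proof -
  let ?a = "linear_response (Theta_tilde S)" and ?b = "linear_response (Theta_star S)"
  show low: "Theta_tilde S \<in> low_rank_mats d1 d2 (rk S)"
    using best by (simp add: best_rank_approx_def is_arg_min_linorder)
  then show carr: "Theta_tilde S \<in> carrier_mat d1 d2" by (simp add: low_rank_mats_def)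
  have min: "expectation (\<lambda>\<omega>. (hs_inner (X_pop S \<omega>) (Theta_star S - Theta_tilde S))\<^sup>2) \<le>
      expectation (\<lambda>\<omega>. (hs_inner (X_pop S \<omega>) (Theta_star S - \<Theta>))\<^sup>2)" if "\<Theta> \<in> low_rank_mats d1 d2 (rk S)" for \<Theta>
    using best that by (auto simp: best_rank_approx_def is_arg_min_linorder)
  have diff: "hs_inner (X_pop S \<omega>) (Theta_star S - t \<cdot>\<^sub>m Theta_tilde S) = ?b \<omega> - t * ?a \<omega>" if "\<omega> \<in> space M" for \<omega> t
  proof -
    have c: "Theta_star S - t \<cdot>\<^sub>m Theta_tilde S \<in> carrier_mat d1 d2"
      by (intro minus_carrier_mat smult_carrier_mat carr)
    show ?thesis
      unfolding linear_response_def hs_inner_eq_sum[OF X_pop_carrier[OF that] c] hs_inner_eq_sum[OF X_pop_carrier[OF that] carr]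
        hs_inner_eq_sum[OF X_pop_carrier[OF that] Theta_star_carrier]
      using carr Theta_star_carrier
      by (simp add: algebra_simps sum_subtractf sum_distrib_left)
  qed
  have ab: "integrable M (\<lambda>\<omega>. ?b \<omega> * ?a \<omega>)" by (rule sq_int_mult_integrable[OF Ts T])
  have i: "integrable M (\<lambda>\<omega>. (?a \<omega>)\<^sup>2)" "integrable M (\<lambda>\<omega>. (?b \<omega>)\<^sup>2)" using T Ts by (auto simp: sq_int_def)
  define C where "C = expectation (\<lambda>\<omega>. ?b \<omega> * ?a \<omega>)"
  define s where "s = expectation (\<lambda>\<omega>. (?a \<omega>)\<^sup>2)"
  have val: "expectation (\<lambda>\<omega>. (hs_inner (X_pop S \<omega>) (Theta_star S - t \<cdot>\<^sub>m Theta_tilde S))\<^sup>2) =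
      expectation (\<lambda>\<omega>. (?b \<omega>)\<^sup>2) - 2 * t * C + t\<^sup>2 * s" for t
  proof -
    have "expectation (\<lambda>\<omega>. (hs_inner (X_pop S \<omega>) (Theta_star S - t \<cdot>\<^sub>m Theta_tilde S))\<^sup>2) =
        expectation (\<lambda>\<omega>. (?b \<omega>)\<^sup>2 - 2 * t * (?b \<omega> * ?a \<omega>) + t\<^sup>2 * (?a \<omega>)\<^sup>2)"
      by (intro Bochner_Integration.integral_cong refl) (simp add: diff power2_diff power_mult_distrib mult_ac)
    also have "\<dots> = expectation (\<lambda>\<omega>. (?b \<omega>)\<^sup>2) - 2 * t * C + t\<^sup>2 * s"
      using i ab by (simp add: C_def s_def)
    finally show ?thesis .
  qed
  have "C = s"
  proof (rule quadratic_max_at_one)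
    show "s \<ge> 0" by (simp add: s_def)
    fix t
    have one: "1 \<cdot>\<^sub>m Theta_tilde S = Theta_tilde S" by (intro eq_matI) auto
    show "2 * t * C - t\<^sup>2 * s \<le> 2 * C - s"
      using min[OF low_rank_mats_scale[OF low, of t]] val[of t] val[of 1] unfolding one by simp
  qed
  have sig: "signal S = s" unfolding s_def by (rule signal_eq[OF carr])
  note ai = sq_int_integrable[OF finite_measure_axioms T] and ei = sq_int_integrable[OF finite_measure_axioms eps_sq_int]
  have ea: "integrable M (\<lambda>\<omega>. ?a \<omega> * eps_pop S \<omega>)" "expectation (\<lambda>\<omega>. ?a \<omega> * eps_pop S \<omega>) = 0"
    using indep_var_integrable[OF indep_response_eps[OF carr] ai ei]
      indep_var_lebesgue_integral[OF indep_response_eps[OF carr] ai ei] eps_mean by auto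
  have eq: "y_pop S \<omega> * ?a \<omega> = ?b \<omega> * ?a \<omega> + ?a \<omega> * eps_pop S \<omega>" for \<omega>
    by (simp add: y_pop_eq algebra_simps)
  show "integrable M (\<lambda>\<omega>. y_pop S \<omega> * ?a \<omega>)" unfolding eq using ab ea by simp
  show "expectation (\<lambda>\<omega>. y_pop S \<omega> * ?a \<omega>) = signal S"
    unfolding eq using ab ea \<open>C = s\<close> sig by (simp add: C_def)
qed

text \<open>
  If \<open>L id \<le> L \<pi>\<close>, then \<open>L id \<le> n * s / 2\<close>, which Chebyshev's inequality makes unlikely, or
  \<open>L \<pi> \<ge> n * s / 2\<close>, which Markov's inequality makes unlikely; averaging over \<open>\<pi>\<close> replaces the number of
  fixed points by one.  The scale \<open>m\<close> of the fitted signal \<open>a\<close> is left open: it is a constant in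
  general, and proportional to the signal under the moment equivalence.
\<close>
lemma rejection_lower_bound:
  fixes B m \<alpha> :: real
  defines "V \<equiv> 2 * ((\<bar>K\<^sub>x\<bar> + 1)\<^sup>2 * (\<bar>B\<bar> + 1)\<^sup>2 + (\<bar>K\<^sub>\<epsilon>\<bar> + 1)\<^sup>2)"
  assumes best: "best_rank_approx S" and B: "frobenius_norm (Theta_star S) \<le> B" and "m > 0"
    and psi: "(\<integral>\<^sup>+\<omega>. ennreal (exp ((linear_response (Theta_tilde S) \<omega>)\<^sup>2 / m)) \<partial>M) \<le> 2"
    and s: "signal S > 0" and n: "n \<ge> 1" and \<alpha>: "\<alpha> > 0"
  shows "1 - (4 * (m * (9216 * V\<^sup>2 + 16 + 8 * m)) / (real n * (signal S)\<^sup>2) +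
      2 * (2304 * V * real (rk S * d2) + 24 * V) / (real n * signal S)) / \<alpha> \<le> prob {\<omega> \<in> space M. gain_p_value \<omega> \<le> \<alpha>}"
proof -
  let ?a = "linear_response (Theta_tilde S)" and ?y = "y_pop S"
  let ?P = "{\<pi>. \<pi> permutes {1..n}}"
  let ?ns = "real n * signal S"
  define v where "v = m * (9216 * V\<^sup>2 + 16 + 8 * m)"
  define q1 where "q1 = 4 * v / (real n * (signal S)\<^sup>2)"
  have V: "V > 0" unfolding V_def by (simp add: add_nonneg_pos add_pos_pos)
  have ns: "?ns > 0" using n s by simp
  have mgf: "subgaussian_mgf M V ?y" unfolding V_def by (rule y_pop_mgf[OF B])
  have tilde: "Theta_tilde S \<in> carrier_mat d1 d2"
    using best by (auto simp: best_rank_approx_def is_arg_min_linorder low_rank_mats_def)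
  have am: "?a \<in> borel_measurable M" by (rule linear_response_measurable[OF tilde])
  note a = exp_square_moments[OF am \<open>m > 0\<close> psi]
  have bsq: "sq_int M (linear_response (Theta_star S))"
    by (rule exp_square_moments(1)[OF linear_response_measurable[OF Theta_star_carrier] _ linear_response_exp_square[OF Theta_star_carrier B]])
      (simp add: add_nonneg_pos)
  note orth = best_rank_orthogonality[OF best a(1) bsq]
  have y4: "integrable M (\<lambda>\<omega>. (?y \<omega>) ^ 4)" "expectation (\<lambda>\<omega>. (?y \<omega>) ^ 4) \<le> 2304 * V\<^sup>2"
    using subgaussian_mgf_moment[OF mgf V, of 2] by (auto simp: power2_eq_square)
  define F where "F p = 2 * snd p * hs_inner (fst p) (Theta_tilde S) - (hs_inner (fst p) (Theta_tilde S))\<^sup>2" for p :: "real mat \<times> real"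
  have Fm: "F \<in> borel_measurable (MX \<Otimes>\<^sub>M borel)"
    unfolding F_def[abs_def]
    by (intro borel_measurable_diff borel_measurable_times borel_measurable_power borel_measurable_const
        measurable_snd measurable_compose[OF measurable_fst hs_inner_measurable[OF tilde]])
  have Fpop: "F (X_pop S \<omega>, ?y \<omega>) = 2 * (?y \<omega> * ?a \<omega>) - (?a \<omega>)\<^sup>2" for \<omega>
    by (simp add: F_def linear_response_def)
  have Fmean: "expectation (\<lambda>\<omega>. F (X_pop S \<omega>, ?y \<omega>)) = signal S"
    unfolding Fpop using orth a(1) signal_eq[OF tilde] by (simp add: sq_int_def)
  \<comment> \<open>Weighted arithmetic-geometric mean: \<open>2 * y\<^sup>2 * a\<^sup>2 \<le> m * y\<^sup>4 + a\<^sup>4 / m\<close>, of order \<open>m\<close> in expectation.\<close>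
  have Fle: "(F (X_pop S \<omega>, ?y \<omega>))\<^sup>2 \<le> 4 * m * (?y \<omega>) ^ 4 + (4 / m + 2) * (?a \<omega>) ^ 4" for \<omega>
  proof -
    define p where "p = ?y \<omega> * ?a \<omega>"
    define q where "q = (?a \<omega>)\<^sup>2"
    have 1: "(2 * p - q)\<^sup>2 \<le> 8 * p\<^sup>2 + 2 * q\<^sup>2"
    proof -
      have "0 \<le> (2 * p + q)\<^sup>2" by simp
      then show ?thesis by (simp add: power2_sum power2_diff power_mult_distrib)
    qed
    have 2: "8 * p\<^sup>2 \<le> 4 * m * (?y \<omega>) ^ 4 + 4 / m * (?a \<omega>) ^ 4"
    proof -
      define c where "c = sqrt m"
      have c: "c > 0" "c\<^sup>2 = m" using \<open>m > 0\<close> by (auto simp: c_def)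
      have "0 \<le> (c * (?y \<omega>)\<^sup>2 - (?a \<omega>)\<^sup>2 / c)\<^sup>2" by simp
      also have "\<dots> = m * (?y \<omega>) ^ 4 + (?a \<omega>) ^ 4 / m - 2 * p\<^sup>2"
        using c by (simp add: power2_diff power_mult_distrib power_divide p_def power_mult[symmetric])
      finally show ?thesis by (simp add: algebra_simps)
    qed
    have q2: "q\<^sup>2 = (?a \<omega>) ^ 4" by (simp add: q_def)
    show ?thesis using 1 2 unfolding Fpop p_def[symmetric] q_def[symmetric] q2 by (simp add: algebra_simps)
  qed
  have Fpm: "(\<lambda>\<omega>. F (X_pop S \<omega>, ?y \<omega>)) \<in> borel_measurable M" by (rule measurable_compose[OF pop_measurable Fm])
  have iF: "integrable M (\<lambda>\<omega>. (F (X_pop S \<omega>, ?y \<omega>))\<^sup>2)"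
    by (rule Bochner_Integration.integrable_bound[of M "\<lambda>\<omega>. 4 * m * (?y \<omega>) ^ 4 + (4 / m + 2) * (?a \<omega>) ^ 4"])
      (use y4 a Fle Fpm in \<open>auto intro!: AE_I2 intro: order_trans[OF _ abs_ge_self]\<close>)
  have Fv: "expectation (\<lambda>\<omega>. (F (X_pop S \<omega>, ?y \<omega>))\<^sup>2) \<le> v"
  proof -
    have "expectation (\<lambda>\<omega>. (F (X_pop S \<omega>, ?y \<omega>))\<^sup>2) \<le> expectation (\<lambda>\<omega>. 4 * m * (?y \<omega>) ^ 4 + (4 / m + 2) * (?a \<omega>) ^ 4)"
      using iF y4 a Fle by (intro integral_mono) auto
    also have "\<dots> = 4 * m * expectation (\<lambda>\<omega>. (?y \<omega>) ^ 4) + (4 / m + 2) * expectation (\<lambda>\<omega>. (?a \<omega>) ^ 4)"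
      using y4 a by simp
    also have "\<dots> \<le> 4 * m * (2304 * V\<^sup>2) + (4 / m + 2) * (4 * m\<^sup>2)"
      using y4 a \<open>m > 0\<close> by (intro add_mono mult_left_mono) auto
    also have "\<dots> = v" using \<open>m > 0\<close> by (simp add: v_def field_simps power2_eq_square)
    finally show ?thesis .
  qed
  define g where "g i \<omega> = F (X_smp S i \<omega>, y_smp S i \<omega>)" for i \<omega>
  have low: "prob {\<omega> \<in> space M. (\<Sum>i=1..n. g i \<omega>) \<le> ?ns / 2} \<le> q1"
    unfolding q1_def
  proof (rule chebyshev_lower_tail_sum[OF _ n _ _ s])
    show "indep_vars (\<lambda>_. borel) g {1..n}"
      unfolding g_def[abs_def] by (rule indep_vars_compose2[OF sample_indep]) (rule Fm)
    fix i assume i: "i \<in> {1..n}"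
    have F2: "(\<lambda>p. (F p)\<^sup>2) \<in> borel_measurable (MX \<Otimes>\<^sub>M borel)" using Fm by measurable
    show "sq_int M (g i)"
      using smp_integral(2)[OF i F2] iF measurable_compose[OF smp_measurable[OF i] Fm]
      by (simp add: sq_int_def g_def[abs_def])
    show "expectation (g i) = signal S" using smp_integral(1)[OF i Fm] Fmean by (simp add: g_def[abs_def])
    show "expectation (\<lambda>\<omega>. (g i \<omega>)\<^sup>2) \<le> v" using smp_integral(1)[OF i F2] Fv by (simp add: g_def)
  qed
  have gain_ge: "(\<Sum>i=1..n. g i \<omega>) \<le> gain id \<omega>" for \<omega>
    using fitted_gain_upper[OF orth(1), where A = "{1..n}" and y = "\<lambda>i. y_smp S i \<omega>" and X = "\<lambda>i. X_smp S i \<omega>"]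
    by (simp add: gain_def g_def F_def)
  define q2 where "q2 \<pi> = 2 / ?ns * (2304 * V * real (rk S * d2) + 24 * V * real (card {i \<in> {1..n}. \<pi> i = i}))" for \<pi>
  have high: "prob {\<omega> \<in> space M. ?ns / 2 \<le> gain \<pi> \<omega>} \<le> q2 \<pi>" if \<pi>: "\<pi> permutes {1..n}" for \<pi>
  proof -
    let ?E = "{\<omega> \<in> space M. ?ns / 2 \<le> gain \<pi> \<omega>}"
    have E: "?E \<in> sets M" using gain_measurable[OF \<pi>] by measurable
    have "ennreal (prob ?E) = (\<integral>\<^sup>+\<omega>. indicator ?E \<omega> \<partial>M)" using E by (simp add: emeasure_eq_measure)
    also have "\<dots> \<le> (\<integral>\<^sup>+\<omega>. ennreal (2 / ?ns) * ennreal (gain \<pi> \<omega>) \<partial>M)"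
    proof (rule nn_integral_mono)
      fix \<omega>
      show "indicator ?E \<omega> \<le> ennreal (2 / ?ns) * ennreal (gain \<pi> \<omega>)"
      proof (cases "\<omega> \<in> ?E")
        case True
        then have "1 \<le> 2 / ?ns * gain \<pi> \<omega>" using ns by (simp add: field_simps)
        then have "ennreal 1 \<le> ennreal (2 / ?ns * gain \<pi> \<omega>)" by (rule ennreal_leI)
        also have "\<dots> = ennreal (2 / ?ns) * ennreal (gain \<pi> \<omega>)" using ns by (intro ennreal_mult') simp
        finally show ?thesis using True by simp
      qed simp
    qed
    also have "\<dots> = ennreal (2 / ?ns) * (\<integral>\<^sup>+\<omega>. ennreal (gain \<pi> \<omega>) \<partial>M)"
      using gain_measurable[OF \<pi>] by (intro nn_integral_cmult) measurable
    also have "\<dots> \<le> ennreal (2 / ?ns) * ennreal (2304 * V * real (rk S * d2) + 24 * V * real (card {i \<in> {1..n}. \<pi> i = i}))"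
      unfolding gain_def
      by (intro mult_left_mono permuted_gain_expectation[OF sample_indep finite_atLeastAtMost y_smp_mgf[OF _ mgf] V dims \<pi>]) auto
    also have "\<dots> = ennreal (q2 \<pi>)"
      unfolding q2_def by (rule ennreal_mult'[symmetric]) (use ns in simp)
    finally show ?thesis using ns V by (subst (asm) ennreal_le_iff) (auto simp: q2_def)
  qed
  have each: "prob {\<omega> \<in> space M. gain id \<omega> \<le> gain \<pi> \<omega>} \<le> q1 + q2 \<pi>" if \<pi>: "\<pi> permutes {1..n}" for \<pi>
  proof -
    note [measurable] = gain_measurable[OF \<pi>] gain_measurable[OF permutes_id]
    have gm[measurable]: "(\<lambda>\<omega>. \<Sum>i=1..n. g i \<omega>) \<in> borel_measurable M"
      unfolding g_def by (intro borel_measurable_sum measurable_compose[OF smp_measurable Fm]) auto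
    have "prob {\<omega> \<in> space M. gain id \<omega> \<le> gain \<pi> \<omega>} \<le>
        prob ({\<omega> \<in> space M. (\<Sum>i=1..n. g i \<omega>) \<le> ?ns / 2} \<union> {\<omega> \<in> space M. ?ns / 2 \<le> gain \<pi> \<omega>})"
    proof (rule finite_measure_mono)
      show "{\<omega> \<in> space M. gain id \<omega> \<le> gain \<pi> \<omega>} \<subseteq>
          {\<omega> \<in> space M. (\<Sum>i=1..n. g i \<omega>) \<le> ?ns / 2} \<union> {\<omega> \<in> space M. ?ns / 2 \<le> gain \<pi> \<omega>}"
      proof
        fix \<omega> assume "\<omega> \<in> {\<omega> \<in> space M. gain id \<omega> \<le> gain \<pi> \<omega>}"
        moreover from this have "(\<Sum>i=1..n. g i \<omega>) \<le> gain \<pi> \<omega>" using gain_ge[of \<omega>] by simp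
        then have "(\<Sum>i=1..n. g i \<omega>) \<le> ?ns / 2 \<or> ?ns / 2 \<le> gain \<pi> \<omega>" by linarith
        ultimately show "\<omega> \<in> {\<omega> \<in> space M. (\<Sum>i=1..n. g i \<omega>) \<le> ?ns / 2} \<union> {\<omega> \<in> space M. ?ns / 2 \<le> gain \<pi> \<omega>}"
          by blast
      qed
    qed measurable
    also have "\<dots> \<le> prob {\<omega> \<in> space M. (\<Sum>i=1..n. g i \<omega>) \<le> ?ns / 2} + prob {\<omega> \<in> space M. ?ns / 2 \<le> gain \<pi> \<omega>}"
      by (intro measure_Un_le) measurable
    also have "\<dots> \<le> q1 + q2 \<pi>" by (intro add_mono low high[OF \<pi>])
    finally show ?thesis .
  qed
  define Q where "Q = q1 + 2 / ?ns * (2304 * V * real (rk S * d2) + 24 * V)"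
  define Ev where "Ev \<pi> = {\<omega> \<in> space M. gain id \<omega> \<le> gain \<pi> \<omega>}" for \<pi>
  have Em: "Ev \<pi> \<in> sets M" if "\<pi> \<in> ?P" for \<pi>
    unfolding Ev_def
    by (rule borel_measurable_le[OF gain_measurable[OF permutes_id] gain_measurable]) (use that in simp)
  have int_Ev: "integrable M (indicat_real (Ev \<pi>))" if "\<pi> \<in> ?P" for \<pi>
    by (rule integrable_real_indicator[OF Em[OF that]]) (simp add: less_top[symmetric])
  have pv_eq: "gain_p_value \<omega> = (\<Sum>\<pi>\<in>?P. indicator (Ev \<pi>) \<omega>) / fact n" if "\<omega> \<in> space M" for \<omega>
    unfolding gain_p_value_def using that
    by (intro arg_cong[where f = "\<lambda>x. x / fact n"] sum.cong) (auto simp: indicator_def Ev_def)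
  have pv_int: "integrable M gain_p_value"
    by (subst Bochner_Integration.integrable_cong[OF refl pv_eq])
      (auto intro!: Bochner_Integration.integrable_sum int_Ev simp del: atLeastAtMost_iff)
  have "expectation gain_p_value = expectation (\<lambda>\<omega>. (\<Sum>\<pi>\<in>?P. indicator (Ev \<pi>) \<omega>) / fact n)"
    by (rule Bochner_Integration.integral_cong[OF refl pv_eq])
  also have "\<dots> = (\<Sum>\<pi>\<in>?P. expectation (indicat_real (Ev \<pi>))) / fact n"
  proof -
    have "expectation (\<lambda>\<omega>. \<Sum>\<pi>\<in>?P. indicator (Ev \<pi>) \<omega>) = (\<Sum>\<pi>\<in>?P. expectation (indicat_real (Ev \<pi>)))"
      by (rule Bochner_Integration.integral_sum[OF int_Ev])
    then show ?thesis by simp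
  qed
  also have "\<dots> = (\<Sum>\<pi>\<in>?P. prob {\<omega> \<in> space M. gain id \<omega> \<le> gain \<pi> \<omega>}) / fact n"
    by (intro arg_cong[where f = "\<lambda>x. x / fact n"] sum.cong refl)
      (simp add: Ev_def Collect_conj_eq Int_ac)
  also have "\<dots> \<le> (\<Sum>\<pi>\<in>?P. q1 + q2 \<pi>) / fact n"
    using each by (intro divide_right_mono sum_mono) auto
  also have "(\<Sum>\<pi>\<in>?P. q1 + q2 \<pi>) = fact n * Q"
  proof -
    have "(\<Sum>\<pi>\<in>?P. real (card {i \<in> {1..n}. \<pi> i = i})) = fact n"
    proof -
      have "(\<Sum>\<pi>\<in>?P. card {i \<in> {1..n}. \<pi> i = i}) = fact n"
        using sum_card_fixed_points[of "{1..n}"] n by simp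
      then have "real (\<Sum>\<pi>\<in>?P. card {i \<in> {1..n}. \<pi> i = i}) = real (fact n)" by (rule arg_cong)
      then show ?thesis by simp
    qed
    then show ?thesis
      unfolding q2_def Q_def sum.distrib sum_distrib_left[symmetric]
      using card_perms by (simp add: algebra_simps)
  qed
  finally have Ep: "expectation gain_p_value \<le> Q" by simp
  have pv0: "0 \<le> gain_p_value \<omega>" for \<omega>
    unfolding gain_p_value_def by (intro divide_nonneg_pos sum_nonneg) auto
  have "prob {\<omega> \<in> space M. \<alpha> \<le> gain_p_value \<omega>} \<le> expectation gain_p_value / \<alpha>"
  proof (rule integral_Markov_inequality_measure[where A = "{}"])
    show "integrable M gain_p_value" by (rule pv_int)
    show "AE \<omega> in M. 0 \<le> gain_p_value \<omega>" by (intro AE_I2 pv0)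
    show "0 < \<alpha>" by (rule \<alpha>)
  qed simp
  also have "\<dots> \<le> Q / \<alpha>" using Ep \<alpha> by (intro divide_right_mono) auto
  finally have hi: "prob {\<omega> \<in> space M. \<alpha> \<le> gain_p_value \<omega>} \<le> Q / \<alpha>" .
  have "1 = prob (space M)" by (simp add: prob_space)
  also have "space M = {\<omega> \<in> space M. gain_p_value \<omega> \<le> \<alpha>} \<union> {\<omega> \<in> space M. \<alpha> \<le> gain_p_value \<omega>}"
    using linear by blast
  also have "prob \<dots> \<le> prob {\<omega> \<in> space M. gain_p_value \<omega> \<le> \<alpha>} + prob {\<omega> \<in> space M. \<alpha> \<le> gain_p_value \<omega>}"
    by (intro measure_Un_le borel_measurable_le borel_measurable_const gain_p_value_measurable)
  finally have bound: "1 - Q / \<alpha> \<le> prob {\<omega> \<in> space M. gain_p_value \<omega> \<le> \<alpha>}" using hi by linarith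
  have Q_eq: "Q = 4 * (m * (9216 * V\<^sup>2 + 16 + 8 * m)) / (real n * (signal S)\<^sup>2) +
      2 * (2304 * V * real (rk S * d2) + 24 * V) / ?ns"
    unfolding Q_def q1_def v_def by (simp only: times_divide_eq_left)
  show ?thesis by (rule bound[unfolded Q_eq])
qed

lemma linear_response_exp_square_moment_equiv:
  assumes equiv: "psi2_moment_equiv \<kappa> S" and "\<kappa> > 0" and T: "Theta_tilde S \<in> carrier_mat d1 d2" and s: "signal S > 0"
  shows "(\<integral>\<^sup>+\<omega>. ennreal (exp ((linear_response (Theta_tilde S) \<omega>)\<^sup>2 / (2 * \<kappa> * signal S))) \<partial>M) \<le> 2"
proof -
  let ?p = "psi2_norm M (\<lambda>\<omega>. vectorize (X_pop S \<omega>) \<bullet> vectorize (Theta_tilde S))"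
  define t where "t = sqrt (2 * \<kappa> * signal S)"
  have ks: "\<kappa> * signal S > 0" using \<open>\<kappa> > 0\<close> s by simp
  have t: "t > 0" "t\<^sup>2 = 2 * \<kappa> * signal S" using ks by (auto simp: t_def mult.assoc)
  have "expectation (\<lambda>\<omega>. (vectorize (X_pop S \<omega>) \<bullet> vectorize (Theta_tilde S))\<^sup>2) = signal S"
    unfolding signal_eq[OF T] by (intro Bochner_Integration.integral_cong refl) (simp add: linear_response_eq_vec[OF T])
  then have p2: "?p\<^sup>2 \<le> ereal (\<kappa> * signal S)"
    using equiv vectorize_carrier[OF T] unfolding psi2_moment_equiv_def by metis
  have "?p < ereal t"
  proof (rule ccontr)
    assume "\<not> ?p < ereal t"
    then have "ereal t \<le> ?p" by simp
    then have "ereal t * ereal t \<le> ?p * ?p"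
      using t(1) by (intro ereal_mult_mono) (auto intro: order_trans[of 0 "ereal t"])
    also have "\<dots> \<le> ereal (\<kappa> * signal S)" using p2 by (simp add: power2_eq_square)
    finally have "t\<^sup>2 \<le> \<kappa> * signal S" by (simp add: power2_eq_square)
    then show False using t(2) ks by simp
  qed
  from psi2_norm_less_exp_square[OF this t(1)]
  show ?thesis by (simp add: t(2) linear_response_eq_vec[OF T] cong: nn_integral_cong)
qed

text \<open>
  The two alternatives enter only through the scale \<open>m\<close> and through the bound \<open>c / h\<close> on the error
  probability of Chebyshev's inequality.
\<close>

lemma power_at_scale:
  fixes \<alpha> B m c h :: real
  defines "V \<equiv> 2 * ((\<bar>K\<^sub>x\<bar> + 1)\<^sup>2 * (\<bar>B\<bar> + 1)\<^sup>2 + (\<bar>K\<^sub>\<epsilon>\<bar> + 1)\<^sup>2)"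
  assumes \<alpha>: "0 < \<alpha>" "\<alpha> < 1"
    and best: "best_rank_approx S" and B: "frobenius_norm (Theta_star S) \<le> B" and m: "m > 0"
    and psi: "(\<integral>\<^sup>+\<omega>. ennreal (exp ((linear_response (Theta_tilde S) \<omega>)\<^sup>2 / m)) \<partial>M) \<le> 2"
    and s: "signal S > 0" and n: "n \<ge> 1"
    and h: "h > 0" "2 * (c + 4656 * V) / (\<alpha> * (1 - \<alpha>)) \<le> h"
    and ns: "h * real (rk S * d2) \<le> real n * signal S"
    and var: "4 * (m * (9216 * V\<^sup>2 + 16 + 8 * m)) / (real n * (signal S)\<^sup>2) \<le> c / h"
  shows "(1 + \<alpha>) / 2 \<le> reject_prob \<alpha> n S"
proof -
  define R where "R = real (rk S * d2)"
  let ?Q = "4 * (m * (9216 * V\<^sup>2 + 16 + 8 * m)) / (real n * (signal S)\<^sup>2) +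
      2 * (2304 * V * R + 24 * V) / (real n * signal S)"
  have V: "V > 0" unfolding V_def by (simp add: add_nonneg_pos add_pos_pos)
  have R: "R \<ge> 1" using dims by (simp add: R_def flip: of_nat_mult)
  have "2 * (2304 * V * R + 24 * V) / (real n * signal S) \<le> 4656 * V / h"
    by (rule permutation_noise_term_bound[OF V R h(1) ns[folded R_def]])
  with var have "?Q \<le> (c + 4656 * V) / h" unfolding add_divide_distrib by (rule add_mono)
  then have "(1 + \<alpha>) / 2 \<le> 1 - ?Q / \<alpha>" by (rule power_from_error_bound[OF \<alpha> h])
  also have "\<dots> \<le> reject_prob \<alpha> n S"
    unfolding reject_prob_eq R_def V_def
    by (rule rejection_lower_bound[OF best B m psi s n \<alpha>(1)])
  finally show ?thesis .
qed

end

lemma less_liminf_of_eventually_ge: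
  assumes "\<alpha> < 1" and "\<forall>\<^sub>F n in sequentially. (1 + \<alpha>) / 2 \<le> f n"
  shows "ereal \<alpha> < liminf (\<lambda>n. ereal (f n))"
proof -
  have "ereal \<alpha> < ereal ((1 + \<alpha>) / 2)" using assms(1) by simp
  also have "\<dots> \<le> liminf (\<lambda>n. ereal (f n))"
    by (rule Liminf_bounded) (use assms(2) in simp)
  finally show ?thesis .
qed

lemma one_le_ln: "n \<ge> 3 \<Longrightarrow> 1 \<le> ln (real n)"
proof -
  assume "n \<ge> 3"
  then have "exp 1 \<le> real n" using exp_le by linarith
  then show ?thesis using \<open>n \<ge> 3\<close> by (simp add: ln_ge_iff)
qed

theorem theorem8:
  fixes \<alpha> K\<^sub>x K\<^sub>\<epsilon> \<sigma> B :: real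
  assumes "0 < \<alpha>" and "\<alpha> < 1"
  shows
    "(\<forall>S :: nat \<Rightarrow> 'w trace_regression.
        (\<forall>\<^sub>F n in sequentially.
           trace_regression_model K\<^sub>x K\<^sub>\<epsilon> \<sigma> n (S n) \<and>
           Theta_star (S n) = 0\<^sub>m (nrow (S n)) (ncol (S n)))
        \<longrightarrow> limsup (\<lambda>n. ereal (reject_prob \<alpha> n (S n))) \<le> ereal \<alpha>) \<and>
     (\<exists>h\<^sub>0>0. \<forall>h\<ge>h\<^sub>0. \<forall>S :: nat \<Rightarrow> 'w trace_regression.
        (\<forall>\<^sub>F n in sequentially.
           trace_regression_model K\<^sub>x K\<^sub>\<epsilon> \<sigma> n (S n) \<and> best_rank_approx (S n) \<and>
           frobenius_norm (Theta_star (S n)) \<le> B \<and> frobenius_norm (Theta_tilde (S n)) \<le> B \<and>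
           signal (S n) =
             h * (1 / sqrt (real n) + real (rk (S n)) * real (ncol (S n)) * ln (real n) / real n))
        \<longrightarrow> ereal \<alpha> < liminf (\<lambda>n. ereal (reject_prob \<alpha> n (S n)))) \<and>
     (\<forall>\<kappa>>0. \<exists>h\<^sub>0>0. \<forall>h\<ge>h\<^sub>0. \<forall>S :: nat \<Rightarrow> 'w trace_regression.
        (\<forall>\<^sub>F n in sequentially.
           trace_regression_model K\<^sub>x K\<^sub>\<epsilon> \<sigma> n (S n) \<and> best_rank_approx (S n) \<and>
           psi2_moment_equiv \<kappa> (S n) \<and>
           frobenius_norm (Theta_star (S n)) \<le> B \<and> frobenius_norm (Theta_tilde (S n)) \<le> B \<and>
           signal (S n) =
             h * (real (rk (S n)) * real (ncol (S n)) * ln (real n) / real n))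
        \<longrightarrow> ereal \<alpha> < liminf (\<lambda>n. ereal (reject_prob \<alpha> n (S n))))"
proof -
  define m0 where "m0 = (\<bar>K\<^sub>x\<bar> + 1)\<^sup>2 * (\<bar>B\<bar> + 1)\<^sup>2"
  define V where "V = 2 * (m0 + (\<bar>K\<^sub>\<epsilon>\<bar> + 1)\<^sup>2)"
  have m0: "m0 > 0" by (simp add: m0_def add_nonneg_pos)
  have null: "limsup (\<lambda>n. ereal (reject_prob \<alpha> n (S n))) \<le> ereal \<alpha>"
    if ev: "\<forall>\<^sub>F n in sequentially. trace_regression_model K\<^sub>x K\<^sub>\<epsilon> \<sigma> n (S n) \<and>
           Theta_star (S n) = 0\<^sub>m (nrow (S n)) (ncol (S n))" for S :: "nat \<Rightarrow> 'w trace_regression"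
  proof (rule Limsup_bounded)
    show "\<forall>\<^sub>F n in sequentially. ereal (reject_prob \<alpha> n (S n)) \<le> ereal \<alpha>"
      using ev eventually_ge_at_top[of 1]
    proof eventually_elim
      case (elim n)
      then interpret trace_regression_instance K\<^sub>x K\<^sub>\<epsilon> \<sigma> n "S n" by unfold_locales simp
      show ?case using null_level[of \<alpha>] elim assms by (simp add: reject_prob_eq)
    qed
  qed
  define c2 where "c2 = 4 * (m0 * (9216 * V\<^sup>2 + 16 + 8 * m0))"
  have c2: "c2 > 0" using m0 unfolding c2_def by (intro mult_pos_pos add_nonneg_pos) auto
  define h2 where "h2 = max 1 (2 * (c2 + 4656 * V) / (\<alpha> * (1 - \<alpha>)))"
  have power2: "ereal \<alpha> < liminf (\<lambda>n. ereal (reject_prob \<alpha> n (S n)))"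
    if h: "h \<ge> h2" and ev: "\<forall>\<^sub>F n in sequentially.
           trace_regression_model K\<^sub>x K\<^sub>\<epsilon> \<sigma> n (S n) \<and> best_rank_approx (S n) \<and>
           frobenius_norm (Theta_star (S n)) \<le> B \<and> frobenius_norm (Theta_tilde (S n)) \<le> B \<and>
           signal (S n) =
             h * (1 / sqrt (real n) + real (rk (S n)) * real (ncol (S n)) * ln (real n) / real n)"
    for h and S :: "nat \<Rightarrow> 'w trace_regression"
  proof (rule less_liminf_of_eventually_ge[OF assms(2)])
    show "\<forall>\<^sub>F n in sequentially. (1 + \<alpha>) / 2 \<le> reject_prob \<alpha> n (S n)"
      using ev eventually_ge_at_top[of 3]
    proof eventually_elim
      case (elim n)
      then interpret trace_regression_instance K\<^sub>x K\<^sub>\<epsilon> \<sigma> n "S n" by unfold_locales simp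
      define R where "R = real (rk (S n) * ncol (S n))"
      define s where "s = signal (S n)"
      have h1: "h \<ge> 1" "2 * (c2 + 4656 * V) / (\<alpha> * (1 - \<alpha>)) \<le> h" using h by (auto simp: h2_def)
      have npos: "real n > 0" using elim by simp
      have s_eq: "s = h * (1 / sqrt (real n) + R * ln (real n) / real n)"
        using elim by (simp add: s_def R_def)
      have "1 \<le> ln (real n)" using elim by (intro one_le_ln) simp
      then have Rl: "R \<le> R * ln (real n)" using mult_left_mono[of 1 "ln (real n)" R] by (simp add: R_def)
      have Rn: "R * ln (real n) / real n \<ge> 0"
        using Rl npos by (intro divide_nonneg_pos) (auto simp: R_def intro: order_trans)
      have s1: "h / sqrt (real n) \<le> s"
        using mult_left_mono[of "1 / sqrt (real n)" "1 / sqrt (real n) + R * ln (real n) / real n" h] Rn h1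
        by (simp add: s_eq)
      then have s: "s > 0" using h1 npos by (smt (verit) divide_pos_pos real_sqrt_gt_zero)
      have "h * R \<le> h * (R * ln (real n))" using Rl h1 by simp
      also have "\<dots> = real n * (h * (R * ln (real n) / real n))" using npos by simp
      also have "\<dots> \<le> real n * s"
        unfolding s_eq using npos h1 by (intro mult_left_mono) auto
      finally have ns: "h * R \<le> real n * s" .
      have "h \<le> h\<^sup>2" using h1 by (simp add: power2_eq_square)
      also have "h\<^sup>2 = real n * (h / sqrt (real n))\<^sup>2" using npos by (simp add: power_divide)
      also have "\<dots> \<le> real n * s\<^sup>2" using s1 h1 npos by (intro mult_left_mono power_mono) auto
      finally have ns2: "h \<le> real n * s\<^sup>2" .
      have tilde: "Theta_tilde (S n) \<in> carrier_mat (nrow (S n)) (ncol (S n))"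
        using elim by (auto simp: best_rank_approx_def is_arg_min_linorder low_rank_mats_def)
      have psi: "(\<integral>\<^sup>+\<omega>. ennreal (exp ((linear_response (Theta_tilde (S n)) \<omega>)\<^sup>2 / m0)) \<partial>Pr (S n)) \<le> 2"
        unfolding m0_def by (rule linear_response_exp_square[OF tilde]) (use elim in simp)
      have "c2 / (real n * s\<^sup>2) \<le> c2 / h"
        using ns2 h1 c2 npos s by (intro divide_left_mono mult_pos_pos) auto
      then show ?case
        using power_at_scale[of \<alpha> B m0 h c2] elim assms m0 psi s ns h1
        unfolding c2_def V_def m0_def[symmetric] s_def R_def by simp
    qed
  qed
  have power3: "ereal \<alpha> < liminf (\<lambda>n. ereal (reject_prob \<alpha> n (S n)))"
    if "\<kappa> > 0"
      and h: "h \<ge> max 1 (2 * (4 * (2 * \<kappa> * (9216 * V\<^sup>2 + 16 + 32 * \<kappa> * m0)) + 4656 * V) / (\<alpha> * (1 - \<alpha>)))"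
      and ev: "\<forall>\<^sub>F n in sequentially.
           trace_regression_model K\<^sub>x K\<^sub>\<epsilon> \<sigma> n (S n) \<and> best_rank_approx (S n) \<and>
           psi2_moment_equiv \<kappa> (S n) \<and>
           frobenius_norm (Theta_star (S n)) \<le> B \<and> frobenius_norm (Theta_tilde (S n)) \<le> B \<and>
           signal (S n) =
             h * (real (rk (S n)) * real (ncol (S n)) * ln (real n) / real n)"
    for \<kappa> h and S :: "nat \<Rightarrow> 'w trace_regression"
  proof (rule less_liminf_of_eventually_ge[OF assms(2)])
    \<comment> \<open>The scale is \<open>m = 2 * \<kappa> * s\<close>, and \<open>s \<le> 2 * m0\<close> turns the quadratic term of the variance bound
       into a linear one, so that the variance is at most \<open>C * s\<close>.\<close>
    define C where "C = 2 * \<kappa> * (9216 * V\<^sup>2 + 16 + 32 * \<kappa> * m0)"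
    have C: "C > 0"
      unfolding C_def using \<open>\<kappa> > 0\<close> m0 by (intro mult_pos_pos add_nonneg_pos) auto
    have h1: "h \<ge> 1" "2 * (4 * C + 4656 * V) / (\<alpha> * (1 - \<alpha>)) \<le> h" using h by (auto simp: C_def)
    show "\<forall>\<^sub>F n in sequentially. (1 + \<alpha>) / 2 \<le> reject_prob \<alpha> n (S n)"
      using ev eventually_ge_at_top[of 3]
    proof eventually_elim
      case (elim n)
      then interpret trace_regression_instance K\<^sub>x K\<^sub>\<epsilon> \<sigma> n "S n" by unfold_locales simp
      define R where "R = real (rk (S n) * ncol (S n))"
      define s where "s = signal (S n)"
      have R: "R \<ge> 1" using dims by (simp add: R_def flip: of_nat_mult)
      have npos: "real n > 0" using elim by simp
      have "1 \<le> ln (real n)" using elim by (intro one_le_ln) simp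
      then have Rl: "R * ln (real n) \<ge> R" using R mult_left_mono[of 1 "ln (real n)" R] by simp
      have "h * R \<le> h * (R * ln (real n))" using Rl h1 by simp
      also have "\<dots> = real n * s" using elim npos by (simp add: s_def R_def)
      finally have ns: "h * R \<le> real n * s" .
      have "h \<le> h * R" using R h1 by simp
      then have hns: "h \<le> real n * s" using ns by linarith
      then have s: "s > 0" using h1 npos by (smt (verit) zero_less_mult_pos)
      have tilde: "Theta_tilde (S n) \<in> carrier_mat (nrow (S n)) (ncol (S n))"
        using elim by (auto simp: best_rank_approx_def is_arg_min_linorder low_rank_mats_def)
      have psi0: "(\<integral>\<^sup>+\<omega>. ennreal (exp ((linear_response (Theta_tilde (S n)) \<omega>)\<^sup>2 / m0)) \<partial>Pr (S n)) \<le> 2"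
        unfolding m0_def by (rule linear_response_exp_square[OF tilde]) (use elim in simp)
      have s_le: "s \<le> 2 * m0"
        unfolding s_def signal_eq[OF tilde] by (rule exp_square_moments(2)[OF linear_response_measurable[OF tilde] m0 psi0])
      have psi: "(\<integral>\<^sup>+\<omega>. ennreal (exp ((linear_response (Theta_tilde (S n)) \<omega>)\<^sup>2 / (2 * \<kappa> * s))) \<partial>Pr (S n)) \<le> 2"
        unfolding s_def by (rule linear_response_exp_square_moment_equiv) (use elim tilde s \<open>\<kappa> > 0\<close> in \<open>auto simp: s_def\<close>)
      have ks: "2 * \<kappa> * s > 0" using \<open>\<kappa> > 0\<close> s by simp
      have "9216 * V\<^sup>2 + 16 + 8 * (2 * \<kappa> * s) \<le> 9216 * V\<^sup>2 + 16 + 32 * \<kappa> * m0"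
        using mult_left_mono[OF s_le, of "16 * \<kappa>"] \<open>\<kappa> > 0\<close> by simp
      then have "2 * \<kappa> * s * (9216 * V\<^sup>2 + 16 + 8 * (2 * \<kappa> * s)) \<le> 2 * \<kappa> * s * (9216 * V\<^sup>2 + 16 + 32 * \<kappa> * m0)"
        using ks by (intro mult_left_mono) auto
      also have "\<dots> = C * s" by (simp add: C_def mult_ac)
      finally have "4 * (2 * \<kappa> * s * (9216 * V\<^sup>2 + 16 + 8 * (2 * \<kappa> * s))) / (real n * s\<^sup>2) \<le> 4 * (C * s) / (real n * s\<^sup>2)"
        using npos by (intro divide_right_mono) auto
      also have "\<dots> = 4 * C / (real n * s)" using s by (simp add: power2_eq_square)
      also have "\<dots> \<le> 4 * C / h" using hns h1 C npos s by (intro divide_left_mono mult_pos_pos) auto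
      finally have var: "4 * (2 * \<kappa> * s * (9216 * V\<^sup>2 + 16 + 8 * (2 * \<kappa> * s))) / (real n * s\<^sup>2) \<le> 4 * C / h" .
      show ?case
        by (rule power_at_scale[OF assms _ _ ks psi, where h = h and c = "4 * C"])
          (use elim var s ns h1 in \<open>simp_all add: V_def m0_def s_def R_def\<close>)
    qed
  qed
  have h0_pos: "max 1 x > 0" for x :: real by simp
  show ?thesis
    apply (intro conjI allI impI)
      apply (erule null)
     apply (rule exI[of _ h2], intro conjI allI impI)
      apply (simp add: h2_def)
     apply (erule (1) power2)
    subgoal for \<kappa>
      apply (rule exI[of _ "max 1 (2 * (4 * (2 * \<kappa> * (9216 * V\<^sup>2 + 16 + 32 * \<kappa> * m0)) + 4656 * V) / (\<alpha> * (1 - \<alpha>)))"],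
          intro conjI allI impI)
       apply (rule h0_pos)
      apply (erule (2) power3)
      done
    done
qed

end
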